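(* Quantum positivity fails for the quantum theta basis. That is, there exist a quantum cluster algebra of skew-symmetrizable type (fixed data, an initial seed $\mathbf s$ and a compatible form $\Lambda$) and an element $m\in M^\circ$ such that the quantum theta function $\vartheta_m$, expressed in terms of the initial quantum cluster variables (i.e. written as $\vartheta_{Q,m}=\sum_{u\in M^\circ}\alpha_uA^u$ for $Q$ a general point of the initial chamber), has a coefficient $\alpha_u$ which lies in $\mathbb Z[q^{\pm1/2}]$ but not in $\mathbb Z_{\ge0}[q^{\pm1/2}]$.
   Context: Data: $I$ a finite set with a subset $I_{\mathrm{uf}}$; $N$ a lattice with basis $\mathbf s=(e_i)_{i\in I}$ (the initial seed); $\{\cdot,\cdot\}$ a skew-symmetric $\mathbb Q$-valued form on $N$; $(d_i)_{i\in I}$ positive integers with gcd $1$, such that $\epsilon_{ij}=\{e_i,e_j\}d_j\in\mathbb Z$; $N^\circ=\bigoplus_i\mathbb Zd_ie_i$; $M^\circ=\operatorname{Hom}(N^\circ,\mathbb Z)$ with basis $(f_i)$ dual to $(d_ie_i)$; $d=\mathrm{lcm}(d_i)$. The data are of skew-symmetrizable type (the $d_i$ need not all equal $1$). $N_{\mathrm{uf}}$ is spanned by $e_i$, $i\in I_{\mathrm{uf}}$, and $p_1^*:N_{\mathrm{uf}}\to M^\circ$, $n\mapsto\{n,\cdot\}$. A compatible form is a skew-symmetric integer form $\Lambda$ on $M^\circ$ with $\Lambda(p_1^*(e_k),f_j)=\delta_{kj}d/d_k$ for $k\in I_{\mathrm{uf}},j\in I$ (in particular $p_1^*$ is injective).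 Put $v=q^{-1/2}$. The initial quantum torus has basis $A^m$, $m\in M^\circ$, with $A^mA^{m'}=q^{\frac12\Lambda(m,m')}A^{m+m'}=v^{-\Lambda(m,m')}A^{m+m'}$; the initial quantum cluster variables are $A_i=A^{f_i}$. Let $N^+=\{\sum_{i\in I_{\mathrm{uf}}}a_ie_i:a_i\in\mathbb Z_{\ge0},\sum a_i>0\}$ and $\deg(\sum a_ie_i)=\sum a_i$. Work with coefficients in $\mathbb Q(v)$ and in the completion consisting of formal sums $\sum c_mA^m$ supported in finitely many translates $m_0+p_1^*(N^+\cup\{0\})$. Let $\mathfrak g=\bigoplus_{n\in N^+}\mathbb Q(v)A^{p_1^*(n)}$ with the commutator bracket, let $\hat{\mathfrak g}$ be its completion by degree and $G=\exp\hat{\mathfrak g}$. An element $g\in G$ acts on the completed quantum torus by $\theta_g(x)=g^{-1}xg$. A wall is a pair $(\mathfrak d,g)$ where, for some primitive $n\in N^+$, $g\in\exp\bigl(\prod_{k\ge1}\mathbb Q(v)A^{kp_1^*(n)}\bigr)$ and $\mathfrak d\subset n^\perp\subset M^\circ_{\mathbb R}$ is a closed convex rational polyhedral codimension-one cone; the wall is outgoing if $p_1^*(n)\notin\mathfrak d$ and incoming otherwise. A scattering diagram is a collection of walls such that, for each $k$, only finitely many have $g$ nontrivial modulo degree $>k$. Its singular locus is the union of the boundaries of walls and of the codimension-two intersections of walls. A generic path $\gamma$ avoiding the singular locus and transverse to the walls has path-ordered product the composition of the automorphisms $\theta_{g}^{\operatorname{sgn}\langle n,-\gamma'\rangle}$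 of the walls crossed, the first crossed applied first (taken as a limit over degrees). The diagram is consistent if this depends only on the endpoints of $\gamma$. The quantum dilogarithm is $\Psi_p(x)=\prod_{\ell\ge1}(1+p^{2\ell-1}x)^{-1}$, regarded as the power series in $x$ with constant term $1$ and coefficients in $\mathbb{Q}(p)$ satisfying $\Psi_p(p^2x)=(1+px)\Psi_p(x)$. The quantum cluster scattering diagram is the unique (up to equivalence, i.e. equality of all path-ordered products) consistent scattering diagram containing the initial walls $\bigl(e_i^\perp,\Psi_{v^{d/d_i}}(A^{p_1^*(e_i)})\bigr)$, $i\in I_{\mathrm{uf}}$, all of whose other walls are outgoing. Quantum theta functions: for $m\in M^\circ\setminus\{0\}$ and a general point $Q\in M^\circ_{\mathbb R}$, a broken line with initial exponent $m$ and endpoint $Q$ is a piecewise linear continuous path $\gamma:(-\infty,0]\to M^\circ_{\mathbb R}$ avoiding the singular locus, with $\gamma(0)=Q$ and finitely many domains of linearity, each decorated by a monomial $c_jA^{m_j}$ with $c_j\ne 0$, such that: the first (unbounded) domain carries $A^m$; on the domain carrying $c_jA^{m_j}$ one has $\gamma'=-m_j$; $\gamma$ bends only when crossing walls, and at a change of domain the new monomial $c_{j+1}A^{m_{j+1}}$ is one of the terms $c A^{u}$ in the expansion (as a sum over distinct exponents $u$) of the wall-crossing automorphism $\theta_g^{\operatorname{sgn}\langle n,-\gamma'\rangle}$ applied to $c_jA^{m_j}$. Then $\vartheta_{Q,m}$ is the sum of the final monomials of all broken lines with initial exponent $m$ and endpoint $Q$, and $\vartheta_{Q,0}=1$. The initial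 chamber is $\{x\in M^\circ_{\mathbb R}:\langle e_i,x\rangle\ge0\ \forall i\in I_{\mathrm{uf}}\}$; for $Q$ general in its interior, $\vartheta_{Q,m}$ is the expansion of the quantum theta function $\vartheta_m$ in the initial quantum cluster variables. *)

theory Defs
  imports
    "HOL-Analysis.Analysis"
    "HOL-Computational_Algebra.Computational_Algebra"
    "HOL-Library.Function_Algebras"
begin

section \<open>Coefficients\<close>

type_synonym coeff = "rat poly fract"

definition v :: coeff where
  "v = Fract [:0, 1:] 1"

definition q_half :: coeff where
  "q_half = inverse v"

text \<open>For \<open>C = \<int>\<close> this is \<open>\<int>[q\<^sup>\<plusminus>\<^sup>1\<^sup>/\<^sup>2]\<close>, for \<open>C = \<int>\<^sub>\<ge>\<^sub>0\<close> it is \<open>\<int>\<^sub>\<ge>\<^sub>0[q\<^sup>\<plusminus>\<^sup>1\<^sup>/\<^sup>2]\<close>.\<close>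

definition laurent_in_q_half :: "int set \<Rightarrow> coeff set" where
  "laurent_in_q_half C =
     {\<Sum>k\<in>K. of_int (a k) * q_half powi k | (K :: int set) a. finite K \<and> (\<forall>k\<in>K. a k \<in> C)}"


section \<open>Fixed data, initial seed and compatible form\<close>

text \<open>
  The finite index set \<open>I\<close> is taken to be a set of natural numbers, and bilinear forms are given by
  their matrices: \<open>sform S i j = {e\<^sub>i, e\<^sub>j}\<close> and \<open>scomp S i j = \<Lambda>(f\<^sub>i, f\<^sub>j)\<close>.
  Elements of \<open>N\<close> are coordinate vectors in the basis \<open>(e\<^sub>i)\<close>; elements of the lattice of \<open>f\<^sub>i\<close>'s and
  of its real extension are coordinate vectors in the basis \<open>(f\<^sub>i)\<close>, which is dual to \<open>(d\<^sub>i e\<^sub>i)\<close>.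
  All coordinates outside \<open>I\<close> vanish.
\<close>

type_synonym lvec = "nat \<Rightarrow> int"
type_synonym rvec = "nat \<Rightarrow> real"

record seed =
  sI :: "nat set"
  suf :: "nat set"
  sform :: "nat \<Rightarrow> nat \<Rightarrow> rat"
  sd :: "nat \<Rightarrow> nat"
  scomp :: "nat \<Rightarrow> nat \<Rightarrow> int"

definition N_lat :: "seed \<Rightarrow> lvec set" where
  "N_lat S = {n. \<forall>i. i \<notin> sI S \<longrightarrow> n i = 0}"

definition M_lat :: "seed \<Rightarrow> lvec set" where
  "M_lat S = {m. \<forall>i. i \<notin> sI S \<longrightarrow> m i = 0}"

definition M_real :: "seed \<Rightarrow> rvec set" where
  "M_real S = {x. \<forall>i. i \<notin> sI S \<longrightarrow> x i = 0}"

definition N_plus :: "seed \<Rightarrow> lvec set" where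
  "N_plus S = {n. (\<forall>i. i \<notin> suf S \<longrightarrow> n i = 0) \<and> (\<forall>i. 0 \<le> n i) \<and> n \<noteq> 0}"

definition unit_vec :: "nat \<Rightarrow> lvec" where
  "unit_vec i = (\<lambda>j. if j = i then 1 else 0)"

definition real_vec :: "lvec \<Rightarrow> rvec" where
  "real_vec m = (\<lambda>i. real_of_int (m i))"

definition deg :: "seed \<Rightarrow> lvec \<Rightarrow> int" where
  "deg S n = (\<Sum>i\<in>suf S. n i)"

text \<open>\<open>\<langle>e\<^sub>i, f\<^sub>j\<rangle> = \<delta>\<^sub>i\<^sub>j / d\<^sub>i\<close>\<close>

definition pairing :: "seed \<Rightarrow> lvec \<Rightarrow> rvec \<Rightarrow> real" where
  "pairing S n x = (\<Sum>i\<in>sI S. real_of_int (n i) * x i / real (sd S i))"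

text \<open>
  The coordinate at \<open>f\<^sub>j\<close> of \<open>{n, \<cdot>}\<close> is its value at \<open>d\<^sub>j e\<^sub>j\<close>, i.e. \<open>\<Sum>\<^sub>i n\<^sub>i \<epsilon>\<^sub>i\<^sub>j\<close>.  This is an integer for
  the seeds considered, so that the floor is only a conversion of types.
\<close>

definition p1star :: "seed \<Rightarrow> lvec \<Rightarrow> lvec" where
  "p1star S n =
     (\<lambda>j. if j \<in> sI S then \<lfloor>\<Sum>i\<in>suf S. of_int (n i) * (sform S i j * of_nat (sd S j))\<rfloor> else 0)"

definition Lam :: "seed \<Rightarrow> lvec \<Rightarrow> lvec \<Rightarrow> int" where
  "Lam S m m' = (\<Sum>i\<in>sI S. \<Sum>j\<in>sI S. m i * m' j * scomp S i j)"

definition d_lcm :: "seed \<Rightarrow> nat" where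
  "d_lcm S = Lcm (sd S ` sI S)"

definition fixed_data :: "seed \<Rightarrow> bool" where
  "fixed_data S \<longleftrightarrow>
     finite (sI S) \<and> suf S \<subseteq> sI S \<and>
     (\<forall>i\<in>sI S. \<forall>j\<in>sI S. sform S i j = - sform S j i) \<and>
     (\<forall>i\<in>sI S. 0 < sd S i) \<and> Gcd (sd S ` sI S) = 1 \<and>
     (\<forall>i\<in>sI S. \<forall>j\<in>sI S. sform S i j * of_nat (sd S j) \<in> \<int>)"

definition compatible_form :: "seed \<Rightarrow> bool" where
  "compatible_form S \<longleftrightarrow>
     (\<forall>i\<in>sI S. \<forall>j\<in>sI S. scomp S i j = - scomp S j i) \<and>
     (\<forall>k\<in>suf S. \<forall>j\<in>sI S.
        Lam S (p1star S (unit_vec k)) (unit_vec j) =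
          (if k = j then int (d_lcm S div sd S k) else 0))"


section \<open>The completed quantum torus\<close>

text \<open>A formal sum \<open>\<Sum>\<^sub>u c\<^sub>u A\<^sup>u\<close> is the function \<open>u \<mapsto> c\<^sub>u\<close>.\<close>

type_synonym qelt = "lvec \<Rightarrow> coeff"

definition qtorus :: "seed \<Rightarrow> qelt set" where
  "qtorus S = {x. \<exists>B. finite B \<and> B \<subseteq> M_lat S \<and>
     (\<forall>u. x u \<noteq> 0 \<longrightarrow> (\<exists>b\<in>B. \<exists>n \<in> N_plus S \<union> {0}. u = b + p1star S n))}"

definition qmono :: "coeff \<Rightarrow> lvec \<Rightarrow> qelt" where
  "qmono c m = (\<lambda>u. if u = m then c else 0)"

text \<open>The sum is finite for elements of the completed torus, as \<open>p1star S\<close> is injective.\<close>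

definition qmul :: "seed \<Rightarrow> qelt \<Rightarrow> qelt \<Rightarrow> qelt" where
  "qmul S x y = (\<lambda>u. \<Sum>(a, b) \<in> {(a, b). a + b = u \<and> x a \<noteq> 0 \<and> y b \<noteq> 0}.
     x a * y b * v powi (- Lam S a b))"

definition qone :: qelt where
  "qone = qmono 1 0"

fun qpow :: "seed \<Rightarrow> qelt \<Rightarrow> nat \<Rightarrow> qelt" where
  "qpow S x 0 = qone"
| "qpow S x (Suc k) = qmul S x (qpow S x k)"

definition qinv :: "seed \<Rightarrow> qelt \<Rightarrow> qelt" where
  "qinv S g = (THE h. h \<in> qtorus S \<and> qmul S g h = qone \<and> qmul S h g = qone)"

text \<open>
  Substitution of an element of the completed Lie algebra into a power series: \<open>\<Sum>\<^sub>k f\<^sub>k x\<^sup>k\<close>, where only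
  finitely many summands contribute to each coefficient.
\<close>

definition qsubst :: "seed \<Rightarrow> coeff fps \<Rightarrow> qelt \<Rightarrow> qelt" where
  "qsubst S f x = (\<lambda>u. \<Sum>k \<in> {k. qpow S x k u \<noteq> 0}. fps_nth f k * qpow S x k u)"

definition qexp :: "seed \<Rightarrow> qelt \<Rightarrow> qelt" where
  "qexp S x = qsubst S (Abs_fps (\<lambda>k. 1 / of_nat (fact k))) x"

definition qdilog :: "coeff \<Rightarrow> coeff fps" where
  "qdilog p = (THE f. fps_nth f 0 = 1 \<and>
     fps_compose f (fps_const (p ^ 2) * fps_X) = (1 + fps_const p * fps_X) * f)"

definition theta_aut :: "seed \<Rightarrow> qelt \<Rightarrow> qelt \<Rightarrow> qelt" where
  "theta_aut S g x = qmul S (qmul S (qinv S g) x) g"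

text \<open>\<open>\<theta>\<^sub>g\<close> to the power \<open>s \<in> {-1, 0, 1}\<close>\<close>

definition theta_aut_sgn :: "seed \<Rightarrow> qelt \<Rightarrow> real \<Rightarrow> qelt \<Rightarrow> qelt" where
  "theta_aut_sgn S g s =
     (if s > 0 then theta_aut S g else if s < 0 then theta_aut S (qinv S g) else id)"


section \<open>Walls and scattering diagrams\<close>

text \<open>
  The wall \<open>(\<dd>, g)\<close> carries its primitive normal vector \<open>n\<close>, which is determined by \<open>\<dd>\<close>.
\<close>

record wall =
  wnormal :: lvec
  wsupp :: "rvec set"
  wfun :: qelt

definition hyperplane :: "seed \<Rightarrow> lvec \<Rightarrow> rvec set" where
  "hyperplane S n = {x \<in> M_real S. pairing S n x = 0}"

definition primitive :: "seed \<Rightarrow> lvec \<Rightarrow> bool" where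
  "primitive S n \<longleftrightarrow> Gcd (n ` sI S) = 1"

definition rational_polyhedral_cone :: "seed \<Rightarrow> rvec set \<Rightarrow> bool" where
  "rational_polyhedral_cone S C \<longleftrightarrow>
     (\<exists>F. finite F \<and> F \<subseteq> N_lat S \<and> C = {x \<in> M_real S. \<forall>a\<in>F. 0 \<le> pairing S a x})"

definition lin_indep :: "seed \<Rightarrow> lvec set \<Rightarrow> bool" where
  "lin_indep S B \<longleftrightarrow>
     (\<forall>c :: lvec \<Rightarrow> int. (\<forall>i\<in>sI S. (\<Sum>b\<in>B. c b * b i) = 0) \<longrightarrow> (\<forall>b\<in>B. c b = 0))"

text \<open>
  The linear span \<open>C - C\<close> of the rational polyhedral cone \<open>C\<close> is a rational subspace of codimension
  \<open>k\<close>, i.e. the common zero set of \<open>k\<close> linearly independent elements of \<open>N\<close>.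
\<close>

definition cone_codim :: "seed \<Rightarrow> rvec set \<Rightarrow> nat \<Rightarrow> bool" where
  "cone_codim S C k \<longleftrightarrow>
     (\<exists>B. finite B \<and> card B = k \<and> B \<subseteq> N_lat S \<and> lin_indep S B \<and>
        {y - z | y z. y \<in> C \<and> z \<in> C} = {x \<in> M_real S. \<forall>b\<in>B. pairing S b x = 0})"

text \<open>\<open>exp (\<Prod>\<^sub>k\<^sub>\<ge>\<^sub>1 \<rat>(v) A\<^sup>k\<^sup>p)\<close> with \<open>p\<close> the image of \<open>n\<close>\<close>

definition wall_group :: "seed \<Rightarrow> lvec \<Rightarrow> qelt set" where
  "wall_group S n =
     qexp S ` {x. \<forall>u. x u \<noteq> 0 \<longrightarrow> (\<exists>k\<ge>1. u = p1star S (\<lambda>i. int k * n i))}"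

definition is_wall :: "seed \<Rightarrow> wall \<Rightarrow> bool" where
  "is_wall S w \<longleftrightarrow>
     wnormal w \<in> N_plus S \<and> primitive S (wnormal w) \<and>
     rational_polyhedral_cone S (wsupp w) \<and> wsupp w \<subseteq> hyperplane S (wnormal w) \<and>
     cone_codim S (wsupp w) 1 \<and>
     wfun w \<in> wall_group S (wnormal w)"

definition outgoing :: "seed \<Rightarrow> wall \<Rightarrow> bool" where
  "outgoing S w \<longleftrightarrow> real_vec (p1star S (wnormal w)) \<notin> wsupp w"

definition nontrivial_mod :: "seed \<Rightarrow> nat \<Rightarrow> wall \<Rightarrow> bool" where
  "nontrivial_mod S k w \<longleftrightarrow> (\<exists>n \<in> N_plus S. deg S n \<le> int k \<and> wfun w (p1star S n) \<noteq> 0)"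

definition scattering_diagram :: "seed \<Rightarrow> wall set \<Rightarrow> bool" where
  "scattering_diagram S D \<longleftrightarrow>
     (\<forall>w\<in>D. is_wall S w) \<and> (\<forall>k. finite {w \<in> D. nontrivial_mod S k w})"

text \<open>The boundary of a wall is taken relative to the hyperplane containing it.\<close>

definition wall_boundary :: "seed \<Rightarrow> wall \<Rightarrow> rvec set" where
  "wall_boundary S w = {x \<in> wsupp w. \<forall>r>0. \<exists>y \<in> hyperplane S (wnormal w) - wsupp w.
     \<forall>i\<in>sI S. \<bar>y i - x i\<bar> < r}"

definition sing_locus :: "seed \<Rightarrow> wall set \<Rightarrow> rvec set" where
  "sing_locus S D =
     (\<Union>w\<in>D. wall_boundary S w) \<union>
     \<Union>{wsupp w \<inter> wsupp w' | w w'. w \<in> D \<and> w' \<in> D \<and> cone_codim S (wsupp w \<inter> wsupp w') 2}"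


section \<open>Path-ordered products and consistency\<close>

text \<open>Coefficientwise limit over degrees, for sequences which become constant.\<close>

definition degree_lim :: "(nat \<Rightarrow> qelt) \<Rightarrow> qelt" where
  "degree_lim s = (\<lambda>u. THE c. \<forall>\<^sub>F k in sequentially. s k u = c)"

text \<open>
  Crossing, at the point \<open>x\<close> with velocity \<open>y\<close>, all walls through \<open>x\<close> which are nontrivial modulo degree
  greater than \<open>k\<close>.  Off the singular locus all of these lie in the same hyperplane, so that the
  automorphisms commute and the order of the list is irrelevant.
\<close>

definition crossing_level :: "seed \<Rightarrow> wall set \<Rightarrow> nat \<Rightarrow> rvec \<Rightarrow> rvec \<Rightarrow> qelt \<Rightarrow> qelt" where
  "crossing_level S D k x y =
     fold (\<lambda>w. theta_aut_sgn S (wfun w) (sgn (pairing S (wnormal w) (- y))))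
       (SOME ws. distinct ws \<and> set ws = {w \<in> D. nontrivial_mod S k w \<and> x \<in> wsupp w})"

definition crossing :: "seed \<Rightarrow> wall set \<Rightarrow> rvec \<Rightarrow> rvec \<Rightarrow> qelt \<Rightarrow> qelt" where
  "crossing S D x y z = degree_lim (\<lambda>k. crossing_level S D k x y z)"

definition velocity :: "(real \<Rightarrow> rvec) \<Rightarrow> real \<Rightarrow> rvec" where
  "velocity \<gamma> t = (\<lambda>i. deriv (\<lambda>s. \<gamma> s i) t)"

definition generic_path :: "seed \<Rightarrow> wall set \<Rightarrow> (real \<Rightarrow> rvec) \<Rightarrow> bool" where
  "generic_path S D \<gamma> \<longleftrightarrow>
     (\<forall>i\<in>sI S. (\<lambda>t. \<gamma> t i) piecewise_C1_differentiable_on {0..1}) \<and>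
     (\<forall>t\<in>{0..1}. \<gamma> t \<in> M_real S - sing_locus S D) \<and>
     (\<forall>w\<in>D. \<gamma> 0 \<notin> wsupp w \<and> \<gamma> 1 \<notin> wsupp w) \<and>
     (\<forall>w\<in>D. \<forall>t\<in>{0<..<1}. \<gamma> t \<in> wsupp w \<longrightarrow>
        (\<forall>i\<in>sI S. (\<lambda>s. \<gamma> s i) differentiable (at t)) \<and>
        pairing S (wnormal w) (velocity \<gamma> t) \<noteq> 0)"

definition path_product_level :: "seed \<Rightarrow> wall set \<Rightarrow> nat \<Rightarrow> (real \<Rightarrow> rvec) \<Rightarrow> qelt \<Rightarrow> qelt" where
  "path_product_level S D k \<gamma> =
     fold (\<lambda>t. crossing_level S D k (\<gamma> t) (velocity \<gamma> t))
       (sorted_list_of_set {t \<in> {0..1}. \<exists>w\<in>D. nontrivial_mod S k w \<and> \<gamma> t \<in> wsupp w})"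

definition path_product :: "seed \<Rightarrow> wall set \<Rightarrow> (real \<Rightarrow> rvec) \<Rightarrow> qelt \<Rightarrow> qelt" where
  "path_product S D \<gamma> x = degree_lim (\<lambda>k. path_product_level S D k \<gamma> x)"

definition consistent :: "seed \<Rightarrow> wall set \<Rightarrow> bool" where
  "consistent S D \<longleftrightarrow>
     (\<forall>\<gamma> \<delta>. generic_path S D \<gamma> \<and> generic_path S D \<delta> \<and> \<gamma> 0 = \<delta> 0 \<and> \<gamma> 1 = \<delta> 1 \<longrightarrow>
        (\<forall>x\<in>qtorus S. path_product S D \<gamma> x = path_product S D \<delta> x))"

definition initial_wall :: "seed \<Rightarrow> nat \<Rightarrow> wall" where
  "initial_wall S i =
     \<lparr> wnormal = unit_vec i,
       wsupp = hyperplane S (unit_vec i),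
       wfun = qsubst S (qdilog (v ^ (d_lcm S div sd S i))) (qmono 1 (p1star S (unit_vec i))) \<rparr>"

text \<open>
  These conditions determine the diagram up to equivalence (equality of all path-ordered products).
\<close>

definition quantum_cluster_scattering_diagram :: "seed \<Rightarrow> wall set \<Rightarrow> bool" where
  "quantum_cluster_scattering_diagram S D \<longleftrightarrow>
     scattering_diagram S D \<and> consistent S D \<and>
     initial_wall S ` suf S \<subseteq> D \<and> (\<forall>w \<in> D - initial_wall S ` suf S. outgoing S w)"


section \<open>Broken lines and theta functions\<close>

text \<open>
  A broken line is recorded as the list of triples \<open>(s\<^sub>j, c\<^sub>j, m\<^sub>j)\<close>, one for each domain of linearity, where
  \<open>s\<^sub>j\<close> is the time at which the domain ends and \<open>c\<^sub>j A\<^bsup>m\<^sub>j\<^esup>\<close> its monomial.  Together with the endpoint this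
  determines the underlying path on \<open>(-\<infinity>, 0]\<close>, so counting these lists is counting broken lines.
  Domains of linearity are maximal, so the exponent changes from each domain to the next.
\<close>

definition broken_line ::
    "seed \<Rightarrow> wall set \<Rightarrow> lvec \<Rightarrow> rvec \<Rightarrow> (real \<times> coeff \<times> lvec) list \<Rightarrow> bool" where
  "broken_line S D m Q L \<longleftrightarrow>
     (\<exists>\<gamma> :: real \<Rightarrow> rvec.
        let s = (\<lambda>j. fst (L ! j)); c = (\<lambda>j. fst (snd (L ! j))); e = (\<lambda>j. snd (snd (L ! j)));
            r = length L - 1
        in
          L \<noteq> [] \<and> s r = 0 \<and> (\<forall>j<r. s j < s (Suc j)) \<and>
          c 0 = 1 \<and> e 0 = m \<and> (\<forall>j\<le>r. c j \<noteq> 0) \<and>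
          \<gamma> 0 = Q \<and> (\<forall>t\<le>0. \<gamma> t \<in> M_real S - sing_locus S D) \<and>
          (\<forall>j\<le>r. \<forall>t\<le>s j. (0 < j \<longrightarrow> s (j - 1) \<le> t) \<longrightarrow>
             (\<forall>i. \<gamma> t i = \<gamma> (s j) i - (t - s j) * real_of_int (e j i))) \<and>
          (\<forall>j<r. e (Suc j) \<noteq> e j \<and> (\<exists>w\<in>D. \<gamma> (s j) \<in> wsupp w) \<and>
             c (Suc j) =
               crossing S D (\<gamma> (s j)) (- real_vec (e j)) (qmono (c j) (e j)) (e (Suc j))))"

definition theta :: "seed \<Rightarrow> wall set \<Rightarrow> rvec \<Rightarrow> lvec \<Rightarrow> qelt" where
  "theta S D Q m =
     (if m = 0 then qone
      else (\<lambda>u. \<Sum>L \<in> {L. broken_line S D m Q L \<and> snd (snd (last L)) = u}. fst (snd (last L))))"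

definition initial_chamber :: "seed \<Rightarrow> rvec set" where
  "initial_chamber S = {x \<in> M_real S. \<forall>i \<in> suf S. 0 \<le> pairing S (unit_vec i) x}"

text \<open>
  General points are those on no rational hyperplane through the origin.  All walls are rational cones,
  so the points at which the theta functions could degenerate lie on such hyperplanes.
\<close>

definition general_point :: "seed \<Rightarrow> rvec \<Rightarrow> bool" where
  "general_point S Q \<longleftrightarrow> Q \<in> M_real S \<and> (\<forall>n \<in> N_lat S. n \<noteq> 0 \<longrightarrow> pairing S n Q \<noteq> 0)"

end

theory Submission
  imports Defs
begin

text \<open>
  The data have rank two, both directions are unfrozen, and \<open>(d\<^sub>0, d\<^sub>1) = (2, 3)\<close>, \<open>{e\<^sub>0, e\<^sub>1} = 1\<close>, so that
  \<open>d = 6\<close> and the initial walls carry \<open>\<Psi>\<close> with parameters \<open>v\<^sup>3\<close> and \<open>v\<^sup>2\<close>. The first terms of these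
  two functions are \<open>1/(v\<^sup>3 - v\<^sup>-\<^sup>3)\<close> and \<open>1/(v\<^sup>2 - v\<^sup>-\<^sup>2)\<close>, and the commutator of the two monomials is
  \<open>v\<^sup>6 - v\<^sup>-\<^sup>6\<close> times a monomial. Hence the outgoing wall with normal \<open>e\<^sub>0 + e\<^sub>1\<close> has leading coefficient
  \<open>(v\<^sup>6 - v\<^sup>-\<^sup>6) / ((v\<^sup>3 - v\<^sup>-\<^sup>3) (v\<^sup>2 - v\<^sup>-\<^sup>2))\<close>. A monomial \<open>A\<^sup>m\<close> whose \<open>\<Lambda>\<close>-product with the exponent of that
  wall is \<open>\<plusminus>1\<close> bends there with this coefficient times \<open>v - v\<^sup>-\<^sup>1\<close>, which is
  \<open>(v\<^sup>3 + v\<^sup>-\<^sup>3) / (v + v\<^sup>-\<^sup>1) = v\<^sup>2 - 1 + v\<^sup>-\<^sup>2\<close>. For \<open>(d\<^sub>0, d\<^sub>1) = (1, 3)\<close> the corresponding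
  quotients are quantum integers, whose coefficients are nonnegative; here neither factor of the denominator equals
  the numerator.

  It remains to choose \<open>m\<close> such that nothing else contributes. For \<open>m = (3, -5)\<close> and the final exponent
  \<open>u = (1, -2)\<close>, a broken line ending at a point \<open>Q\<close> of the initial chamber has positive first coordinate all
  the way, because bends only decrease the first coordinate of the exponent and it is still \<open>1\<close> at the end.
  So every bend uses up a positive multiple of \<open>e\<^sub>1\<close>; there is only one \<open>e\<^sub>1\<close> to be used, and the line bends
  exactly once, on the wall with normal \<open>e\<^sub>0 + e\<^sub>1\<close> (\<open>the_line_unique\<close>, \<open>crossing_alpha\<close>).

  The diagram has infinitely many walls, and its existence is part of the claim. It is built
  from a single element \<open>T\<close>, the product of the two initial wall functions. For every set \<open>C\<close> of exponents, \<open>T\<close>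
  factors uniquely as \<open>A B\<close> with \<open>A\<close> supported on \<open>C\<close> and \<open>B\<close> off \<open>C\<close>: the coefficients are determined degree
  by degree (\<open>lower_upper\<close>, \<open>factor_coeff_unique\<close>). Let \<open>\<Phi>(y)\<close> be the factor \<open>A\<close> for
  \<open>C = {n. \<langle>n, y\<rangle> < 0}\<close>. It changes only when \<open>y\<close> crosses the orthogonal space of some \<open>n\<close>, and the quotient
  of the values on the two sides is an element supported on the multiples of \<open>n\<close>. These quotients
  are taken as wall functions. Every path-ordered product is then conjugation by
  \<open>\<Phi>(start)\<^sup>-\<^sup>1 \<Phi>(end)\<close>, which is consistency (\<open>path_product_level_D23\<close>, \<open>consistent_D23\<close>).
  On the coordinate axes the quotient is the initial wall function. In the second quadrant, where all
  incoming rays lie, \<open>\<Phi>\<close> is constant. So all further walls are rays in the fourth quadrant, and these are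
  outgoing.
\<close>

section \<open>The seed of type (2,3)\<close>

declare One_nat_def [simp del]

text \<open>
  With this choice \<open>p\<^sub>1\<^sup>*(e\<^sub>0) = (0, 3)\<close>, \<open>p\<^sub>1\<^sup>*(e\<^sub>1) = (-2, 0)\<close>, and \<open>\<Lambda>(f\<^sub>1, f\<^sub>0) = 1\<close> is forced by
  compatibility.
\<close>

definition S23 :: seed where
  "S23 = \<lparr> sI = {0, 1}, suf = {0, 1},
     sform = (\<lambda>i j. if i = 0 \<and> j = 1 then 1 else if i = 1 \<and> j = 0 then - 1 else 0),
     sd = (\<lambda>i. if i = 0 then 2 else 3),
     scomp = (\<lambda>i j. if i = 1 \<and> j = 0 then 1 else if i = 0 \<and> j = 1 then - 1 else 0) \<rparr>"

definition mv :: "int \<Rightarrow> int \<Rightarrow> lvec" where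
  "mv a b = (\<lambda>i. if i = 0 then a else if i = 1 then b else 0)"

lemma mv_nth [simp]: "mv a b 0 = a" "mv a b 1 = b" "mv a b (Suc 0) = b"
  by (auto simp: mv_def)

lemma mv_eq_iff [simp]: "mv a b = mv c d \<longleftrightarrow> a = c \<and> b = d"
  by (metis mv_nth(1,2))

lemma mv_add [simp]: "mv a b + mv c d = mv (a + c) (b + d)"
  by (auto simp: mv_def)

lemma mv_0 [simp]: "mv a b = 0 \<longleftrightarrow> a = 0 \<and> b = 0" "0 = mv a b \<longleftrightarrow> a = 0 \<and> b = 0"
proof -
  have "(0::lvec) = mv 0 0" by (auto simp: mv_def)
  then show "mv a b = 0 \<longleftrightarrow> a = 0 \<and> b = 0" "0 = mv a b \<longleftrightarrow> a = 0 \<and> b = 0"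
    by (metis mv_eq_iff)+
qed

lemma mv_zero [simp]: "mv 0 0 = 0"
  by simp

lemma S23_sel [simp]: "sI S23 = {0, 1}" "suf S23 = {0, 1}" "sd S23 0 = 2" "sd S23 1 = 3"
  "sform S23 0 1 = 1" "sform S23 1 0 = - 1" "sform S23 0 0 = 0" "sform S23 1 1 = 0"
  "scomp S23 0 1 = - 1" "scomp S23 1 0 = 1" "scomp S23 0 0 = 0" "scomp S23 1 1 = 0"
  by (auto simp: S23_def)

lemma Lam_S23: "Lam S23 a b = a 1 * b 0 - a 0 * b 1"
  by (simp add: Lam_def algebra_simps)

lemma p1star_S23: "p1star S23 n = mv (- 2 * n 1) (3 * n 0)"
  by (auto simp: p1star_def mv_def fun_eq_iff floor_eq_iff)

lemma M_lat_S23: "u \<in> M_lat S23 \<longleftrightarrow> (\<forall>i. i \<noteq> 0 \<and> i \<noteq> 1 \<longrightarrow> u i = 0)"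
  by (auto simp: M_lat_def)

lemma mv_in_M_lat [simp]: "mv a b \<in> M_lat S23"
  by (auto simp: M_lat_S23 mv_def)

lemma zero_in_M_lat [simp]: "0 \<in> M_lat S23"
  by (simp add: M_lat_S23)

lemma M_lat_S23_eq: "u \<in> M_lat S23 \<Longrightarrow> u = mv (u 0) (u 1)"
  by (auto simp: M_lat_S23 mv_def)

lemma M_lat_S23_add: "a \<in> M_lat S23 \<Longrightarrow> b \<in> M_lat S23 \<Longrightarrow> a + b \<in> M_lat S23"
  by (auto simp: M_lat_S23)

lemma N_plus_S23: "n \<in> N_plus S23 \<longleftrightarrow> (\<exists>a b. n = mv (int a) (int b) \<and> (a, b) \<noteq> (0, 0))"
proof
  assume "n \<in> N_plus S23"
  then have *: "\<forall>i. i \<noteq> 0 \<and> i \<noteq> 1 \<longrightarrow> n i = 0" "n 0 \<ge> 0" "n 1 \<ge> 0" "n \<noteq> 0"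
    by (auto simp: N_plus_def)
  then have "n = mv (int (nat (n 0))) (int (nat (n 1)))"
    by (auto simp: mv_def)
  then show "\<exists>a b. n = mv (int a) (int b) \<and> (a, b) \<noteq> (0, 0)"
    using *(4) by (metis mv_0(1) of_nat_0 prod.inject)
next
  assume "\<exists>a b. n = mv (int a) (int b) \<and> (a, b) \<noteq> (0, 0)"
  then obtain a b where n: "n = mv (int a) (int b)" "(a, b) \<noteq> (0, 0)" by blast
  then have "n \<noteq> 0" by auto
  then show "n \<in> N_plus S23" using n(1) by (auto simp: N_plus_def mv_def)
qed

text \<open>
  The cone spanned by \<open>p\<^sub>1\<^sup>*(N\<^sup>+)\<close> is the second quadrant, and its lattice points have index \<open>6\<close> in those of
  the quadrant. Six translates therefore cover a translated quadrant, and being supported in finitely many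
  translates means being bounded on the right and from below.
\<close>

lemma qtorus_S23: "x \<in> qtorus S23 \<longleftrightarrow>
    (\<exists>K. \<forall>u. x u \<noteq> 0 \<longrightarrow> u \<in> M_lat S23 \<and> u 0 \<le> K \<and> - K \<le> u 1)"
proof
  assume "x \<in> qtorus S23"
  then obtain B where B: "finite B" "B \<subseteq> M_lat S23"
    "\<And>u. x u \<noteq> 0 \<Longrightarrow> \<exists>b\<in>B. \<exists>n \<in> N_plus S23 \<union> {0}. u = b + p1star S23 n"
    by (auto simp: qtorus_def)
  define K where "K = (\<Sum>b\<in>B. \<bar>b 0\<bar> + \<bar>b 1\<bar>)"
  have K: "\<bar>b 0\<bar> + \<bar>b 1\<bar> \<le> K" if "b \<in> B" for b
    unfolding K_def by (rule member_le_sum[OF that _ B(1)]) auto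
  show "\<exists>K. \<forall>u. x u \<noteq> 0 \<longrightarrow> u \<in> M_lat S23 \<and> u 0 \<le> K \<and> - K \<le> u 1"
  proof (intro exI[of _ K] allI impI)
    fix u assume "x u \<noteq> 0"
    from B(3)[OF this] obtain b n where bn: "b \<in> B" "n \<in> N_plus S23 \<union> {0}" "u = b + p1star S23 n"
      by blast
    have "n 0 \<ge> 0" "n 1 \<ge> 0" using bn(2) by (auto simp: N_plus_def)
    then show "u \<in> M_lat S23 \<and> u 0 \<le> K \<and> - K \<le> u 1"
      using K[OF bn(1)] bn B(2) by (auto simp: p1star_S23 intro!: M_lat_S23_add)
  qed
next
  assume "\<exists>K. \<forall>u. x u \<noteq> 0 \<longrightarrow> u \<in> M_lat S23 \<and> u 0 \<le> K \<and> - K \<le> u 1"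
  then obtain K where K: "\<And>u. x u \<noteq> 0 \<Longrightarrow> u \<in> M_lat S23 \<and> u 0 \<le> K \<and> - K \<le> u 1" by blast
  let ?B = "(\<lambda>(a, b). mv a b) ` ({K - 1..K} \<times> {- K..- K + 2})"
  show "x \<in> qtorus S23"
    unfolding qtorus_def mem_Collect_eq
  proof (intro exI[of _ ?B] conjI allI impI)
    fix u assume "x u \<noteq> 0"
    then have u: "u \<in> M_lat S23" "u 0 \<le> K" "- K \<le> u 1" using K by auto
    define i j where "i = nat ((K - u 0) div 2)" and "j = nat ((u 1 + K) div 3)"
    have ij: "int i = (K - u 0) div 2" "int j = (u 1 + K) div 3"
      unfolding i_def j_def using u by auto
    \<comment> \<open>Divide the distances to the two bounds by \<open>2\<close> and \<open>3\<close>; the remainders select the translate.\<close>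
    show "\<exists>b\<in>?B. \<exists>n\<in>N_plus S23 \<union> {0}. u = b + p1star S23 n"
    proof (rule bexI[of _ "mv (K - (K - u 0) mod 2) (- K + (u 1 + K) mod 3)"],
        rule bexI[of _ "mv (int j) (int i)"])
      show "u = mv (K - (K - u 0) mod 2) (- K + (u 1 + K) mod 3) + p1star S23 (mv (int j) (int i))"
        by (subst M_lat_S23_eq[OF u(1)], simp add: p1star_S23 ij, presburger)
      show "mv (int j) (int i) \<in> N_plus S23 \<union> {0}"
        by (cases "(j, i) = (0, 0)") (auto simp: N_plus_S23)
      have "(K - (K - u 0) mod 2, - K + (u 1 + K) mod 3) \<in> {K - 1..K} \<times> {- K..- K + 2}"
        by simp presburger
      then show "mv (K - (K - u 0) mod 2) (- K + (u 1 + K) mod 3) \<in> ?B"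
        by (metis (no_types, lifting) case_prod_conv image_eqI)
    qed
  qed auto
qed

lemma finite_box: "finite {u \<in> M_lat S23. a \<le> u 0 \<and> u 0 \<le> b \<and> c \<le> u 1 \<and> u 1 \<le> d}"
proof (rule finite_subset)
  show "{u \<in> M_lat S23. a \<le> u 0 \<and> u 0 \<le> b \<and> c \<le> u 1 \<and> u 1 \<le> d} \<subseteq>
      (\<lambda>(s, t). mv s t) ` ({a..b} \<times> {c..d})"
  proof
    fix u assume "u \<in> {u \<in> M_lat S23. a \<le> u 0 \<and> u 0 \<le> b \<and> c \<le> u 1 \<and> u 1 \<le> d}"
    then have "u = (\<lambda>(s, t). mv s t) (u 0, u 1)" "(u 0, u 1) \<in> {a..b} \<times> {c..d}"
      using M_lat_S23_eq[of u] by auto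
    then show "u \<in> (\<lambda>(s, t). mv s t) ` ({a..b} \<times> {c..d})" by (rule image_eqI)
  qed
qed auto

definition qpairs :: "qelt \<Rightarrow> qelt \<Rightarrow> lvec \<Rightarrow> (lvec \<times> lvec) set" where
  "qpairs x y u = {(a, b). a + b = u \<and> x a \<noteq> 0 \<and> y b \<noteq> 0}"

lemma finite_qpairs:
  assumes "x \<in> qtorus S23" "y \<in> qtorus S23"
  shows "finite (qpairs x y u)"
proof -
  obtain K where K: "\<And>u. x u \<noteq> 0 \<Longrightarrow> u \<in> M_lat S23 \<and> u 0 \<le> K \<and> - K \<le> u 1"
    using assms(1) by (auto simp: qtorus_S23)
  obtain L where L: "\<And>u. y u \<noteq> 0 \<Longrightarrow> u \<in> M_lat S23 \<and> u 0 \<le> L \<and> - L \<le> u 1"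
    using assms(2) by (auto simp: qtorus_S23)
  let ?A = "{a \<in> M_lat S23. u 0 - L \<le> a 0 \<and> a 0 \<le> K \<and> - K \<le> a 1 \<and> a 1 \<le> u 1 + L}"
  have "qpairs x y u \<subseteq> (\<lambda>a. (a, u - a)) ` ?A"
    using K L by (fastforce simp: qpairs_def)
  then show ?thesis using finite_box finite_subset by blast
qed

definition tw :: "lvec \<Rightarrow> lvec \<Rightarrow> coeff" where
  "tw a b = v powi (- Lam S23 a b)"

lemma v_nz [simp]: "v \<noteq> 0"
  by (simp add: v_def Zero_fract_def eq_fract)

lemma tw_nz [simp]: "tw a b \<noteq> 0" by (simp add: tw_def)

lemma tw_add_left: "tw (a + b) c = tw a c * tw b c"
  by (simp add: tw_def Lam_S23 power_int_add[symmetric] algebra_simps)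

lemma tw_add_right: "tw a (b + c) = tw a b * tw a c"
  by (simp add: tw_def Lam_S23 power_int_add[symmetric] algebra_simps)

lemma tw_0 [simp]: "tw 0 a = 1" "tw a 0 = 1"
  by (simp_all add: tw_def Lam_S23)

lemma qmul_alt: "qmul S23 x y u = (\<Sum>(a, b)\<in>qpairs x y u. x a * y b * tw a b)"
  by (simp add: qmul_def qpairs_def tw_def)

text \<open>
  Sums over the support of a product are awkward to compare between different factors; this lets one
  enlarge the index set to one that is common to several products.
\<close>

lemma qmul_superset:
  assumes "finite P" "qpairs x y u \<subseteq> P" "\<And>a b. (a, b) \<in> P \<Longrightarrow> a + b = u"
  shows "qmul S23 x y u = (\<Sum>(a, b)\<in>P. x a * y b * tw a b)"
  unfolding qmul_alt
  by (rule sum.mono_neutral_left) (use assms in \<open>auto simp: qpairs_def\<close>)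

lemma qmul_nonzeroE:
  assumes "qmul S23 x y u \<noteq> 0"
  obtains a b where "a + b = u" "x a \<noteq> 0" "y b \<noteq> 0"
proof -
  have "qpairs x y u \<noteq> {}" using assms by (auto simp: qmul_alt)
  then show ?thesis using that by (auto simp: qpairs_def)
qed

lemma qmul_closed:
  assumes "x \<in> qtorus S23" "y \<in> qtorus S23"
  shows "qmul S23 x y \<in> qtorus S23"
proof -
  obtain K where K: "\<And>u. x u \<noteq> 0 \<Longrightarrow> u \<in> M_lat S23 \<and> u 0 \<le> K \<and> - K \<le> u 1"
    using assms(1) by (auto simp: qtorus_S23)
  obtain L where L: "\<And>u. y u \<noteq> 0 \<Longrightarrow> u \<in> M_lat S23 \<and> u 0 \<le> L \<and> - L \<le> u 1"
    using assms(2) by (auto simp: qtorus_S23)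
  show ?thesis unfolding qtorus_S23
  proof (intro exI[of _ "K + L"] allI impI)
    fix u assume "qmul S23 x y u \<noteq> 0"
    then obtain a b where "a + b = u" "x a \<noteq> 0" "y b \<noteq> 0" by (rule qmul_nonzeroE)
    then show "u \<in> M_lat S23 \<and> u 0 \<le> K + L \<and> - (K + L) \<le> u 1"
      using K[of a] L[of b] M_lat_S23_add by fastforce
  qed
qed

text \<open>
  Both sides are the sum over the finite set of triples of exponents with sum \<open>u\<close>; the twists agree because
  \<open>tw\<close> is bimultiplicative.
\<close>

lemma qmul_assoc:
  assumes x: "x \<in> qtorus S23" and y: "y \<in> qtorus S23" and z: "z \<in> qtorus S23"
  shows "qmul S23 (qmul S23 x y) z = qmul S23 x (qmul S23 y z)"
proof
  fix u
  obtain K where K: "\<And>u. x u \<noteq> 0 \<Longrightarrow> u \<in> M_lat S23 \<and> u 0 \<le> K \<and> - K \<le> u 1"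
    using x by (auto simp: qtorus_S23)
  obtain L where L: "\<And>u. y u \<noteq> 0 \<Longrightarrow> u \<in> M_lat S23 \<and> u 0 \<le> L \<and> - L \<le> u 1"
    using y by (auto simp: qtorus_S23)
  obtain R where R: "\<And>u. z u \<noteq> 0 \<Longrightarrow> u \<in> M_lat S23 \<and> u 0 \<le> R \<and> - R \<le> u 1"
    using z by (auto simp: qtorus_S23)
  define T where "T = {(a, b, c). a + b + c = u \<and> x a \<noteq> 0 \<and> y b \<noteq> 0 \<and> z c \<noteq> 0}"
  let ?A = "{a \<in> M_lat S23. u 0 - L - R \<le> a 0 \<and> a 0 \<le> K \<and> - K \<le> a 1 \<and> a 1 \<le> u 1 + L + R}"
  let ?B = "{a \<in> M_lat S23. u 0 - K - R \<le> a 0 \<and> a 0 \<le> L \<and> - L \<le> a 1 \<and> a 1 \<le> u 1 + K + R}"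
  \<comment> \<open>The set is finite because two of the three exponents lie in a box and determine the third.\<close>
  have T: "(a, b, c) \<in> T \<longleftrightarrow> a + b + c = u \<and> x a \<noteq> 0 \<and> y b \<noteq> 0 \<and> z c \<noteq> 0" for a b c
    by (simp add: T_def)
  have "T \<subseteq> (\<lambda>(a, b). (a, b, u - a - b)) ` (?A \<times> ?B)"
  proof
    fix p assume "p \<in> T"
    then obtain a b c where p: "p = (a, b, c)" and *: "a + b + c = u" "x a \<noteq> 0" "y b \<noteq> 0" "z c \<noteq> 0"
      by (cases p) (auto simp: T)
    have "(a, b) \<in> ?A \<times> ?B" using K[OF *(2)] L[OF *(3)] R[OF *(4)] *(1) by auto
    moreover have "p = (\<lambda>(a, b). (a, b, u - a - b)) (a, b)" using p *(1) by auto
    ultimately show "p \<in> (\<lambda>(a, b). (a, b, u - a - b)) ` (?A \<times> ?B)" by (rule rev_image_eqI)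
  qed
  then have finT: "finite T"
    by (rule finite_subset) (intro finite_imageI finite_cartesian_product finite_box)
  have fxy: "finite (qpairs x y w)" for w using finite_qpairs x y by blast
  have fyz: "finite (qpairs y z w)" for w using finite_qpairs y z by blast
  define W where "W = (\<lambda>(a, b, c). (a + b, c)) ` T"
  define W' where "W' = (\<lambda>(a, b, c). (a, b + c)) ` T"
  have WI: "(a + b, c) \<in> W" "(a, b + c) \<in> W'" if "(a, b, c) \<in> T" for a b c
    using that by (force simp: W_def W'_def)+
  have WE: "w + c = u \<and> z c \<noteq> 0" if "(w, c) \<in> W" for w c
    using that by (auto simp: W_def T)
  have WE': "a + w = u \<and> x a \<noteq> 0" if "(a, w) \<in> W'" for a w
    using that by (auto simp: W'_def T add.assoc)
  have "qmul S23 (qmul S23 x y) z u = (\<Sum>(w, c)\<in>W. qmul S23 x y w * z c * tw w c)"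
  proof (rule qmul_superset)
    show "finite W" using finT by (simp add: W_def)
    show "qpairs (qmul S23 x y) z u \<subseteq> W"
    proof
      fix p assume "p \<in> qpairs (qmul S23 x y) z u"
      then obtain w c where p: "p = (w, c)" "w + c = u" "qmul S23 x y w \<noteq> 0" "z c \<noteq> 0"
        by (auto simp: qpairs_def)
      obtain a b where "a + b = w" "x a \<noteq> 0" "y b \<noteq> 0" using p(3) by (rule qmul_nonzeroE)
      then have "(a, b, c) \<in> T" using p by (auto simp: T)
      then show "p \<in> W" unfolding W_def using p \<open>a + b = w\<close> by force
    qed
  qed (auto simp: W_def T)
  also have "\<dots> = (\<Sum>(w, c)\<in>W. \<Sum>(a, b)\<in>qpairs x y w. x a * y b * tw a b * z c * tw w c)"
    by (simp add: qmul_alt sum_distrib_right case_prod_unfold)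
  also have "\<dots> = (\<Sum>((w, c), (a, b))\<in>(SIGMA (w, c):W. qpairs x y w). x a * y b * tw a b * z c * tw w c)"
    using finT by (simp add: sum.Sigma case_prod_unfold fxy W_def)
  also have "\<dots> = (\<Sum>(a, b, c)\<in>T. x a * y b * z c * tw a b * tw a c * tw b c)"
    by (rule sum.reindex_bij_witness[where i = "\<lambda>(a, b, c). ((a + b, c), (a, b))"
          and j = "\<lambda>((w, c), (a, b)). (a, b, c)"])
      (auto simp: T qpairs_def tw_add_left intro!: WI dest!: WE)
  also have "\<dots> = (\<Sum>((a, w), (b, c))\<in>(SIGMA (a, w):W'. qpairs y z w). x a * (y b * z c * tw b c) * tw a w)"
    by (rule sum.reindex_bij_witness[where j = "\<lambda>(a, b, c). ((a, b + c), (b, c))"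
          and i = "\<lambda>((a, w), (b, c)). (a, b, c)"])
      (auto simp: T qpairs_def tw_add_right add.assoc intro!: WI dest!: WE')
  also have "\<dots> = (\<Sum>(a, w)\<in>W'. \<Sum>(b, c)\<in>qpairs y z w. x a * (y b * z c * tw b c) * tw a w)"
    using finT by (simp add: sum.Sigma case_prod_unfold fyz W'_def)
  also have "\<dots> = (\<Sum>(a, w)\<in>W'. x a * qmul S23 y z w * tw a w)"
    by (simp add: qmul_alt sum_distrib_right sum_distrib_left case_prod_unfold)
  also have "\<dots> = qmul S23 x (qmul S23 y z) u"
  proof (rule qmul_superset[symmetric])
    show "finite W'" using finT by (simp add: W'_def)
    show "qpairs x (qmul S23 y z) u \<subseteq> W'"
    proof
      fix p assume "p \<in> qpairs x (qmul S23 y z) u"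
      then obtain a w where p: "p = (a, w)" "a + w = u" "qmul S23 y z w \<noteq> 0" "x a \<noteq> 0"
        by (auto simp: qpairs_def)
      obtain b c where bc: "b + c = w" "y b \<noteq> 0" "z c \<noteq> 0" using p(3) by (rule qmul_nonzeroE)
      then have "(a, b, c) \<in> T" using p by (auto simp: T add.assoc)
      then show "p \<in> W'" unfolding W'_def using p bc(1) by force
    qed
  qed (auto simp: W'_def T add.assoc)
  finally show "qmul S23 (qmul S23 x y) z u = qmul S23 x (qmul S23 y z) u" .
qed

lemma qtorus_add: "x \<in> qtorus S23 \<Longrightarrow> y \<in> qtorus S23 \<Longrightarrow> (\<lambda>u. x u + y u) \<in> qtorus S23"
proof -
  assume "x \<in> qtorus S23" "y \<in> qtorus S23"
  then obtain K L where KL: "\<And>u. x u \<noteq> 0 \<Longrightarrow> u \<in> M_lat S23 \<and> u 0 \<le> K \<and> - K \<le> u 1"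
    "\<And>u. y u \<noteq> 0 \<Longrightarrow> u \<in> M_lat S23 \<and> u 0 \<le> L \<and> - L \<le> u 1"
    by (auto simp: qtorus_S23)
  have "\<forall>u. x u + y u \<noteq> 0 \<longrightarrow> u \<in> M_lat S23 \<and> u 0 \<le> \<bar>K\<bar> + \<bar>L\<bar> \<and> - (\<bar>K\<bar> + \<bar>L\<bar>) \<le> u 1"
  proof (intro allI impI)
    fix u assume "x u + y u \<noteq> 0"
    then consider "x u \<noteq> 0" | "y u \<noteq> 0" by fastforce
    then show "u \<in> M_lat S23 \<and> u 0 \<le> \<bar>K\<bar> + \<bar>L\<bar> \<and> - (\<bar>K\<bar> + \<bar>L\<bar>) \<le> u 1"
      by cases (use KL in \<open>force+\<close>)
  qed
  then show ?thesis
    unfolding qtorus_S23 by blast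
qed

lemma qtorus_uminus: "x \<in> qtorus S23 \<Longrightarrow> (\<lambda>u. - x u) \<in> qtorus S23"
  by (auto simp: qtorus_S23)

lemma qmono_in_qtorus: "m \<in> M_lat S23 \<Longrightarrow> qmono c m \<in> qtorus S23"
  unfolding qtorus_S23 qmono_def
  by (intro exI[of _ "\<bar>m 0\<bar> + \<bar>m 1\<bar>"]) auto

lemma qmul_add_left:
  assumes "x \<in> qtorus S23" "y \<in> qtorus S23" "z \<in> qtorus S23"
  shows "qmul S23 (\<lambda>u. x u + y u) z = (\<lambda>u. qmul S23 x z u + qmul S23 y z u)"
proof
  fix u
  let ?P = "qpairs x z u \<union> qpairs y z u"
  have P: "finite ?P" "\<And>a b. (a, b) \<in> ?P \<Longrightarrow> a + b = u"
    using finite_qpairs assms by (auto simp: qpairs_def)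
  have "qmul S23 (\<lambda>u. x u + y u) z u = (\<Sum>(a, b)\<in>?P. (x a + y a) * z b * tw a b)"
    by (rule qmul_superset[OF P(1) _ P(2)]) (auto simp: qpairs_def)
  also have "\<dots> = (\<Sum>(a, b)\<in>?P. x a * z b * tw a b) + (\<Sum>(a, b)\<in>?P. y a * z b * tw a b)"
    by (subst sum.distrib[symmetric], rule sum.cong[OF refl])
      (simp only: split_beta distrib_right)
  also have "\<dots> = qmul S23 x z u + qmul S23 y z u"
    by (subst (1 2) qmul_superset[OF P(1) _ P(2)]) (simp_all only: Un_upper1 Un_upper2)
  finally show "qmul S23 (\<lambda>u. x u + y u) z u = qmul S23 x z u + qmul S23 y z u" .
qed

lemma qmul_add_right:
  assumes "x \<in> qtorus S23" "y \<in> qtorus S23" "z \<in> qtorus S23"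
  shows "qmul S23 z (\<lambda>u. x u + y u) = (\<lambda>u. qmul S23 z x u + qmul S23 z y u)"
proof
  fix u
  let ?P = "qpairs z x u \<union> qpairs z y u"
  have P: "finite ?P" "\<And>a b. (a, b) \<in> ?P \<Longrightarrow> a + b = u"
    using finite_qpairs assms by (auto simp: qpairs_def)
  have "qmul S23 z (\<lambda>u. x u + y u) u = (\<Sum>(a, b)\<in>?P. z a * (x b + y b) * tw a b)"
    by (rule qmul_superset[OF P(1) _ P(2)]) (auto simp: qpairs_def)
  also have "\<dots> = (\<Sum>(a, b)\<in>?P. z a * x b * tw a b) + (\<Sum>(a, b)\<in>?P. z a * y b * tw a b)"
    by (subst sum.distrib[symmetric], rule sum.cong[OF refl])
      (simp only: split_beta distrib_right distrib_left)
  also have "\<dots> = qmul S23 z x u + qmul S23 z y u"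
    by (subst (1 2) qmul_superset[OF P(1) _ P(2)]) (simp_all only: Un_upper1 Un_upper2)
  finally show "qmul S23 z (\<lambda>u. x u + y u) u = qmul S23 z x u + qmul S23 z y u" .
qed

lemma qmul_qmono_left: "qmul S23 (qmono c m) x u = c * x (u - m) * tw m (u - m)"
proof -
  have "qmul S23 (qmono c m) x u = (\<Sum>(a, b)\<in>{(m, u - m)}. qmono c m a * x b * tw a b)"
    by (rule qmul_superset) (auto simp: qpairs_def qmono_def split: if_splits)
  then show ?thesis by (simp add: qmono_def)
qed

lemma qmul_qmono_right: "qmul S23 x (qmono c m) u = x (u - m) * c * tw (u - m) m"
proof -
  have "qmul S23 x (qmono c m) u = (\<Sum>(a, b)\<in>{(u - m, m)}. x a * qmono c m b * tw a b)"
    by (rule qmul_superset) (auto simp: qpairs_def qmono_def split: if_splits)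
  then show ?thesis by (simp add: qmono_def)
qed

text \<open>
  As a type, the completed torus is an instance of a ring class, and computations with conjugations and powers reduce
  to the general laws of rings.
\<close>

typedef qt = "qtorus S23"
  morphisms coef Abs_qt
  using qmono_in_qtorus[of "mv 0 0" 1] by auto

setup_lifting type_definition_qt

instantiation qt :: ring_1
begin

lift_definition zero_qt :: qt is "\<lambda>_. 0" by (auto simp: qtorus_S23)
lift_definition one_qt :: qt is qone
  unfolding qone_def using qmono_in_qtorus[of "mv 0 0" 1] by simp
lift_definition plus_qt :: "qt \<Rightarrow> qt \<Rightarrow> qt" is "\<lambda>x y u. x u + y u" by (rule qtorus_add)
lift_definition uminus_qt :: "qt \<Rightarrow> qt" is "\<lambda>x u. - x u" by (rule qtorus_uminus)
lift_definition minus_qt :: "qt \<Rightarrow> qt \<Rightarrow> qt" is "\<lambda>x y u. x u - y u"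
  using qtorus_add qtorus_uminus by fastforce
lift_definition times_qt :: "qt \<Rightarrow> qt \<Rightarrow> qt" is "qmul S23" by (rule qmul_closed)

instance
proof
  fix a b c :: qt
  show "a * b * c = a * (b * c)" by transfer (rule qmul_assoc)
  show "(a + b) * c = a * c + b * c" by transfer (rule qmul_add_left)
  show "a * (b + c) = a * b + a * c" by transfer (rule qmul_add_right)
  show "1 * a = a" by transfer (auto simp: qone_def qmul_qmono_left)
  show "a * 1 = a" by transfer (auto simp: qone_def qmul_qmono_right)
  show "a + b + c = a + (b + c)" by transfer (simp add: add.assoc)
  show "a + b = b + a" by transfer (simp add: add.commute)
  show "0 + a = a" by transfer simp
  show "- a + a = 0" by transfer simp
  show "a - b = a + - b" by transfer simp
  show "(0::qt) \<noteq> 1" by transfer (auto simp: qone_def qmono_def fun_eq_iff)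
qed

end

section \<open>Twisted power series\<close>

declare split_paired_All [simp del] split_paired_Ex [simp del]

text \<open>
  The exponent \<open>p\<^sub>1\<^sup>*(n)\<close> of \<open>n = n\<^sub>0 e\<^sub>0 + n\<^sub>1 e\<^sub>1\<close>. Elements of \<open>N\<^sup>+ \<union> {0}\<close> are represented by pairs of natural
  numbers, on which induction by degree is convenient.
\<close>

definition pv :: "nat \<times> nat \<Rightarrow> lvec" where
  "pv n = mv (- 2 * int (snd n)) (3 * int (fst n))"

lemma pv_eq_iff [simp]: "pv a = pv b \<longleftrightarrow> a = b"
  by (auto simp: pv_def prod_eq_iff)

lemma pv_add: "pv (a + b) = pv a + pv b"
  by (simp add: pv_def)

lemma pv_0 [simp]: "pv 0 = 0"
  by (simp add: pv_def)

definition below :: "nat \<times> nat \<Rightarrow> (nat \<times> nat) set" where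
  "below n = {..fst n} \<times> {..snd n}"

lemma finite_below [simp]: "finite (below n)" by (simp add: below_def)

lemma below_iff: "a \<in> below n \<longleftrightarrow> (\<exists>b. n = a + b)"
proof
  assume "a \<in> below n"
  then have "n = a + (n - a)" by (cases n, cases a) (auto simp: below_def)
  then show "\<exists>b. n = a + b" by blast
qed (auto simp: below_def mem_Times_iff)

lemma below_diff [simp]: "a \<in> below n \<Longrightarrow> a + (n - a) = n" "a \<in> below n \<Longrightarrow> (n - a) + a = n"
  by (auto simp: below_def prod_eq_iff)

lemma self_in_below [simp]: "n \<in> below n" "0 \<in> below n" by (auto simp: below_def mem_Times_iff)

abbreviation tdeg :: "nat \<times> nat \<Rightarrow> nat" where
  "tdeg n \<equiv> fst n + snd n"

lemma tdeg_below: "a \<in> below n \<Longrightarrow> a \<noteq> n \<Longrightarrow> tdeg a < tdeg n"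
  by (auto simp: below_def prod_eq_iff)

lemma tdeg_below': "a \<in> below n \<Longrightarrow> a \<noteq> 0 \<Longrightarrow> tdeg (n - a) < tdeg n"
  by (auto simp: below_def prod_eq_iff)

definition tn :: "nat \<times> nat \<Rightarrow> nat \<times> nat \<Rightarrow> coeff" where
  "tn a b = tw (pv a) (pv b)"

lemma tn_0 [simp]: "tn 0 a = 1" "tn a 0 = 1" by (simp_all add: tn_def)

definition conv :: "(nat \<times> nat \<Rightarrow> coeff) \<Rightarrow> (nat \<times> nat \<Rightarrow> coeff) \<Rightarrow> nat \<times> nat \<Rightarrow> coeff" where
  "conv f g n = (\<Sum>a\<in>below n. f a * g (n - a) * tn a (n - a))"

text \<open>
  The subring of series in the monomials \<open>A\<^bsup>p\<^sub>1\<^sup>*(n)\<^esup>\<close>, with \<open>conv\<close> as its product.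
\<close>

definition emb :: "(nat \<times> nat \<Rightarrow> coeff) \<Rightarrow> qt" where
  "emb f = Abs_qt (\<lambda>u. if u \<in> range pv then f (the_inv pv u) else 0)"

lemma inj_pv: "inj pv" by (rule injI) simp

lemma coef_emb_raw: "coef (emb f) = (\<lambda>u. if u \<in> range pv then f (the_inv pv u) else 0)"
  unfolding emb_def
  by (rule Abs_qt_inverse, unfold qtorus_S23, rule exI[of _ 0]) (auto simp: pv_def)

lemma coef_emb [simp]: "coef (emb f) (pv n) = f n"
  by (simp add: coef_emb_raw the_inv_f_f[OF inj_pv])

lemma coef_emb_nonzeroE:
  assumes "coef (emb f) u \<noteq> 0" obtains n where "u = pv n" "f n \<noteq> 0"
proof -
  have "u \<in> range pv" using assms by (auto simp: coef_emb_raw split: if_splits)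
  then show ?thesis using assms that by auto
qed

lemma coef_emb_0: "u \<notin> range pv \<Longrightarrow> coef (emb f) u = 0"
  using coef_emb_nonzeroE by blast

lemma emb_eqI: assumes "\<And>n. coef x (pv n) = f n" "\<And>u. u \<notin> range pv \<Longrightarrow> coef x u = 0" shows "x = emb f"
proof -
  have "coef x u = coef (emb f) u" for u
    by (cases "u \<in> range pv") (auto simp: assms coef_emb_0)
  then show ?thesis by (metis coef_inject ext)
qed

lemma emb_inject [simp]: "emb f = emb g \<longleftrightarrow> f = g"
  by (metis coef_emb ext)

lemma emb_mult: "emb f * emb g = emb (conv f g)"
proof (rule emb_eqI)
  fix n
  let ?P = "(\<lambda>a. (pv a, pv (n - a))) ` below n"
  have "coef (emb f * emb g) (pv n) = (\<Sum>(a, b)\<in>?P. coef (emb f) a * coef (emb g) b * tw a b)"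
    unfolding times_qt.rep_eq
  proof (rule qmul_superset)
    show "qpairs (coef (emb f)) (coef (emb g)) (pv n) \<subseteq> ?P"
    proof
      fix p assume "p \<in> qpairs (coef (emb f)) (coef (emb g)) (pv n)"
      then obtain a b where p: "p = (a, b)" "a + b = pv n" "coef (emb f) a \<noteq> 0" "coef (emb g) b \<noteq> 0"
        by (auto simp: qpairs_def)
      obtain i j where ij: "a = pv i" "b = pv j"
        using p(3,4) by (meson coef_emb_nonzeroE)
      then have "i + j = n" using p(2) by (simp flip: pv_add)
      then have "i \<in> below n" "j = n - i" by (auto simp: below_iff)
      then show "p \<in> ?P" using p ij by auto
    qed
  qed (auto simp flip: pv_add)
  also have "\<dots> = conv f g n"
    by (subst sum.reindex) (auto simp: inj_on_def conv_def tn_def)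
  finally show "coef (emb f * emb g) (pv n) = conv f g n" .
next
  fix u assume u: "u \<notin> range pv"
  show "coef (emb f * emb g) u = 0"
  proof (rule ccontr)
    assume "coef (emb f * emb g) u \<noteq> 0"
    then obtain a b where "a + b = u" "coef (emb f) a \<noteq> 0" "coef (emb g) b \<noteq> 0"
      unfolding times_qt.rep_eq by (rule qmul_nonzeroE)
    then show False using u by (metis coef_emb_nonzeroE pv_add rangeI)
  qed
qed

definition delta :: "nat \<times> nat \<Rightarrow> coeff" where "delta n = (if n = 0 then 1 else 0)"

lemma emb_delta: "emb delta = 1"
proof (rule emb_eqI[symmetric])
  show "coef 1 (pv n) = delta n" for n
    by (simp add: one_qt.rep_eq qone_def qmono_def delta_def flip: pv_0)
  show "coef 1 u = 0" if "u \<notin> range pv" for u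
  proof -
    have "u \<noteq> 0" using that pv_0 by (metis rangeI)
    then show ?thesis by (simp add: one_qt.rep_eq qone_def qmono_def)
  qed
qed

lemma emb_diff: "emb f - emb g = emb (\<lambda>n. f n - g n)"
  by (rule emb_eqI) (auto simp: minus_qt.rep_eq coef_emb_0)

lemma conv_assoc: "conv (conv f g) h = conv f (conv g h)"
  by (metis emb_inject emb_mult mult.assoc)

lemma conv_delta [simp]: "conv f delta = f" "conv delta f = f"
  by (metis emb_inject emb_mult emb_delta mult_1 mult_1_right)+

text \<open>
  For an additively closed \<open>C\<close> this is the pro-unipotent group whose Lie algebra is the part of the completed
  Lie algebra with exponents in \<open>C\<close>; it is used for arbitrary \<open>C\<close>. The value at \<open>0\<close> is always \<open>1\<close>, whether
  or not \<open>0 \<in> C\<close>.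
\<close>

definition unip :: "(nat \<times> nat) set \<Rightarrow> (nat \<times> nat \<Rightarrow> coeff) set" where
  "unip C = {f. f 0 = 1 \<and> (\<forall>n. n \<noteq> 0 \<longrightarrow> n \<notin> C \<longrightarrow> f n = 0)}"

lemma unip_I: "f 0 = 1 \<Longrightarrow> (\<And>n. n \<noteq> 0 \<Longrightarrow> n \<notin> C \<Longrightarrow> f n = 0) \<Longrightarrow> f \<in> unip C"
  by (simp add: unip_def)

lemma unip_0: "f \<in> unip C \<Longrightarrow> f 0 = 1" by (simp add: unip_def)

lemma unip_outside: "f \<in> unip C \<Longrightarrow> n \<notin> C \<Longrightarrow> n \<noteq> 0 \<Longrightarrow> f n = 0"
  by (simp add: unip_def)

lemma unip_mono: "f \<in> unip C \<Longrightarrow> C \<subseteq> D \<Longrightarrow> f \<in> unip D"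
  by (auto simp: unip_def)

lemma delta_in_unip [simp]: "delta \<in> unip C" by (simp add: unip_def delta_def)

definition add_closed :: "(nat \<times> nat) set \<Rightarrow> bool" where
  "add_closed M \<longleftrightarrow> (\<forall>a\<in>M. \<forall>b\<in>M. a + b \<in> M)"

text \<open>
  First summands of the decompositions of \<open>n\<close> into two nonzero exponents. Both summands have smaller degree,
  which drives all recursions below.
\<close>

definition proper :: "nat \<times> nat \<Rightarrow> (nat \<times> nat) set" where
  "proper n = below n - {0, n}"

lemma properD: assumes "a \<in> proper n"
  shows "a \<noteq> 0" "n - a \<noteq> 0" "tdeg a < tdeg n" "tdeg (n - a) < tdeg n" "a + (n - a) = n" "a \<in> below n"
proof -
  show a: "a \<noteq> 0" "a \<in> below n" using assms by (auto simp: proper_def)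
  then show s: "a + (n - a) = n" by simp
  show "n - a \<noteq> 0" using s assms by (metis Diff_iff add.right_neutral proper_def insertCI)
  show "tdeg a < tdeg n" "tdeg (n - a) < tdeg n"
    using assms tdeg_below tdeg_below' by (auto simp: proper_def)
qed

lemma conv_expand:
  assumes "n \<noteq> 0"
  shows "conv f g n = f 0 * g n + f n * g 0 + (\<Sum>a\<in>proper n. f a * g (n - a) * tn a (n - a))"
proof -
  have "below n = insert 0 (insert n (proper n))" by (auto simp: proper_def)
  then have "conv f g n = (\<Sum>a\<in>insert 0 (insert n (proper n)). f a * g (n - a) * tn a (n - a))"
    by (simp add: conv_def)
  also have "\<dots> = f 0 * g n + f n * g 0 + (\<Sum>a\<in>proper n. f a * g (n - a) * tn a (n - a))"
    using assms by (subst sum.insert; (subst sum.insert)?) (auto simp: proper_def)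
  finally show ?thesis .
qed

lemma conv_0: "conv f g 0 = f 0 * g 0"
proof -
  have "below 0 = {0}" by (auto simp: below_def zero_prod_def)
  then show ?thesis by (simp add: conv_def)
qed

lemma conv_in_unip:
  assumes M: "add_closed M" and f: "f \<in> unip M" and g: "g \<in> unip M"
  shows "conv f g \<in> unip M"
proof (rule unip_I)
  fix n assume n: "n \<noteq> 0" "n \<notin> M"
  have "f a * g (n - a) * tn a (n - a) = 0" if "a \<in> proper n" for a
  proof -
    have "a \<notin> M \<or> n - a \<notin> M" using properD(5)[OF that] M n by (metis add_closed_def)
    then show ?thesis using unip_outside[OF f, of a] unip_outside[OF g, of "n - a"] properD(1,2)[OF that] by auto
  qed
  then have "(\<Sum>a\<in>proper n. f a * g (n - a) * tn a (n - a)) = 0" by (intro sum.neutral ballI)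
  then show "conv f g n = 0"
    using n unip_outside[OF f n(2,1)] unip_outside[OF g n(2,1)] by (simp add: conv_expand)
qed (use f g in \<open>auto simp: conv_0 unip_0\<close>)

text \<open>
  The equation \<open>conv f g = delta\<close> solved for \<open>g\<close> degree by degree.
\<close>

function cinv :: "(nat \<times> nat \<Rightarrow> coeff) \<Rightarrow> nat \<times> nat \<Rightarrow> coeff" where
  "cinv f n = (if n = 0 then 1
     else - f n - (\<Sum>a\<in>proper n. f a * cinv f (n - a) * tn a (n - a)))"
  by auto
termination
  by (relation "Wellfounded.measure (\<lambda>(f, n). tdeg n)") (auto dest: properD(4))

declare cinv.simps [simp del]

lemma conv_cinv: assumes "f 0 = 1" shows "conv f (cinv f) = delta"
proof
  fix n
  show "conv f (cinv f) n = delta n"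
  proof (cases "n = 0")
    case True
    then show ?thesis using assms by (simp add: conv_0 cinv.simps delta_def)
  next
    case False
    have 0: "cinv f 0 = 1" by (simp add: cinv.simps)
    show ?thesis
      using False assms 0 by (simp add: conv_expand delta_def) (subst cinv.simps, simp)
  qed
qed

lemma cinv_in_unip:
  assumes M: "add_closed M" and f: "f \<in> unip M" shows "cinv f \<in> unip M"
proof (rule unip_I)
  show "cinv f 0 = 1" by (simp add: cinv.simps)
  fix n :: "nat \<times> nat" assume "n \<noteq> 0" "n \<notin> M"
  then show "cinv f n = 0"
  proof (induction n rule: measure_induct_rule[where f = tdeg])
    case (less n)
    have "f a * cinv f (n - a) * tn a (n - a) = 0" if "a \<in> proper n" for a
    proof (cases "a \<in> M")
      case True
      then have "n - a \<notin> M" using properD(5)[OF that] M less.prems by (metis add_closed_def)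
      then show ?thesis using less.IH[of "n - a"] properD[OF that] by simp
    qed (use unip_outside[OF f] properD[OF that] in auto)
    then have "(\<Sum>a\<in>proper n. f a * cinv f (n - a) * tn a (n - a)) = 0" by (intro sum.neutral ballI)
    then show ?case
      using less.prems unip_outside[OF f] by (subst cinv.simps) simp
  qed
qed

text \<open>
  The right inverse \<open>cinv f\<close> has a right inverse itself, which must then be \<open>f\<close>.
\<close>

lemma cinv_conv: assumes "f 0 = 1" shows "conv (cinv f) f = delta"
proof -
  have 0: "cinv f 0 = 1" by (simp add: cinv.simps)
  have "conv (cinv f) (cinv (cinv f)) = delta" by (rule conv_cinv) (rule 0)
  then have "cinv (cinv f) = f"
    using conv_cinv[where f = f, OF assms] by (metis conv_assoc conv_delta)
  then show ?thesis using conv_cinv[where f = "cinv f", OF 0] by simp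
qed

section \<open>Factorization along a partition of the exponents\<close>

text \<open>
  In \<open>T = A B\<close> with \<open>A\<close> supported on \<open>C\<close> and \<open>B\<close> off \<open>C\<close>, the coefficient of \<open>T\<close> at \<open>n\<close> is
  \<open>A(n) + B(n)\<close> plus terms of smaller degree, and only one of \<open>A(n)\<close>, \<open>B(n)\<close> may be nonzero. Hence
  one recursion determines both factors.
\<close>

function factor_coeff :: "(nat \<times> nat) set \<Rightarrow> (nat \<times> nat \<Rightarrow> coeff) \<Rightarrow> nat \<times> nat \<Rightarrow> coeff" where
  "factor_coeff C T n = T n - (\<Sum>a\<in>proper n. if a \<in> C \<and> n - a \<notin> C
     then factor_coeff C T a * factor_coeff C T (n - a) * tn a (n - a) else 0)"
  by auto
termination
  by (relation "Wellfounded.measure (\<lambda>(C, T, n). tdeg n)") (auto dest: properD(3,4))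

declare factor_coeff.simps [simp del]

definition lower :: "(nat \<times> nat) set \<Rightarrow> (nat \<times> nat \<Rightarrow> coeff) \<Rightarrow> nat \<times> nat \<Rightarrow> coeff" where
  "lower C T n = (if n = 0 then 1 else if n \<in> C then factor_coeff C T n else 0)"

definition upper :: "(nat \<times> nat) set \<Rightarrow> (nat \<times> nat \<Rightarrow> coeff) \<Rightarrow> nat \<times> nat \<Rightarrow> coeff" where
  "upper C T n = (if n = 0 then 1 else if n \<notin> C then factor_coeff C T n else 0)"

lemma lower_upper: assumes "T 0 = 1" shows "conv (lower C T) (upper C T) = T"
proof
  fix n
  show "conv (lower C T) (upper C T) n = T n"
  proof (cases "n = 0")
    case False
    have "(\<Sum>a\<in>proper n. lower C T a * upper C T (n - a) * tn a (n - a)) =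
      (\<Sum>a\<in>proper n. if a \<in> C \<and> n - a \<notin> C then factor_coeff C T a * factor_coeff C T (n - a) * tn a (n - a) else 0)"
      by (rule sum.cong) (auto simp: lower_def upper_def dest: properD(1,2))
    moreover have "upper C T n + lower C T n = factor_coeff C T n"
      using False by (simp add: lower_def upper_def)
    ultimately show ?thesis
      using False by (simp add: conv_expand) (simp add: lower_def upper_def factor_coeff.simps[of C T n])
  qed (simp add: conv_0 lower_def upper_def assms)
qed

lemma factor_coeff_unique:
  assumes A: "A \<in> unip C" and B: "B \<in> unip (- C)" and T: "conv A B = T"
  shows "A = lower C T" "B = upper C T"
proof -
  have *: "A n = lower C T n \<and> B n = upper C T n" for n
  proof (induction n rule: measure_induct_rule[where f = tdeg])
    case (less n)
    show ?case
    proof (cases "n = 0")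
      case False
      have "(\<Sum>a\<in>proper n. A a * B (n - a) * tn a (n - a)) =
        (\<Sum>a\<in>proper n. if a \<in> C \<and> n - a \<notin> C then factor_coeff C T a * factor_coeff C T (n - a) * tn a (n - a) else 0)"
      proof (rule sum.cong[OF refl])
        fix a assume a: "a \<in> proper n"
        then show "A a * B (n - a) * tn a (n - a) =
          (if a \<in> C \<and> n - a \<notin> C then factor_coeff C T a * factor_coeff C T (n - a) * tn a (n - a) else 0)"
          using properD[OF a] less.IH[of a] less.IH[of "n - a"] by (auto simp: lower_def upper_def)
      qed
      then have "A n + B n = factor_coeff C T n"
        using conv_expand[OF False, of A B] T unip_0[OF A] unip_0[OF B]
        by (subst factor_coeff.simps) (simp add: algebra_simps)
      then show ?thesis
        using False unip_outside[OF A] unip_outside[OF B] by (cases "n \<in> C") (auto simp: lower_def upper_def)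
    qed (use A B in \<open>auto simp: unip_0 lower_def upper_def\<close>)
  qed
  show "A = lower C T" "B = upper C T" using * by auto
qed

lemma factor_coeff_support:
  assumes K: "add_closed K" and T: "T \<in> unip K"
  shows "n \<noteq> 0 \<Longrightarrow> n \<notin> K \<Longrightarrow> factor_coeff C T n = 0"
proof (induction n rule: measure_induct_rule[where f = tdeg])
  case (less n)
  have "(if a \<in> C \<and> n - a \<notin> C then factor_coeff C T a * factor_coeff C T (n - a) * tn a (n - a) else 0) = 0"
    if "a \<in> proper n" for a
  proof -
    have "a \<notin> K \<or> n - a \<notin> K" using properD(5)[OF that] K less.prems by (metis add_closed_def)
    then have "factor_coeff C T a = 0 \<or> factor_coeff C T (n - a) = 0" using less.IH properD[OF that] by blast
    then show ?thesis by auto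
  qed
  then have "(\<Sum>a\<in>proper n. if a \<in> C \<and> n - a \<notin> C
      then factor_coeff C T a * factor_coeff C T (n - a) * tn a (n - a) else 0) = 0" by (intro sum.neutral ballI)
  then show ?case using unip_outside[OF T less.prems(2,1)] by (subst factor_coeff.simps) simp
qed

lemma lower_in_unip: "lower C T \<in> unip C" by (auto simp: unip_def lower_def)
lemma upper_in_unip: "upper C T \<in> unip (- C)" by (auto simp: unip_def upper_def)

lemma lower_support: "add_closed K \<Longrightarrow> T \<in> unip K \<Longrightarrow> lower C T \<in> unip (C \<inter> K)"
  by (auto simp: unip_def lower_def factor_coeff_support unip_I)

text \<open>
  Up to degree \<open>k\<close> the factorization depends only on the part of \<open>C\<close> of degree at most \<open>k\<close>. This is why the
  potential below is locally constant modulo degree \<open>k\<close> off finitely many rays.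
\<close>

lemma factor_coeff_local:
  assumes "\<And>n. tdeg n \<le> k \<Longrightarrow> n \<noteq> 0 \<Longrightarrow> n \<in> C \<longleftrightarrow> n \<in> D"
  shows "tdeg n \<le> k \<Longrightarrow> factor_coeff C T n = factor_coeff D T n"
proof (induction n rule: measure_induct_rule[where f = tdeg])
  case (less n)
  have "(\<Sum>a\<in>proper n. if a \<in> C \<and> n - a \<notin> C then factor_coeff C T a * factor_coeff C T (n - a) * tn a (n - a) else 0) =
    (\<Sum>a\<in>proper n. if a \<in> D \<and> n - a \<notin> D then factor_coeff D T a * factor_coeff D T (n - a) * tn a (n - a) else 0)"
  proof (rule sum.cong[OF refl])
    fix a assume a: "a \<in> proper n"
    have "a \<in> C \<longleftrightarrow> a \<in> D" "n - a \<in> C \<longleftrightarrow> n - a \<in> D" "factor_coeff C T a = factor_coeff D T a" "factor_coeff C T (n - a) = factor_coeff D T (n - a)"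
      using assms[of a] assms[of "n - a"] less.IH[of a] less.IH[of "n - a"] properD[OF a] less.prems
      by (meson le_trans less_imp_le)+
    then show "(if a \<in> C \<and> n - a \<notin> C then factor_coeff C T a * factor_coeff C T (n - a) * tn a (n - a) else 0) =
       (if a \<in> D \<and> n - a \<notin> D then factor_coeff D T a * factor_coeff D T (n - a) * tn a (n - a) else 0)" by simp
  qed
  then show ?case by (subst (1 2) factor_coeff.simps) simp
qed

lemma lower_local:
  assumes "\<And>n. tdeg n \<le> k \<Longrightarrow> n \<noteq> 0 \<Longrightarrow> n \<in> C \<longleftrightarrow> n \<in> D" "tdeg n \<le> k"
  shows "lower C T n = lower D T n"
  using factor_coeff_local[OF assms(1) assms(2)] assms by (auto simp: lower_def)

text \<open>
  The quotient of the lower factors for \<open>C \<subseteq> D\<close>, obtained as a factor of the upper factor of \<open>C\<close>.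
\<close>

definition jump :: "(nat \<times> nat) set \<Rightarrow> (nat \<times> nat) set \<Rightarrow> (nat \<times> nat \<Rightarrow> coeff) \<Rightarrow> nat \<times> nat \<Rightarrow> coeff" where
  "jump C D T = lower D (upper C T)"

lemma jump:
  assumes CD: "C \<subseteq> D" and "add_closed D" "add_closed (- C)" and T: "T 0 = 1"
  shows "jump C D T \<in> unip (D - C)" "lower D T = conv (lower C T) (jump C D T)"
proof -
  have 1: "upper C T \<in> unip (- C)" by (rule upper_in_unip)
  have J: "jump C D T \<in> unip (D \<inter> - C)"
    unfolding jump_def by (rule lower_support) (use assms 1 in auto)
  then show "jump C D T \<in> unip (D - C)" by (simp add: Diff_eq)
  have "conv (jump C D T) (upper D (upper C T)) = upper C T"
    unfolding jump_def by (rule lower_upper) (rule unip_0[OF 1])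
  then have "conv (conv (lower C T) (jump C D T)) (upper D (upper C T)) = T"
    by (simp add: conv_assoc lower_upper T)
  moreover have "conv (lower C T) (jump C D T) \<in> unip D"
    by (rule conv_in_unip) (use assms J lower_in_unip in \<open>auto intro: unip_mono\<close>)
  ultimately show "lower D T = conv (lower C T) (jump C D T)"
    using factor_coeff_unique(1) upper_in_unip by metis
qed

section \<open>Inverses and conjugation\<close>

instance fract :: ("{idom,ring_char_0}") field_char_0
proof
  have "of_nat n = to_fract (of_nat n :: 'a)" for n
    by (induction n) simp_all
  then show "inj (of_nat :: nat \<Rightarrow> 'a fract)"
    by (auto simp: inj_on_def)
qed

lemma emb_cinv: assumes "f 0 = 1" shows "emb f * emb (cinv f) = 1" "emb (cinv f) * emb f = 1"
  using assms by (simp_all add: emb_mult conv_cinv cinv_conv emb_delta)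

lemma cinv_0: "cinv f 0 = 1" by (simp add: cinv.simps)

lemma cinv_unique: assumes "f 0 = 1" "conv f g = delta" shows "g = cinv f"
  by (metis assms cinv_conv conv_assoc conv_delta)

lemma cinv_cinv: "f 0 = 1 \<Longrightarrow> cinv (cinv f) = f"
  using cinv_unique[of "cinv f" f] by (simp add: cinv_0 cinv_conv)

lemma cinv_delta [simp]: "cinv delta = delta"
  using cinv_unique[of delta delta] by (simp add: delta_def)

lemma cinv_mult: assumes "f 0 = 1" "g 0 = 1" shows "cinv (conv f g) = conv (cinv g) (cinv f)"
proof -
  have "conv (conv f g) (conv (cinv g) (cinv f)) = conv f (conv (conv g (cinv g)) (cinv f))"
    by (simp add: conv_assoc)
  also have "\<dots> = delta" using assms by (simp add: conv_cinv)
  finally show ?thesis using assms cinv_unique[of "conv f g"] by (simp add: conv_0)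
qed

lemma qinv_coef:
  assumes "g * h = 1" "h * g = 1"
  shows "qinv S23 (coef g) = coef h"
  unfolding qinv_def
proof (rule the_equality)
  show "coef h \<in> qtorus S23 \<and> qmul S23 (coef g) (coef h) = qone \<and> qmul S23 (coef h) (coef g) = qone"
    using assms by (metis coef one_qt.rep_eq times_qt.rep_eq)
  fix k assume k: "k \<in> qtorus S23 \<and> qmul S23 (coef g) k = qone \<and> qmul S23 k (coef g) = qone"
  then obtain k' where k': "k = coef k'" by (metis Abs_qt_inverse)
  then have "k' * g = 1" using k by (metis coef_inject one_qt.rep_eq times_qt.rep_eq)
  then have "k' = h" using assms by (metis mult.assoc mult_1 mult_1_right)
  then show "k = coef h" using k' by simp
qed

definition conj_by :: "(nat \<times> nat \<Rightarrow> coeff) \<Rightarrow> qt \<Rightarrow> qt" where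
  "conj_by f x = emb (cinv f) * x * emb f"

definition signed :: "real \<Rightarrow> (nat \<times> nat \<Rightarrow> coeff) \<Rightarrow> nat \<times> nat \<Rightarrow> coeff" where
  "signed s f = (if s > 0 then f else if s < 0 then cinv f else delta)"

lemma signed_0: "f 0 = 1 \<Longrightarrow> signed s f 0 = 1"
  by (simp add: signed_def cinv_0 delta_def)

lemma theta_aut_coef:
  assumes "f 0 = 1"
  shows "theta_aut S23 (coef (emb f)) (coef x) = coef (conj_by f x)"
  using qinv_coef[OF emb_cinv[of f, OF assms]]
  by (simp add: theta_aut_def conj_by_def times_qt.rep_eq)

text \<open>
  Wall crossing automorphisms become conjugations in the ring; all group theory from here on takes place
  among series on the cone.
\<close>

lemma theta_aut_sgn_coef:
  assumes "f 0 = 1"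
  shows "theta_aut_sgn S23 (coef (emb f)) s (coef x) = coef (conj_by (signed s f) x)"
  using theta_aut_coef[of f x] theta_aut_coef[of "cinv f" x] assms qinv_coef[OF emb_cinv[of f, OF assms]]
  by (auto simp: theta_aut_sgn_def signed_def cinv_0) (simp add: conj_by_def emb_delta)

lemma conj_by_conv:
  assumes "f 0 = 1" "g 0 = 1"
  shows "conj_by (conv f g) x = conj_by g (conj_by f x)"
  by (simp add: conj_by_def cinv_mult assms emb_mult[symmetric] mult.assoc)

lemma conj_by_delta [simp]: "conj_by delta x = x"
  by (simp add: conj_by_def emb_delta)

section \<open>Truncation by degree\<close>

definition eq_upto :: "nat \<Rightarrow> (nat \<times> nat \<Rightarrow> coeff) \<Rightarrow> (nat \<times> nat \<Rightarrow> coeff) \<Rightarrow> bool" where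
  "eq_upto k f g \<longleftrightarrow> (\<forall>n. tdeg n \<le> k \<longrightarrow> f n = g n)"

lemma eq_upto_refl [simp]: "eq_upto k f f" by (simp add: eq_upto_def)
lemma eq_upto_sym: "eq_upto k f g \<Longrightarrow> eq_upto k g f" by (simp add: eq_upto_def)
lemma eq_upto_trans [trans]: "eq_upto k f g \<Longrightarrow> eq_upto k g h \<Longrightarrow> eq_upto k f h" by (simp add: eq_upto_def)

lemma eq_upto_conv: assumes "eq_upto k f f'" "eq_upto k g g'" shows "eq_upto k (conv f g) (conv f' g')"
  unfolding eq_upto_def conv_def
proof (intro allI impI sum.cong refl)
  fix n a assume n: "tdeg n \<le> k" and a: "a \<in> below n"
  have "tdeg a \<le> k" "tdeg (n - a) \<le> k" using n a by (auto simp: below_def)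
  then show "f a * g (n - a) * tn a (n - a) = f' a * g' (n - a) * tn a (n - a)"
    using assms by (simp add: eq_upto_def)
qed

lemma eq_upto_cinv: assumes "eq_upto k f g" "f 0 = 1" "g 0 = 1" shows "eq_upto k (cinv f) (cinv g)"
proof -
  have "eq_upto k (conv (cinv f) (conv g (cinv g))) (conv (cinv f) (conv f (cinv g)))"
    using assms by (intro eq_upto_conv eq_upto_refl) (rule eq_upto_sym)
  moreover have "conv (cinv f) (conv f (cinv g)) = cinv g"
    using assms by (simp add: conv_assoc[symmetric] cinv_conv)
  ultimately show ?thesis using assms by (simp add: conv_cinv)
qed

text \<open>
  A valuation bound: \<open>u 1 - u 0\<close> is nonnegative on the cone and grows with the degree there, so that it
  detects to which order two conjugations agree on a given element of the torus.
\<close>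

definition order_ge :: "int \<Rightarrow> qt \<Rightarrow> bool" where
  "order_ge r x \<longleftrightarrow> (\<forall>u. coef x u \<noteq> 0 \<longrightarrow> r \<le> u 1 - u 0)"

lemma order_ge_mult: assumes "order_ge r x" "order_ge s y" shows "order_ge (r + s) (x * y)"
  unfolding order_ge_def times_qt.rep_eq
proof (intro allI impI)
  fix u assume "qmul S23 (coef x) (coef y) u \<noteq> 0"
  then obtain a b where "a + b = u" "coef x a \<noteq> 0" "coef y b \<noteq> 0" by (rule qmul_nonzeroE)
  then show "r + s \<le> u 1 - u 0" using assms by (auto simp: order_ge_def) fastforce
qed

lemma order_ge_add: "order_ge r x \<Longrightarrow> order_ge r y \<Longrightarrow> order_ge r (x + y)"
  unfolding order_ge_def plus_qt.rep_eq by (metis add.right_neutral)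

lemma order_ge_emb: "order_ge 0 (emb f)"
  unfolding order_ge_def by (auto simp: pv_def elim!: coef_emb_nonzeroE)

lemma order_ge_emb_diff: "eq_upto k f g \<Longrightarrow> order_ge (int k + 1) (emb f - emb g)"
  unfolding order_ge_def emb_diff
proof (intro allI impI)
  fix u assume *: "eq_upto k f g" "coef (emb (\<lambda>n. f n - g n)) u \<noteq> 0"
  then obtain n where n: "u = pv n" "f n \<noteq> g n" by (auto elim: coef_emb_nonzeroE)
  then have "tdeg n > k" using * unfolding eq_upto_def by (meson not_le)
  then show "int k + 1 \<le> u 1 - u 0" by (simp add: n pv_def)
qed

lemma order_ge_ex: "\<exists>r. order_ge r x"
proof -
  obtain K where "\<forall>u. coef x u \<noteq> 0 \<longrightarrow> u \<in> M_lat S23 \<and> u 0 \<le> K \<and> - K \<le> u 1"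
    using coef[of x] unfolding qtorus_S23 by blast
  then have "order_ge (- 2 * K) x" unfolding order_ge_def by fastforce
  then show ?thesis by blast
qed

text \<open>
  Elements which agree up to degree \<open>k\<close> conjugate \<open>x\<close> to elements with the same coefficient at \<open>u\<close>, as soon as \<open>k\<close>
  is large compared with \<open>u\<close>. This turns congruences into equality of the limits over degrees.
\<close>

lemma conj_by_local:
  assumes "eq_upto k f g" "f 0 = 1" "g 0 = 1" "order_ge r x" "u 1 - u 0 < int k + 1 + r"
  shows "coef (conj_by f x) u = coef (conj_by g x) u"
proof -
  have "conj_by f x - conj_by g x =
      (emb (cinv f) - emb (cinv g)) * (x * emb f) + emb (cinv g) * (x * (emb f - emb g))"
    by (simp add: conj_by_def algebra_simps)
  moreover have "order_ge (int k + 1 + (r + 0)) ((emb (cinv f) - emb (cinv g)) * (x * emb f))"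
    using assms by (intro order_ge_mult order_ge_emb order_ge_emb_diff eq_upto_cinv)
  moreover have "order_ge (0 + (r + (int k + 1))) (emb (cinv g) * (x * (emb f - emb g)))"
    using assms by (intro order_ge_mult order_ge_emb order_ge_emb_diff)
  ultimately have "order_ge (int k + 1 + r) (conj_by f x - conj_by g x)"
    by (simp add: order_ge_add add.commute add.left_commute)
  then have "coef (conj_by f x - conj_by g x) u = 0"
    using assms(5) unfolding order_ge_def by (meson not_le)
  then show ?thesis by (simp add: minus_qt.rep_eq)
qed

section \<open>Elements supported on a ray\<close>

definition nscale :: "nat \<Rightarrow> nat \<times> nat \<Rightarrow> nat \<times> nat" where
  "nscale k n = (k * fst n, k * snd n)"

lemma nscale_inj: "n \<noteq> 0 \<Longrightarrow> nscale k n = nscale l n \<longleftrightarrow> k = l"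
  by (auto simp: nscale_def prod_eq_iff)

lemma nscale_add: "nscale (k + l) n = nscale k n + nscale l n"
  by (simp add: nscale_def algebra_simps)

lemma nscale_simps [simp]: "nscale 0 n = 0" "nscale 1 n = n" "nscale k n = 0 \<longleftrightarrow> k = 0 \<or> n = 0"
  by (auto simp: nscale_def prod_eq_iff)

definition nv :: "nat \<times> nat \<Rightarrow> lvec" where
  "nv n = mv (int (fst n)) (int (snd n))"

lemma p1star_nv: "p1star S23 (nv n) = pv n"
  by (simp add: p1star_S23 nv_def pv_def)

lemma nv_nscale: "(\<lambda>i. int k * nv n i) = nv (nscale k n)"
  by (auto simp: nv_def nscale_def mv_def)

text \<open>
  A power series evaluated at \<open>A\<^bsup>p\<^sub>1\<^sup>*(n)\<^esup>\<close>. Since \<open>\<Lambda>\<close> vanishes on parallel exponents, this is a ring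
  homomorphism into the torus.
\<close>

definition ray :: "nat \<times> nat \<Rightarrow> coeff fps \<Rightarrow> nat \<times> nat \<Rightarrow> coeff" where
  "ray n f m = (if \<exists>k. m = nscale k n then fps_nth f (THE k. m = nscale k n) else 0)"

lemma ray_nscale [simp]: "n \<noteq> 0 \<Longrightarrow> ray n f (nscale k n) = fps_nth f k"
  by (auto simp: ray_def nscale_inj)

lemma ray_0 [simp]: "n \<noteq> 0 \<Longrightarrow> ray n f 0 = fps_nth f 0"
  using ray_nscale[of n f 0] by simp

lemma ray_nonzeroE: assumes "ray n f m \<noteq> 0" obtains k where "m = nscale k n"
  using assms by (auto simp: ray_def split: if_splits)

lemma tn_nscale: "tn (nscale i n) (nscale j n) = 1"
  by (simp add: tn_def tw_def Lam_S23 pv_def nscale_def)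

lemma ray_mult: assumes n: "n \<noteq> 0" shows "conv (ray n f) (ray n g) = ray n (f * g)"
proof
  fix m
  have key: "\<exists>i j. a = nscale i n \<and> m - a = nscale j n \<and> m = nscale (i + j) n"
    if "a \<in> below m" "ray n f a * ray n g (m - a) * tn a (m - a) \<noteq> 0" for a
  proof -
    obtain i j where ij: "a = nscale i n" "m - a = nscale j n"
      using \<open>ray n f a * _ * _ \<noteq> 0\<close> by (auto elim!: ray_nonzeroE)
    then show ?thesis using below_diff(1)[OF that(1)] by (metis nscale_add)
  qed
  show "conv (ray n f) (ray n g) m = ray n (f * g) m"
  proof (cases "\<exists>k. m = nscale k n")
    case True
    then obtain k where k: "m = nscale k n" by blast
    have diff: "m - nscale i n = nscale (k - i) n" if "i \<le> k" for i
      using that by (simp add: k nscale_def diff_mult_distrib)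
    have "conv (ray n f) (ray n g) m =
        (\<Sum>a\<in>(\<lambda>i. nscale i n) ` {0..k}. ray n f a * ray n g (m - a) * tn a (m - a))"
      unfolding conv_def
    proof (rule sum.mono_neutral_right)
      show "(\<lambda>i. nscale i n) ` {0..k} \<subseteq> below m" by (auto simp: below_def k nscale_def)
      show "\<forall>a\<in>below m - (\<lambda>i. nscale i n) ` {0..k}. ray n f a * ray n g (m - a) * tn a (m - a) = 0"
      proof (intro ballI, rule ccontr)
        fix a assume a: "a \<in> below m - (\<lambda>i. nscale i n) ` {0..k}"
          "ray n f a * ray n g (m - a) * tn a (m - a) \<noteq> 0"
        then obtain i j where "a = nscale i n" "m = nscale (i + j) n" using key by blast
        then show False using a(1) k n by (auto simp: nscale_inj)
      qed
    qed auto
    also have "\<dots> = (\<Sum>i=0..k. fps_nth f i * fps_nth g (k - i))"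
      by (subst sum.reindex) (auto simp: inj_on_def nscale_inj n diff tn_nscale intro!: sum.cong)
    finally show ?thesis by (simp add: k n fps_mult_nth)
  next
    case False
    then have "conv (ray n f) (ray n g) m = 0"
      unfolding conv_def using key by (intro sum.neutral) blast
    then show ?thesis using False by (simp add: ray_def)
  qed
qed

lemma ray_1: "n \<noteq> 0 \<Longrightarrow> ray n 1 = delta"
proof
  fix m assume n: "n \<noteq> 0"
  show "ray n 1 m = delta m"
  proof (cases "\<exists>k. m = nscale k n")
    case True
    then show ?thesis using n by (auto simp: delta_def)
  next
    case False
    then show ?thesis by (metis delta_def ray_def nscale_simps(1))
  qed
qed

lemma ray_power: "n \<noteq> 0 \<Longrightarrow> emb (ray n f) ^ k = emb (ray n (f ^ k))"
  by (induction k) (simp_all add: ray_1 emb_delta emb_mult ray_mult)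

lemma qpow_coef: "qpow S23 (coef x) k = coef (x ^ k)"
  by (induction k) (simp_all add: one_qt.rep_eq times_qt.rep_eq)

text \<open>
  Substitution into power series in the torus reduces, along a ray, to composition of formal power series.
  This handles both the quantum dilogarithm and the exponential that defines the wall group.
\<close>

lemma qsubst_ray:
  assumes n: "n \<noteq> 0" and L: "fps_nth L 0 = 0"
  shows "qsubst S23 f (coef (emb (ray n L))) = coef (emb (ray n (fps_compose f L)))"
proof
  fix u
  have pw: "qpow S23 (coef (emb (ray n L))) k = coef (emb (ray n (L ^ k)))" for k
    by (simp add: qpow_coef ray_power n)
  show "qsubst S23 f (coef (emb (ray n L))) u = coef (emb (ray n (fps_compose f L))) u"
  proof (cases "\<exists>j. u = pv (nscale j n)")
    case True
    then obtain j where j: "u = pv (nscale j n)" by blast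
    have z: "fps_nth (L ^ k) j = 0" if "j < k" for k
      using startsby_zero_power_prefix[OF L] that by blast
    show ?thesis
      unfolding qsubst_def pw j coef_emb ray_nscale[OF n] fps_compose_nth
      by (rule sum.mono_neutral_left) (auto intro: ccontr simp: z not_le)
  next
    case False
    have "coef (emb (ray n h)) u = 0" for h
    proof (rule ccontr)
      assume "coef (emb (ray n h)) u \<noteq> 0"
      then obtain m where "u = pv m" "ray n h m \<noteq> 0" by (rule coef_emb_nonzeroE)
      then show False using False by (auto elim: ray_nonzeroE)
    qed
    then show ?thesis by (simp add: qsubst_def pw)
  qed
qed

text \<open>
  The logarithm of \<open>f\<close> is \<open>ln (1 + X)\<close> composed with \<open>f - 1\<close>.
\<close>

lemma fps_exp_surj:
  fixes f :: "'a :: field_char_0 fps"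
  assumes "fps_nth f 0 = 1"
  shows "\<exists>L. fps_nth L 0 = 0 \<and> fps_compose (fps_exp 1) L = f"
proof -
  have 1: "fps_compose (fps_exp 1 - 1) (fps_ln 1) = (fps_X :: 'a fps)"
    unfolding fps_ln_fps_exp_inv[OF one_neq_zero] by (rule fps_inv_right) auto
  have 2: "fps_compose (fps_exp 1) (fps_ln 1) = (1 + fps_X :: 'a fps)"
    using 1 by (simp add: fps_compose_sub_distrib algebra_simps)
  have f1: "fps_nth (f - 1) 0 = 0" using assms by simp
  have "fps_compose (fps_exp 1) (fps_compose (fps_ln 1) (f - 1)) =
     fps_compose (fps_compose (fps_exp 1) (fps_ln 1)) (f - 1)"
    by (rule fps_compose_assoc) (use f1 in auto)
  also have "\<dots> = f"
    unfolding 2 by (simp add: fps_compose_add_distrib fps_X_fps_compose_startby0[OF f1])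
  finally show ?thesis using f1 by (intro exI[of _ "fps_compose (fps_ln 1) (f - 1)"]) simp
qed

lemma ray_in_wall_group:
  assumes n: "n \<noteq> 0" and "fps_nth f 0 = 1"
  shows "coef (emb (ray n f)) \<in> wall_group S23 (nv n)"
proof -
  obtain L where L: "fps_nth L 0 = 0" "fps_compose (fps_exp 1) L = f"
    using fps_exp_surj[OF assms(2)] by blast
  have "Abs_fps (\<lambda>k. 1 / of_nat (fact k)) = (fps_exp 1 :: coeff fps)"
    by (simp add: fps_exp_def)
  then have "coef (emb (ray n f)) = qexp S23 (coef (emb (ray n L)))"
    by (simp add: qexp_def qsubst_ray n L)
  moreover have "\<exists>k\<ge>1. u = p1star S23 (\<lambda>i. int k * nv n i)" if "coef (emb (ray n L)) u \<noteq> 0" for u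
  proof -
    from that obtain m where m: "u = pv m" "ray n L m \<noteq> 0" by (rule coef_emb_nonzeroE)
    then obtain k where k: "m = nscale k n" by (auto elim: ray_nonzeroE)
    then have "k \<noteq> 0" using m L n by (metis ray_nscale)
    then have "k \<ge> 1" by simp
    then show ?thesis using m k by (intro exI[of _ k]) (auto simp: nv_nscale p1star_nv)
  qed
  ultimately show ?thesis unfolding wall_group_def by blast
qed

lemma ray_of_unip:
  assumes n: "n \<noteq> 0" and f: "f \<in> unip (range (\<lambda>k. nscale k n))"
  shows "f = ray n (Abs_fps (\<lambda>k. f (nscale k n)))"
proof
  fix m
  show "f m = ray n (Abs_fps (\<lambda>k. f (nscale k n))) m"
  proof (cases "\<exists>k. m = nscale k n")
    case False
    then have "m \<noteq> 0" by (metis nscale_simps(1))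
    then show ?thesis using False unip_outside[OF f, of m] by (auto simp: ray_def)
  qed (use n in auto)
qed

section \<open>Quantum dilogarithms\<close>

lemma v_power: "v ^ k = to_fract (monom 1 k)"
proof (induction k)
  case (Suc k)
  have "v = to_fract [:0, 1:]" by (simp add: v_def to_fract_def)
  then have "v ^ Suc k = to_fract ([:0, 1:] * monom 1 k)"
    using Suc by (simp only: power_Suc to_fract_mult)
  then show ?case by (simp add: monom_Suc)
qed simp

lemma v_power_inj [simp]: "v ^ k = v ^ l \<longleftrightarrow> k = l"
  by (simp add: v_power monom_eq_iff')

lemma v_power_eq_1 [simp]: "v ^ k = 1 \<longleftrightarrow> k = 0"
  using v_power_inj[of k 0] by simp

fun qdilog_coeff :: "coeff \<Rightarrow> nat \<Rightarrow> coeff" where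
  "qdilog_coeff p 0 = 1"
| "qdilog_coeff p (Suc k) = p * qdilog_coeff p k / (p ^ (2 * Suc k) - 1)"

text \<open>
  The functional equation is a two-term recursion for the coefficients, which can be solved
  because \<open>p\<close> is not a root of unity.
\<close>

lemma qdilog_eq:
  assumes "\<And>k. k > 0 \<Longrightarrow> p ^ k \<noteq> 1"
  shows "qdilog p = Abs_fps (qdilog_coeff p)"
proof -
  have nz: "p ^ (2 * Suc k) - 1 \<noteq> 0" for k using assms[of "2 * Suc k"] by simp
  have iff: "fps_nth f 0 = 1 \<and> fps_compose f (fps_const (p ^ 2) * fps_X) = (1 + fps_const p * fps_X) * f
    \<longleftrightarrow> f = Abs_fps (qdilog_coeff p)" for f
  proof -
    have "fps_compose f (fps_const (p ^ 2) * fps_X) = (1 + fps_const p * fps_X) * f \<longleftrightarrow>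
      (\<forall>k. p ^ (2 * k) * fps_nth f k = fps_nth f k + (if k = 0 then 0 else p * fps_nth f (k - 1)))"
      by (simp add: fps_eq_iff fps_compose_linear distrib_right mult.assoc power_mult)
    also have "\<dots> \<longleftrightarrow> (\<forall>k. fps_nth f (Suc k) = p * fps_nth f k / (p ^ (2 * Suc k) - 1))"
    proof -
      have "p ^ (2 * Suc k) * fps_nth f (Suc k) = fps_nth f (Suc k) + p * fps_nth f k \<longleftrightarrow>
        fps_nth f (Suc k) = p * fps_nth f k / (p ^ (2 * Suc k) - 1)" for k
        using nz[of k] by (simp add: eq_divide_eq algebra_simps del: power_Suc mult_Suc_right)
      then have Suc: "p ^ (2 * Suc k) * fps_nth f (Suc k) =
          fps_nth f (Suc k) + (if Suc k = 0 then 0 else p * fps_nth f (Suc k - 1)) \<longleftrightarrow>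
        fps_nth f (Suc k) = p * fps_nth f k / (p ^ (2 * Suc k) - 1)" for k
        by (simp only: nat.distinct(2) if_False diff_Suc_1)
      have all: "(\<forall>k. P k) \<longleftrightarrow> P 0 \<and> (\<forall>k. P (Suc k))" for P
        by (metis not0_implies_Suc)
      show ?thesis by (subst all, subst Suc) simp
    qed
    finally have *: "fps_compose f (fps_const (p ^ 2) * fps_X) = (1 + fps_const p * fps_X) * f \<longleftrightarrow>
      (\<forall>k. fps_nth f (Suc k) = p * fps_nth f k / (p ^ (2 * Suc k) - 1))" .
    show ?thesis
    proof
      assume A: "fps_nth f 0 = 1 \<and> fps_compose f (fps_const (p ^ 2) * fps_X) = (1 + fps_const p * fps_X) * f"
      have "fps_nth f k = qdilog_coeff p k" for k
        using A * by (induction k) auto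
      then show "f = Abs_fps (qdilog_coeff p)" by (simp add: fps_eq_iff)
    next
      assume "f = Abs_fps (qdilog_coeff p)"
      then show "fps_nth f 0 = 1 \<and> fps_compose f (fps_const (p ^ 2) * fps_X) = (1 + fps_const p * fps_X) * f"
        unfolding * by simp
    qed
  qed
  show ?thesis unfolding qdilog_def iff by simp
qed

lemma qdilog_v: assumes "k > 0"
  shows "fps_nth (qdilog (v ^ k)) 0 = 1" "fps_nth (qdilog (v ^ k)) 1 = 1 / (v ^ k - inverse (v ^ k))"
proof -
  have *: "qdilog (v ^ k) = Abs_fps (qdilog_coeff (v ^ k))"
    by (rule qdilog_eq) (use assms in \<open>simp flip: power_mult\<close>)
  show "fps_nth (qdilog (v ^ k)) 0 = 1" by (simp add: *)
  have "qdilog_coeff (v ^ k) (Suc 0) = 1 / (v ^ k - inverse (v ^ k))"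
    by (simp add: field_simps power2_eq_square)
  then show "fps_nth (qdilog (v ^ k)) 1 = 1 / (v ^ k - inverse (v ^ k))" by (simp add: * One_nat_def)
qed

definition E0 :: "nat \<times> nat \<Rightarrow> coeff" where "E0 = ray (1, 0) (qdilog (v ^ 3))"
definition E1 :: "nat \<times> nat \<Rightarrow> coeff" where "E1 = ray (0, 1) (qdilog (v ^ 2))"

lemma initial_wall_fun:
  assumes n: "n \<noteq> 0"
  shows "qsubst S23 f (qmono 1 (pv n)) = coef (emb (ray n f))"
proof -
  have "emb (ray n fps_X) = Abs_qt (qmono 1 (pv n))"
  proof (rule emb_eqI[symmetric])
    have q: "coef (Abs_qt (qmono 1 (pv n))) = qmono 1 (pv n)"
      by (rule Abs_qt_inverse) (simp add: qmono_in_qtorus pv_def)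
    show "coef (Abs_qt (qmono 1 (pv n))) u = 0" if "u \<notin> range pv" for u
      using that unfolding q by (auto simp: qmono_def)
    fix m
    show "coef (Abs_qt (qmono 1 (pv n))) (pv m) = ray n fps_X m"
    proof (cases "\<exists>k. m = nscale k n")
      case True
      then obtain k where k: "m = nscale k n" by blast
      show ?thesis unfolding k q using n nscale_inj[of n k 1] by (simp add: qmono_def)
    next
      case False
      then have "m \<noteq> n" by (metis nscale_simps(2))
      with False show ?thesis unfolding q by (simp add: qmono_def ray_def)
    qed
  qed
  then have "coef (emb (ray n fps_X)) = qmono 1 (pv n)"
    by (simp add: Abs_qt_inverse qmono_in_qtorus pv_def)
  then show ?thesis using qsubst_ray[OF n, of fps_X f] by simp
qed

lemma unit_vec_nv: "unit_vec 0 = nv (1, 0)" "unit_vec 1 = nv (0, 1)"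
  by (auto simp: unit_vec_def nv_def mv_def)

lemma d_lcm_S23: "d_lcm S23 = 6"
  by (simp add: d_lcm_def lcm_nat_def gcd_non_0_nat)

lemma initial_wall_S23:
  "initial_wall S23 0 = \<lparr> wnormal = nv (1, 0), wsupp = hyperplane S23 (nv (1, 0)), wfun = coef (emb E0) \<rparr>"
  "initial_wall S23 1 = \<lparr> wnormal = nv (0, 1), wsupp = hyperplane S23 (nv (0, 1)), wfun = coef (emb E1) \<rparr>"
  unfolding initial_wall_def unit_vec_nv p1star_nv d_lcm_S23
  by (simp_all add: initial_wall_fun E0_def E1_def zero_prod_def)

section \<open>The wall-crossing element at a point\<close>

definition npair :: "nat \<times> nat \<Rightarrow> rvec \<Rightarrow> real" where
  "npair n y = real (fst n) * (y 0 / 2) + real (snd n) * (y 1 / 3)"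

lemma pairing_S23: "pairing S23 n x = real_of_int (n 0) * (x 0 / 2) + real_of_int (n 1) * (x 1 / 3)"
  by (simp add: pairing_def)

lemma pairing_nv: "pairing S23 (nv n) x = npair n x"
  by (simp add: pairing_S23 nv_def npair_def)

lemma npair_add: "npair (a + b) y = npair a y + npair b y"
  by (simp add: npair_def algebra_simps)

lemma npair_0 [simp]: "npair 0 y = 0" "npair n 0 = 0" by (simp_all add: npair_def)

lemma M_real_S23: "x \<in> M_real S23 \<longleftrightarrow> (\<forall>i. i \<noteq> 0 \<and> i \<noteq> 1 \<longrightarrow> x i = 0)"
  by (auto simp: M_real_def)

lemma M_real_eq_0: "x \<in> M_real S23 \<Longrightarrow> x = 0 \<longleftrightarrow> x 0 = 0 \<and> x 1 = 0"
  unfolding M_real_S23 fun_eq_iff by (metis zero_fun_apply)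

lemma zero_in_M_real [simp]: "0 \<in> M_real S23" by (simp add: M_real_S23)

text \<open>
  The parts of the cone on which \<open>y\<close> is negative, or nonpositive. Both are half planes, so they and their
  complements are closed under addition.
\<close>

definition Cneg :: "rvec \<Rightarrow> (nat \<times> nat) set" where "Cneg y = {n. npair n y < 0}"
definition Cle :: "rvec \<Rightarrow> (nat \<times> nat) set" where "Cle y = {n. npair n y \<le> 0}"

lemma Cneg_closed: "add_closed (Cneg y)" "add_closed (- Cneg y)" "add_closed (Cle y)" "add_closed (- Cle y)"
  by (auto simp: add_closed_def Cneg_def Cle_def npair_add)

text \<open>
  The value of the potential in the third quadrant. The order of the factors makes the
  factorization trivial in the second quadrant, where no wall may be added.
\<close>

definition T23 :: "nat \<times> nat \<Rightarrow> coeff" where "T23 = conv E0 E1"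

lemma ray_in_unip:
  assumes "n \<noteq> 0" "fps_nth f 0 = 1"
  shows "ray n f \<in> unip (range (\<lambda>k. nscale k n))"
  by (rule unip_I) (use assms in \<open>auto simp: ray_def\<close>)

lemma E0_in_unip: "E0 \<in> unip {n. snd n = 0}"
  unfolding E0_def
  by (rule unip_mono[OF ray_in_unip]) (auto simp: qdilog_v zero_prod_def nscale_def)

lemma E1_in_unip: "E1 \<in> unip {n. fst n = 0}"
  unfolding E1_def
  by (rule unip_mono[OF ray_in_unip]) (auto simp: qdilog_v zero_prod_def nscale_def)

lemma E_outside: "snd n \<noteq> 0 \<Longrightarrow> E0 n = 0" "fst n \<noteq> 0 \<Longrightarrow> E1 n = 0"
  using unip_outside[OF E0_in_unip, of n] unip_outside[OF E1_in_unip, of n] by (cases "n = 0"; simp)+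

lemma E_0 [simp]: "E0 0 = 1" "E1 0 = 1" "T23 0 = 1"
  using E0_in_unip E1_in_unip by (auto simp: T23_def conv_0 unip_0)

text \<open>
  The wall function that consistency forces at the point \<open>y\<close>: the change of the potential across the line
  through \<open>y\<close> and the origin.
\<close>

definition jump_at :: "rvec \<Rightarrow> nat \<times> nat \<Rightarrow> coeff" where
  "jump_at y = jump (Cneg y) (Cle y) T23"

definition potential :: "rvec \<Rightarrow> nat \<times> nat \<Rightarrow> coeff" where
  "potential y = lower (Cneg y) T23"

lemma jump_at: "jump_at y \<in> unip {n. npair n y = 0}" "lower (Cle y) T23 = conv (potential y) (jump_at y)"
proof -
  have *: "Cneg y \<subseteq> Cle y" "Cle y - Cneg y = {n. npair n y = 0}" by (auto simp: Cneg_def Cle_def)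
  show "jump_at y \<in> unip {n. npair n y = 0}" "lower (Cle y) T23 = conv (potential y) (jump_at y)"
    using jump[OF *(1) Cneg_closed(3) Cneg_closed(2), of T23] by (simp_all add: * jump_at_def potential_def)
qed

lemma jump_at_0 [simp]: "jump_at y 0 = 1" using unip_0[OF jump_at(1)] .

lemma potential_0 [simp]: "potential y 0 = 1" by (simp add: potential_def lower_def)

lemma conv_edge_left:
  assumes "f 0 = 1" "\<And>a. a \<in> below n \<Longrightarrow> a \<noteq> 0 \<Longrightarrow> f a = 0"
  shows "conv f g n = g n"
proof -
  have "conv f g n = (\<Sum>a\<in>{0}. f a * g (n - a) * tn a (n - a))"
    unfolding conv_def by (rule sum.mono_neutral_right) (use assms in auto)
  then show ?thesis using assms(1) by simp
qed

lemma conv_edge_right: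
  assumes "g 0 = 1" "\<And>a. a \<in> below n \<Longrightarrow> a \<noteq> 0 \<Longrightarrow> g a = 0"
  shows "conv f g n = f n"
proof -
  have "f a * g (n - a) * tn a (n - a) = 0" if "a \<in> below n" "a \<noteq> n" for a
  proof -
    have "n - a \<in> below n" "n - a \<noteq> 0"
      using that below_diff[OF that(1)] by (metis below_iff, metis add_0)
    then show ?thesis using assms(2) by simp
  qed
  then have "conv f g n = (\<Sum>a\<in>{n}. f a * g (n - a) * tn a (n - a))"
    unfolding conv_def by (intro sum.mono_neutral_right) auto
  then show ?thesis using assms(1) by simp
qed

lemma T23_axes: "T23 (k, 0) = E0 (k, 0)" "T23 (0, k) = E1 (0, k)"
proof -
  show "T23 (k, 0) = E0 (k, 0)" unfolding T23_def
    by (rule conv_edge_right) (auto intro!: unip_outside[OF E1_in_unip] simp: below_def prod_eq_iff)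
  show "T23 (0, k) = E1 (0, k)" unfolding T23_def
    by (rule conv_edge_left) (auto intro!: unip_outside[OF E0_in_unip] simp: below_def prod_eq_iff)
qed

lemma lower_eq_E0:
  assumes "\<And>n. n \<noteq> 0 \<Longrightarrow> snd n = 0 \<Longrightarrow> n \<in> C" "\<And>n. n \<noteq> 0 \<Longrightarrow> fst n = 0 \<Longrightarrow> n \<notin> C"
  shows "lower C T23 = E0"
proof (rule factor_coeff_unique(1)[symmetric])
  show "E0 \<in> unip C" by (rule unip_I, simp) (use assms(1) E_outside(1) in blast)
  show "E1 \<in> unip (- C)" by (rule unip_I, simp) (use assms(2) E_outside(2) in blast)
qed (simp add: T23_def)

lemma lower_all: "(\<And>n. n \<in> C) \<Longrightarrow> lower C T23 = T23"
proof (rule factor_coeff_unique(1)[symmetric, where B = delta])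
  show "T23 \<in> unip C" if "\<And>n. n \<in> C" by (rule unip_I) (use that in simp_all)
qed simp_all

lemma lower_none: "(\<And>n. n \<notin> C) \<Longrightarrow> lower C T23 = delta"
  by (auto simp: lower_def delta_def)

lemma jump_at_cancel:
  assumes "lower (Cle y) T23 = conv (potential y) g" shows "jump_at y = g"
proof -
  have "conv (cinv (potential y)) (conv (potential y) (jump_at y)) = conv (cinv (potential y)) (conv (potential y) g)"
    using assms jump_at(2) by simp
  then show ?thesis by (simp add: conv_assoc[symmetric] cinv_conv)
qed

text \<open>
  On the upper half axis the lower factors are \<open>1\<close> and \<open>E0\<close>. On the lower half axis \<open>E0\<close> is what is
  left of \<open>T\<close> at multiples of \<open>e\<^sub>0\<close>, where the lower factor has only its constant term.
\<close>

lemma jump_at_vertical: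
  assumes "y 0 = 0" "y 1 \<noteq> 0"
  shows "jump_at y = E0"
proof (cases "y 1 > 0")
  case True
  have "lower (Cle y) T23 = E0"
    by (rule lower_eq_E0) (use assms True in \<open>auto simp: Cle_def npair_def prod_eq_iff not_le\<close>)
  moreover have "potential y = delta" unfolding potential_def
    by (rule lower_none) (use assms True in \<open>auto simp: Cneg_def npair_def not_less\<close>)
  ultimately show ?thesis by (intro jump_at_cancel) simp
next
  case False
  with assms have y1: "y 1 < 0" by simp
  have all: "lower (Cle y) T23 = T23"
    by (rule lower_all) (use assms y1 in \<open>auto simp: Cle_def npair_def mult_nonneg_nonpos\<close>)
  have eq: "conv (potential y) (jump_at y) = T23" using jump_at(2) all by simp
  show ?thesis
  proof
    fix n
    show "jump_at y n = E0 n"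
    proof (cases "snd n = 0")
      case True
      have "conv (potential y) (jump_at y) n = jump_at y n"
        by (rule conv_edge_left) (use True assms in \<open>auto simp: potential_def lower_def Cneg_def npair_def below_def\<close>)
      then show ?thesis using True eq T23_axes(1)[of "fst n"] by (metis prod.collapse)
    next
      case False
      then have "n \<noteq> 0" by auto
      then show ?thesis
        using False unip_outside[OF jump_at(1)[of y], of n] unip_outside[OF E0_in_unip, of n] assms by (simp add: npair_def)
    qed
  qed
qed

lemma jump_at_horizontal:
  assumes "y 1 = 0" "y 0 \<noteq> 0"
  shows "jump_at y = E1"
proof (cases "y 0 > 0")
  case False
  with assms have y0: "y 0 < 0" by simp
  have "potential y = E0" unfolding potential_def
    by (rule lower_eq_E0) (use assms y0 in \<open>auto simp: Cneg_def npair_def prod_eq_iff mult_less_0_iff\<close>)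
  moreover have "lower (Cle y) T23 = T23"
    by (rule lower_all) (use assms y0 in \<open>auto simp: Cle_def npair_def mult_nonneg_nonpos\<close>)
  ultimately show ?thesis by (intro jump_at_cancel) (simp add: T23_def)
next
  case True
  have none: "potential y = delta" unfolding potential_def
    by (rule lower_none) (use assms True in \<open>auto simp: Cneg_def npair_def not_less\<close>)
  then have J: "jump_at y = lower (Cle y) T23" using jump_at(2) by simp
  have eq: "conv (jump_at y) (upper (Cle y) T23) = T23"
    unfolding J by (rule lower_upper) simp
  show ?thesis
  proof
    fix n
    show "jump_at y n = E1 n"
    proof (cases "fst n = 0")
      case n: True
      have "conv (jump_at y) (upper (Cle y) T23) n = jump_at y n"
        by (rule conv_edge_right) (use True n assms in \<open>auto simp: upper_def Cle_def npair_def below_def\<close>)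
      then show ?thesis using n eq T23_axes(2)[of "snd n"] by (metis prod.collapse)
    next
      case False
      then have "n \<noteq> 0" by auto
      then show ?thesis
        using False unip_outside[OF jump_at(1)[of y], of n] unip_outside[OF E1_in_unip, of n] assms by (simp add: npair_def)
    qed
  qed
qed

text \<open>
  Every point of the open second quadrant is negative on \<open>e\<^sub>0\<close> and positive on \<open>e\<^sub>1\<close>, so the product
  \<open>E0 E1\<close> is the factorization already.
\<close>

lemma jump_at_second_quadrant:
  assumes "y 0 < 0" "y 1 > 0"
  shows "jump_at y = delta"
proof (rule jump_at_cancel)
  have "potential y = E0" unfolding potential_def
    by (rule lower_eq_E0) (use assms in \<open>auto simp: Cneg_def npair_def prod_eq_iff mult_less_0_iff\<close>)
  moreover have "lower (Cle y) T23 = E0"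
    by (rule lower_eq_E0) (use assms in \<open>auto simp: Cle_def npair_def prod_eq_iff mult_le_0_iff\<close>)
  ultimately show "lower (Cle y) T23 = conv (potential y) delta" by simp
qed

lemma jump_at_trivial:
  assumes "\<And>n. n \<noteq> 0 \<Longrightarrow> npair n y \<noteq> 0" shows "jump_at y = delta"
proof
  fix n show "jump_at y n = delta n"
    using unip_outside[OF jump_at(1)[of y], of n] assms[of n] by (auto simp: delta_def)
qed

lemma jump_at_scale:
  assumes "t > 0" "\<And>n. npair n x = t * npair n y" shows "jump_at x = jump_at y"
proof -
  have "Cneg x = Cneg y" "Cle x = Cle y"
    using assms by (auto simp: Cneg_def Cle_def mult_less_0_iff mult_le_0_iff)
  then show ?thesis by (simp add: jump_at_def)
qed

section \<open>The walls\<close>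

definition prim :: "(nat \<times> nat) set" where
  "prim = {n. 0 < fst n \<and> 0 < snd n \<and> coprime (fst n) (snd n)}"

text \<open>
  The vector \<open>- p\<^sub>1\<^sup>*(n)\<close>, which spans the outgoing ray orthogonal to \<open>n\<close>.
\<close>

definition wall_dir :: "nat \<times> nat \<Rightarrow> rvec" where
  "wall_dir n = real_vec (mv (2 * int (snd n)) (- 3 * int (fst n)))"

text \<open>
  On the line orthogonal to \<open>n\<close>, the inequality \<open>0 \<le> x 0\<close> selects the half in the fourth quadrant.
\<close>

definition out_wall :: "nat \<times> nat \<Rightarrow> wall" where
  "out_wall n = \<lparr> wnormal = nv n, wsupp = {x \<in> hyperplane S23 (nv n). 0 \<le> x 0},
     wfun = coef (emb (jump_at (wall_dir n))) \<rparr>"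

definition D23 :: "wall set" where
  "D23 = {initial_wall S23 0, initial_wall S23 1} \<union> out_wall ` prim"

lemma D23_cases:
  assumes "w \<in> D23"
  obtains "w = initial_wall S23 0" | "w = initial_wall S23 1" | n where "n \<in> prim" "w = out_wall n"
  using assms by (auto simp: D23_def)

lemma npair_wall_dir: "npair m (wall_dir n) = real (fst m) * real (snd n) - real (snd m) * real (fst n)"
  by (simp add: npair_def wall_dir_def real_vec_def)

lemma hyperplane_nv: "x \<in> hyperplane S23 (nv n) \<longleftrightarrow> x \<in> M_real S23 \<and> npair n x = 0"
  by (simp add: hyperplane_def pairing_nv)

lemma wsupp_initial:
  "x \<in> wsupp (initial_wall S23 0) \<longleftrightarrow> x \<in> M_real S23 \<and> x 0 = 0"
  "x \<in> wsupp (initial_wall S23 1) \<longleftrightarrow> x \<in> M_real S23 \<and> x 1 = 0"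
  by (auto simp: initial_wall_S23 hyperplane_nv npair_def)

lemma wsupp_out: "x \<in> wsupp (out_wall n) \<longleftrightarrow> x \<in> M_real S23 \<and> npair n x = 0 \<and> 0 \<le> x 0"
  by (auto simp: out_wall_def hyperplane_nv)

lemma wsupp_out_signs:
  assumes "n \<in> prim" "x \<in> wsupp (out_wall n)" "x \<noteq> 0"
  shows "0 < x 0" "x 1 < 0"
proof -
  have n: "fst n > 0" "snd n > 0" using assms(1) by (auto simp: prim_def)
  have x: "x \<in> M_real S23" "real (fst n) * (x 0 / 2) = - (real (snd n) * (x 1 / 3))" "0 \<le> x 0"
    using assms(2) by (auto simp: wsupp_out npair_def)
  have "x 0 \<noteq> 0" using x n assms(3) M_real_eq_0[OF x(1)] by auto
  then show "0 < x 0" using x(3) by simp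
  then have "real (snd n) * (x 1 / 3) < 0" using x(2) n(1) by (metis divide_pos_pos mult_pos_pos neg_0_less_iff_less of_nat_0_less_iff zero_less_numeral)
  then show "x 1 < 0" using n(2) by (simp add: mult_less_0_iff)
qed

lemma wsupp_out_scale:
  assumes "n \<in> prim" "x \<in> wsupp (out_wall n)" "x \<noteq> 0"
  shows "jump_at x = jump_at (wall_dir n)"
proof (rule jump_at_scale)
  have n: "fst n > 0" "snd n > 0" using assms(1) by (auto simp: prim_def)
  show t: "0 < x 0 / (2 * real (snd n))" using wsupp_out_signs(1)[OF assms] n by simp
  have "real (fst n) * (x 0 / 2) + real (snd n) * (x 1 / 3) = 0"
    using assms(2) by (auto simp: wsupp_out npair_def)
  then have x1: "x 1 = - 3 * real (fst n) * x 0 / (2 * real (snd n))"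
    using n by (simp add: field_simps)
  show "npair m x = x 0 / (2 * real (snd n)) * npair m (wall_dir n)" for m
    unfolding npair_wall_dir unfolding npair_def x1 using n by (simp add: field_simps)
qed

lemma wall_jump:
  assumes "w \<in> D23" "x \<in> wsupp w" "x \<noteq> 0"
  shows "wfun w = coef (emb (jump_at x))"
  using assms(1)
proof (cases rule: D23_cases)
  case 1
  then show ?thesis using assms jump_at_vertical[of x]
    by (auto simp: wsupp_initial M_real_eq_0) (simp add: initial_wall_S23)
next
  case 2
  then show ?thesis using assms jump_at_horizontal[of x]
    by (auto simp: wsupp_initial M_real_eq_0) (simp add: initial_wall_S23)
next
  case (3 n)
  then show ?thesis using assms wsupp_out_scale[of n x] by (auto simp: out_wall_def)
qed

lemma wall_normal:
  assumes "w \<in> D23"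
  obtains n where "n \<noteq> 0" "coprime (fst n) (snd n)" "wnormal w = nv n" "wsupp w \<subseteq> {x \<in> M_real S23. npair n x = 0}"
  using assms
proof (cases rule: D23_cases)
  case 1
  then show ?thesis using that[of "(1, 0)"]
    using hyperplane_nv by (simp add: initial_wall_S23(1) zero_prod_def) blast
next
  case 2
  then show ?thesis using that[of "(0, 1)"]
    using hyperplane_nv by (simp add: initial_wall_S23(2) zero_prod_def) blast
next
  case (3 n)
  moreover have "n \<noteq> 0" "coprime (fst n) (snd n)" using 3(1) by (auto simp: prim_def)
  moreover have "wnormal (out_wall n) = nv n" by (simp add: out_wall_def)
  moreover have "wsupp (out_wall n) \<subseteq> {x \<in> M_real S23. npair n x = 0}" using wsupp_out by blast
  ultimately show ?thesis using that[of n] by blast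
qed

lemma wall_unique:
  assumes "w \<in> D23" "w' \<in> D23" "x \<in> wsupp w" "x \<in> wsupp w'" "x \<noteq> 0"
  shows "w = w'"
proof -
  have M: "x \<in> M_real S23" using assms(1,3) wall_normal by blast
  have nz: "x 0 \<noteq> 0 \<or> x 1 \<noteq> 0" using M_real_eq_0[OF M] assms(5) by blast
  have signs: "x 0 > 0 \<and> x 1 < 0" if "n \<in> prim" "x \<in> wsupp (out_wall n)" for n
    using wsupp_out_signs that assms(5) by blast
  have out: "n = n'" if "n \<in> prim" "n' \<in> prim" "x \<in> wsupp (out_wall n)" "x \<in> wsupp (out_wall n')" for n n'
  proof -
    have s: "x 0 > 0" "x 1 < 0" using wsupp_out_signs[OF that(1,3) assms(5)] by auto
    have eqs: "real (fst n) * (x 0 / 2) = - (real (snd n) * (x 1 / 3))"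
      "real (fst n') * (x 0 / 2) = - (real (snd n') * (x 1 / 3))"
      using that by (auto simp: wsupp_out npair_def)
    then have "(real (fst n) * (x 0 / 2)) * (real (snd n') * (x 1 / 3)) =
       (real (fst n') * (x 0 / 2)) * (real (snd n) * (x 1 / 3))" by simp
    then have "real (fst n) * real (snd n') = real (fst n') * real (snd n)" using s by simp
    then have "fst n * snd n' = fst n' * snd n" by (metis of_nat_eq_iff of_nat_mult)
    then show "n = n'"
      using that(1,2) coprime_crossproduct_nat[of "fst n" "snd n" "fst n'" "snd n'"]
      by (auto simp: prim_def prod_eq_iff coprime_commute mult.commute)
  qed
  show ?thesis
    using assms(1)
  proof (cases rule: D23_cases)
    case 1
    show ?thesis using assms(2) by (cases rule: D23_cases)
        (use 1 assms nz in \<open>auto simp: wsupp_initial dest: signs\<close>)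
  next
    case 2
    show ?thesis using assms(2) by (cases rule: D23_cases)
        (use 2 assms nz in \<open>auto simp: wsupp_initial dest: signs\<close>)
  next
    case (3 n)
    show ?thesis using assms(2)
    proof (cases rule: D23_cases)
      case (3 n')
      then show ?thesis using \<open>n \<in> prim\<close> \<open>w = out_wall n\<close> out assms by blast
    qed (use 3 assms nz in \<open>auto simp: wsupp_initial dest: signs\<close>)
  qed
qed

text \<open>
  A point on no wall either is orthogonal to no nonzero exponent, and then nothing can jump there, or it lies in the
  second quadrant.
\<close>

lemma no_wall_jump:
  assumes M: "x \<in> M_real S23" and nz: "x \<noteq> 0" and no: "\<And>w. w \<in> D23 \<Longrightarrow> x \<notin> wsupp w"
  shows "jump_at x = delta"
proof (cases "\<exists>m. m \<noteq> 0 \<and> npair m x = 0")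
  case True
  then obtain m where m: "m \<noteq> 0" "npair m x = 0" by blast
  have x: "x 0 \<noteq> 0" "x 1 \<noteq> 0"
    using no[of "initial_wall S23 0"] no[of "initial_wall S23 1"] M by (auto simp: D23_def wsupp_initial)
  have eq: "real (fst m) * (x 0 / 2) = - (real (snd m) * (x 1 / 3))" using m by (simp add: npair_def)
  have m0: "fst m > 0" "snd m > 0" using m(1) eq x by (auto simp: prod_eq_iff intro!: gr0I)
  show ?thesis
  proof (cases "x 0 > 0")
    case False
    then have "x 0 < 0" using x by simp
    moreover have "x 1 > 0"
    proof (rule ccontr)
      assume "\<not> x 1 > 0"
      then have "real (snd m) * (x 1 / 3) < 0" "real (fst m) * (x 0 / 2) < 0"
        using x m0 \<open>x 0 < 0\<close> by (auto simp: mult_less_0_iff)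
      then show False using eq by linarith
    qed
    ultimately show ?thesis by (rule jump_at_second_quadrant)
  next
    case True
    define g n where "g = gcd (fst m) (snd m)" and "n = (fst m div g, snd m div g)"
    have g: "g > 0" "fst m = g * fst n" "snd m = g * snd n" using m0 by (auto simp: g_def n_def)
    have "coprime (fst n) (snd n)"
      using m0 by (simp add: n_def g_def div_gcd_coprime)
    then have "n \<in> prim" using g m0 by (auto simp: prim_def)
    moreover have "real g * npair n x = npair m x" by (simp add: npair_def g algebra_simps)
    then have "npair n x = 0" using m g by simp
    ultimately show ?thesis
      using no[of "out_wall n"] M True by (auto simp: D23_def wsupp_out)
  qed
qed (use jump_at_trivial in blast)

section \<open>The scattering diagram\<close>

lemma prim_nscale:
  assumes "n \<noteq> 0" "coprime (fst n) (snd n)" "fst m * snd n = snd m * fst n"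
  shows "m \<in> range (\<lambda>k. nscale k n)"
proof -
  have "fst n dvd fst m * snd n" by (simp add: assms(3))
  then have 1: "fst n dvd fst m" using assms(2) by (simp add: coprime_dvd_mult_left_iff)
  have "snd n dvd snd m * fst n" by (metis assms(3) dvd_triv_right)
  then have 2: "snd n dvd snd m" using assms(2) by (simp add: coprime_dvd_mult_left_iff coprime_commute)
  obtain i j where ij: "fst m = fst n * i" "snd m = snd n * j" using 1 2 by (auto elim!: dvdE)
  have eq: "fst n * snd n * i = fst n * snd n * j" using assms(3) ij by (simp add: ac_simps)
  show ?thesis
  proof (cases "fst n = 0 \<or> snd n = 0")
    case False
    then have "i = j" using eq by simp
    then show ?thesis using ij by (auto simp: nscale_def prod_eq_iff mult.commute intro!: image_eqI[of _ _ i])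
  next
    case True
    then show ?thesis
    proof
      assume "fst n = 0"
      then show ?thesis using ij by (auto simp: nscale_def prod_eq_iff mult.commute intro!: image_eqI[of _ _ j])
    next
      assume "snd n = 0"
      then show ?thesis using ij by (auto simp: nscale_def prod_eq_iff mult.commute intro!: image_eqI[of _ _ i])
    qed
  qed
qed

text \<open>
  Exponents orthogonal to the ray are multiples of \<open>n\<close> because \<open>n\<close> is primitive.
\<close>

lemma jump_out_wall:
  assumes "n \<in> prim" shows "jump_at (wall_dir n) \<in> unip (range (\<lambda>k. nscale k n))"
proof (rule unip_mono[OF jump_at(1)])
  have n: "n \<noteq> 0" "coprime (fst n) (snd n)" using assms by (auto simp: prim_def)
  show "{m. npair m (wall_dir n) = 0} \<subseteq> range (\<lambda>k. nscale k n)"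
  proof
    fix m assume "m \<in> {m. npair m (wall_dir n) = 0}"
    then have "real (fst m) * real (snd n) = real (snd m) * real (fst n)"
      by (simp add: npair_wall_dir)
    then have "fst m * snd n = snd m * fst n" by (metis of_nat_eq_iff of_nat_mult)
    then show "m \<in> range (\<lambda>k. nscale k n)" by (rule prim_nscale[OF n])
  qed
qed

lemma nv_N_plus: "n \<noteq> 0 \<Longrightarrow> nv n \<in> N_plus S23"
  unfolding N_plus_S23 nv_def by (metis prod.collapse zero_prod_def)

lemma nv_N_lat [simp]: "nv n \<in> N_lat S23" by (auto simp: N_lat_def nv_def mv_def)

lemma nv_primitive: "coprime (fst n) (snd n) \<Longrightarrow> primitive S23 (nv n)"
proof -
  assume *: "coprime (fst n) (snd n)"
  have "nv n ` sI S23 = {int (fst n), int (snd n)}" by (auto simp: nv_def)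
  moreover have "gcd (int (fst n)) (int (snd n)) = 1" using * by simp
  ultimately show "primitive S23 (nv n)" by (simp add: primitive_def)
qed

lemma pairing_uminus: "pairing S23 (- m) x = - pairing S23 m x"
  by (simp add: pairing_S23)

lemma uminus_nv_N_lat [simp]: "- nv n \<in> N_lat S23"
  using nv_N_lat[of n] by (simp add: N_lat_def)

lemma cone_codim_1:
  assumes "n \<noteq> 0" "{y - z | y z. y \<in> C \<and> z \<in> C} = hyperplane S23 (nv n)"
  shows "cone_codim S23 C 1"
  unfolding cone_codim_def
proof (intro exI[of _ "{nv n}"] conjI)
  show "lin_indep S23 {nv n}"
    using assms(1) by (auto simp: lin_indep_def nv_def prod_eq_iff)
qed (use assms in \<open>auto simp: hyperplane_def\<close>)

lemma M_real_diff: "x \<in> M_real S23 \<Longrightarrow> y \<in> M_real S23 \<Longrightarrow> x - y \<in> M_real S23"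
  by (simp add: M_real_S23)

lemma npair_diff: "npair n (x - y) = npair n x - npair n y"
  by (simp add: npair_def algebra_simps diff_divide_distrib)

lemma hyperplane_wall:
  assumes n: "n \<noteq> 0" and "coprime (fst n) (snd n)" "f \<in> wall_group S23 (nv n)"
  shows "is_wall S23 \<lparr> wnormal = nv n, wsupp = hyperplane S23 (nv n), wfun = f \<rparr>"
  unfolding is_wall_def
proof (intro conjI)
  show "rational_polyhedral_cone S23 (wsupp \<lparr> wnormal = nv n, wsupp = hyperplane S23 (nv n), wfun = f \<rparr>)"
    unfolding rational_polyhedral_cone_def
    by (intro exI[of _ "{nv n, - nv n}"])
      (auto simp: hyperplane_nv pairing_nv pairing_uminus)
  have "{y - z | y z. y \<in> hyperplane S23 (nv n) \<and> z \<in> hyperplane S23 (nv n)} = hyperplane S23 (nv n)"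
  proof (intro equalityI subsetI)
    fix x assume "x \<in> hyperplane S23 (nv n)"
    moreover have "x = x - 0" by simp
    moreover have "0 \<in> hyperplane S23 (nv n)" by (simp add: hyperplane_nv)
    ultimately show "x \<in> {y - z | y z. y \<in> hyperplane S23 (nv n) \<and> z \<in> hyperplane S23 (nv n)}" by blast
  qed (auto simp: hyperplane_nv M_real_diff npair_diff)
  then show "cone_codim S23 (wsupp \<lparr> wnormal = nv n, wsupp = hyperplane S23 (nv n), wfun = f \<rparr>) 1"
    using cone_codim_1[OF n] by simp
qed (use assms nv_N_plus nv_primitive in auto)

lemma out_wall_is_wall:
  assumes "n \<in> prim" shows "is_wall S23 (out_wall n)"
  unfolding is_wall_def
proof (intro conjI)
  have n: "n \<noteq> 0" "coprime (fst n) (snd n)" using assms by (auto simp: prim_def)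
  have nrm [simp]: "wnormal (out_wall n) = nv n" by (simp add: out_wall_def)
  show "wnormal (out_wall n) \<in> N_plus S23" "primitive S23 (wnormal (out_wall n))"
    using n nv_N_plus nv_primitive by auto
  have supp: "wsupp (out_wall n) = {x \<in> M_real S23. npair n x = 0 \<and> 0 \<le> x 0}" using wsupp_out by blast
  show "wsupp (out_wall n) \<subseteq> hyperplane S23 (wnormal (out_wall n))"
    by (auto simp: wsupp_out hyperplane_nv)
  show "rational_polyhedral_cone S23 (wsupp (out_wall n))"
    unfolding rational_polyhedral_cone_def supp
    by (intro exI[of _ "{nv n, - nv n, nv (1, 0)}"])
      (auto simp: pairing_nv pairing_uminus npair_def[of "(1, 0)"])
  have "{y - z | y z. y \<in> wsupp (out_wall n) \<and> z \<in> wsupp (out_wall n)} = hyperplane S23 (nv n)"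
  proof (intro equalityI subsetI)
    fix x assume x: "x \<in> hyperplane S23 (nv n)"
    then have x': "x \<in> M_real S23" "npair n x = 0" by (auto simp: hyperplane_nv)
    have 0: "0 \<in> wsupp (out_wall n)" by (simp add: supp)
    show "x \<in> {y - z | y z. y \<in> wsupp (out_wall n) \<and> z \<in> wsupp (out_wall n)}"
    proof (cases "0 \<le> x 0")
      case True
      then have "x \<in> wsupp (out_wall n)" "x = x - 0" using x' by (auto simp: supp)
      then show ?thesis using 0 by blast
    next
      case False
      then have "0 - x \<in> wsupp (out_wall n)" "x = 0 - (0 - x)"
        using x' M_real_diff[of 0 x] npair_diff[of n 0 x] by (auto simp: supp)
      then show ?thesis using 0 by blast
    qed
  qed (auto simp: hyperplane_nv M_real_diff npair_diff supp)
  then show "cone_codim S23 (wsupp (out_wall n)) 1" using cone_codim_1[OF n(1)] by simp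
  have "wfun (out_wall n) = coef (emb (ray n (Abs_fps (\<lambda>k. jump_at (wall_dir n) (nscale k n)))))"
    using ray_of_unip[OF n(1) jump_out_wall[OF assms]] by (simp add: out_wall_def)
  then show "wfun (out_wall n) \<in> wall_group S23 (wnormal (out_wall n))"
    using ray_in_wall_group[OF n(1)] by simp
qed

lemma outgoing_out_wall: "n \<in> prim \<Longrightarrow> outgoing S23 (out_wall n)"
  by (auto simp: outgoing_def wsupp_out real_vec_def p1star_S23 out_wall_def nv_def prim_def)

lemma deg_nv: "deg S23 (nv n) = int (tdeg n)" by (simp add: deg_def nv_def)

lemma nontrivial_mod_emb:
  assumes "wfun w = coef (emb f)"
  shows "nontrivial_mod S23 k w \<longleftrightarrow> (\<exists>n. n \<noteq> 0 \<and> tdeg n \<le> k \<and> f n \<noteq> 0)"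
proof
  assume "nontrivial_mod S23 k w"
  then obtain n where n: "n \<in> N_plus S23" "deg S23 n \<le> int k" "wfun w (p1star S23 n) \<noteq> 0"
    by (auto simp: nontrivial_mod_def)
  then obtain a b where ab: "n = nv (a, b)" "(a, b) \<noteq> 0"
    unfolding N_plus_S23 nv_def by (auto simp: zero_prod_def)
  then show "\<exists>n. n \<noteq> 0 \<and> tdeg n \<le> k \<and> f n \<noteq> 0"
    using n unfolding ab p1star_nv assms coef_emb deg_nv by (metis of_nat_le_iff)
next
  assume "\<exists>n. n \<noteq> 0 \<and> tdeg n \<le> k \<and> f n \<noteq> 0"
  then obtain n where "n \<noteq> 0" "tdeg n \<le> k" "f n \<noteq> 0" by blast
  then show "nontrivial_mod S23 k w" unfolding nontrivial_mod_def
    by (intro bexI[of _ "nv n"]) (auto simp: nv_N_plus deg_nv p1star_nv assms)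
qed

lemma nontrivial_mod_eq_upto:
  assumes "wfun w = coef (emb f)" "f 0 = 1"
  shows "nontrivial_mod S23 k w \<longleftrightarrow> \<not> eq_upto k f delta"
  unfolding nontrivial_mod_emb[OF assms(1)] eq_upto_def delta_def using assms(2) by auto

text \<open>
  The function of an outgoing wall is supported on multiples of its normal, hence it is trivial up to degree \<open>k\<close>
  unless the normal has degree at most \<open>k\<close>. This gives local finiteness.
\<close>

lemma scattering_diagram_D23: "scattering_diagram S23 D23"
  unfolding scattering_diagram_def
proof (intro conjI ballI allI)
  fix w assume "w \<in> D23"
  then show "is_wall S23 w"
  proof (cases rule: D23_cases)
    case 1
    show ?thesis unfolding 1 initial_wall_S23 E0_def
      by (rule hyperplane_wall) (auto simp: zero_prod_def qdilog_v intro: ray_in_wall_group)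
  next
    case 2
    show ?thesis unfolding 2 initial_wall_S23 E1_def
      by (rule hyperplane_wall) (auto simp: zero_prod_def qdilog_v intro: ray_in_wall_group)
  qed (simp add: out_wall_is_wall)
next
  fix k
  have "{w \<in> D23. nontrivial_mod S23 k w} \<subseteq>
    {initial_wall S23 0, initial_wall S23 1} \<union> out_wall ` ({..k} \<times> {..k})"
  proof
    fix w assume w: "w \<in> {w \<in> D23. nontrivial_mod S23 k w}"
    then have "w \<in> D23" by simp
    then show "w \<in> {initial_wall S23 0, initial_wall S23 1} \<union> out_wall ` ({..k} \<times> {..k})"
    proof (cases rule: D23_cases)
      case (3 n)
      have "nontrivial_mod S23 k (out_wall n)" using w 3 by simp
      then obtain m where m: "m \<noteq> 0" "tdeg m \<le> k" "jump_at (wall_dir n) m \<noteq> 0"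
        by (subst (asm) nontrivial_mod_emb[of _ "jump_at (wall_dir n)"]) (auto simp: out_wall_def)
      then obtain j where j: "m = nscale j n" using unip_outside[OF jump_out_wall[OF 3(1)], of m] by auto
      then have "j \<ge> 1" using m(1) by (cases j) auto
      then have "fst n \<le> fst m" "snd n \<le> snd m" by (auto simp: j nscale_def)
      then have "n \<in> {..k} \<times> {..k}" using m(2) by (auto simp: mem_Times_iff)
      then show ?thesis using 3 by blast
    qed auto
  qed
  then show "finite {w \<in> D23. nontrivial_mod S23 k w}"
    by (rule finite_subset) simp
qed

text \<open>
  Cramer's rule: in rank two, a cone of codimension two is the origin.
\<close>

lemma two_independent:
  assumes "lin_indep S23 B" "card B = 2" "B \<subseteq> N_lat S23" "x \<in> M_real S23" "\<And>b. b \<in> B \<Longrightarrow> pairing S23 b x = 0"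
  shows "x = 0"
proof -
  obtain b c where B: "B = {b, c}" "b \<noteq> c" using assms(2) by (auto simp: card_2_iff)
  have ind: "p = 0 \<and> q = 0" if "p * b 0 + q * c 0 = 0" "p * b 1 + q * c 1 = 0" for p q
  proof -
    have "\<forall>i\<in>sI S23. (\<Sum>d\<in>B. (if d = b then p else q) * d i) = 0"
      using that B by (auto simp: sum.insert)
    then have "\<forall>d\<in>B. (if d = b then p else q) = 0"
      by (rule assms(1)[unfolded lin_indep_def, THEN spec, THEN mp])
    then show ?thesis using B by auto
  qed
  define D where "D = b 0 * c 1 - b 1 * c 0"
  have "D \<noteq> 0"
  proof
    assume "D = 0"
    then have "c 1 = 0 \<and> - b 1 = 0" "c 0 = 0 \<and> - b 0 = 0"
      using ind[of "c 1" "- b 1"] ind[of "c 0" "- b 0"] by (auto simp: D_def algebra_simps)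
    then show False using ind[of 1 1] by simp
  qed
  have 1: "real_of_int (b 0) * (x 0 / 2) + real_of_int (b 1) * (x 1 / 3) = 0"
    "real_of_int (c 0) * (x 0 / 2) + real_of_int (c 1) * (x 1 / 3) = 0"
    using assms(5)[of b] assms(5)[of c] B by (auto simp: pairing_S23)
  have "real_of_int D * (x 0 / 2) = real_of_int (c 1) * (real_of_int (b 0) * (x 0 / 2) + real_of_int (b 1) * (x 1 / 3))
     - real_of_int (b 1) * (real_of_int (c 0) * (x 0 / 2) + real_of_int (c 1) * (x 1 / 3))"
    by (simp add: D_def algebra_simps)
  moreover have "real_of_int D * (x 1 / 3) = real_of_int (b 0) * (real_of_int (c 0) * (x 0 / 2) + real_of_int (c 1) * (x 1 / 3))
     - real_of_int (c 0) * (real_of_int (b 0) * (x 0 / 2) + real_of_int (b 1) * (x 1 / 3))"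
    by (simp add: D_def algebra_simps)
  ultimately have "x 0 = 0" "x 1 = 0" using \<open>D \<noteq> 0\<close> unfolding 1 by auto
  then show "x = 0" using M_real_eq_0[OF assms(4)] by simp
qed

lemma zero_in_wall: "w \<in> D23 \<Longrightarrow> 0 \<in> wsupp w"
  by (erule D23_cases) (auto simp: wsupp_initial wsupp_out)

lemma wall_boundary_D23: assumes "w \<in> D23" shows "wall_boundary S23 w \<subseteq> {0}"
  using assms
proof (cases rule: D23_cases)
  case 1
  then show ?thesis by (auto simp: wall_boundary_def initial_wall_S23) (meson zero_less_one)
next
  case 2
  then show ?thesis by (auto simp: wall_boundary_def initial_wall_S23) (meson zero_less_one)
next
  case (3 n)
  show ?thesis
  proof
    fix x assume "x \<in> wall_boundary S23 w"
    then have x: "x \<in> wsupp (out_wall n)"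
      and near: "\<And>r. r > 0 \<Longrightarrow> \<exists>y \<in> hyperplane S23 (nv n) - wsupp (out_wall n). \<forall>i\<in>sI S23. \<bar>y i - x i\<bar> < r"
      using 3 by (auto simp: wall_boundary_def) (simp_all add: out_wall_def)
    show "x \<in> {0}"
    proof (rule ccontr)
      assume "x \<notin> {0}"
      then have "x 0 > 0" using wsupp_out_signs[OF 3(1) x] by simp
      from near[OF this] obtain y where "y \<in> hyperplane S23 (nv n)" "y \<notin> wsupp (out_wall n)" "\<bar>y 0 - x 0\<bar> < x 0"
        by auto
      then show False by (auto simp: wsupp_out hyperplane_nv)
    qed
  qed
qed

text \<open>
  Walls are lines through the origin or rays from it, so they meet, and end, only there.
\<close>

lemma sing_locus_D23: "sing_locus S23 D23 = {0}"
proof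
  have "wsupp w \<inter> wsupp w' \<subseteq> {0}" if w: "w \<in> D23" "w' \<in> D23" and codim: "cone_codim S23 (wsupp w \<inter> wsupp w') 2" for w w'
  proof
    fix x assume x: "x \<in> wsupp w \<inter> wsupp w'"
    let ?C = "wsupp w \<inter> wsupp w'"
    obtain B where B: "card B = 2" "B \<subseteq> N_lat S23" "lin_indep S23 B"
      "{y - z | y z. y \<in> ?C \<and> z \<in> ?C} = {x \<in> M_real S23. \<forall>b\<in>B. pairing S23 b x = 0}"
      using codim unfolding cone_codim_def by blast
    have "x = x - 0" "0 \<in> ?C" using zero_in_wall w by auto
    then have "x \<in> {y - z | y z. y \<in> ?C \<and> z \<in> ?C}" using x by blast
    then show "x \<in> {0}" unfolding B(4) using two_independent[OF B(3,1,2)] by simp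
  qed
  then show "sing_locus S23 D23 \<subseteq> {0}"
    using wall_boundary_D23 unfolding sing_locus_def by blast
  let ?C = "wsupp (initial_wall S23 0) \<inter> wsupp (initial_wall S23 1)"
  have C: "?C = {0}" using M_real_eq_0 by (auto simp: wsupp_initial)
  have "cone_codim S23 ?C 2"
    unfolding cone_codim_def
  proof (intro exI[of _ "{nv (1, 0), nv (0, 1)}"] conjI)
    have ne: "nv (1, 0) \<noteq> nv (0, 1)" by (simp add: nv_def)
    show "card {nv (1, 0), nv (0, 1)} = 2" using ne by simp
    show "lin_indep S23 {nv (1, 0), nv (0, 1)}"
      using ne by (auto simp: lin_indep_def sum.insert) (simp_all add: nv_def)
    show "{y - z | y z. y \<in> ?C \<and> z \<in> ?C} = {x \<in> M_real S23. \<forall>b\<in>{nv (1, 0), nv (0, 1)}. pairing S23 b x = 0}"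
      unfolding C using M_real_eq_0 by (auto simp: pairing_nv npair_def)
  qed auto
  moreover have "initial_wall S23 0 \<in> D23" "initial_wall S23 1 \<in> D23" by (auto simp: D23_def)
  moreover have "0 \<in> ?C" by (simp add: C)
  ultimately show "{0} \<subseteq> sing_locus S23 D23"
    unfolding sing_locus_def by blast
qed

lemma fixed_data_S23: "fixed_data S23"
  by (auto simp: fixed_data_def gcd_non_0_nat)

lemma compatible_form_S23: "compatible_form S23"
  by (auto simp: compatible_form_def Lam_S23 p1star_S23 unit_vec_def d_lcm_S23)

section \<open>Consistency\<close>

lemma delta_0: "delta 0 = 1" by (simp add: delta_def)

lemma the_list_singleton: "(SOME ws. distinct ws \<and> set ws = {w}) = [w]"
proof (rule some_equality)
  fix ws assume "distinct ws \<and> set ws = {w}"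
  then have "length ws = 1" using distinct_card[of ws] by simp
  then obtain w' where "ws = [w']" by (auto simp: length_Suc_conv One_nat_def)
  with \<open>distinct ws \<and> set ws = {w}\<close> show "ws = [w]" by simp
qed simp

lemma crossing_level_wall:
  assumes "w \<in> D23" "x \<in> wsupp w" "x \<noteq> 0" "nontrivial_mod S23 k w"
  shows "crossing_level S23 D23 k x y (coef z) =
    coef (conj_by (signed (sgn (pairing S23 (wnormal w) (- y))) (jump_at x)) z)"
proof -
  have "{w' \<in> D23. nontrivial_mod S23 k w' \<and> x \<in> wsupp w'} = {w}"
    using assms wall_unique by blast
  then show ?thesis
    by (simp add: crossing_level_def the_list_singleton wall_jump[OF assms(1-3)] theta_aut_sgn_coef)
qed

lemma crossing_level_no_wall:
  assumes "\<And>w. w \<in> D23 \<Longrightarrow> nontrivial_mod S23 k w \<Longrightarrow> x \<notin> wsupp w"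
  shows "crossing_level S23 D23 k x y = id"
proof -
  have none: "{w \<in> D23. nontrivial_mod S23 k w \<and> x \<in> wsupp w} = {}" using assms by blast
  have "(SOME ws :: wall list. distinct ws \<and> set ws = {}) = []"
    by (rule some_equality) auto
  then show ?thesis by (simp add: crossing_level_def none)
qed

text \<open>
  A point may lie on a wall whose function is trivial up to degree \<open>k\<close>. Such walls are not seen at level \<open>k\<close>,
  and the potential does not jump there either.
\<close>

lemma jump_eq_upto_delta:
  assumes "x \<in> M_real S23" "x \<noteq> 0" "\<And>w. w \<in> D23 \<Longrightarrow> nontrivial_mod S23 k w \<Longrightarrow> x \<notin> wsupp w"
  shows "eq_upto k (jump_at x) delta"
proof (cases "\<exists>w\<in>D23. x \<in> wsupp w")
  case True
  then obtain w where w: "w \<in> D23" "x \<in> wsupp w" by blast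
  then have "\<not> nontrivial_mod S23 k w" using assms by blast
  then show ?thesis using nontrivial_mod_eq_upto[OF wall_jump[OF w assms(2)]] by simp
next
  case False
  then show ?thesis using no_wall_jump[OF assms(1,2)] by auto
qed

section \<open>The potential near a point\<close>

text \<open>
  All exponents orthogonal to a given point are parallel, and being nonnegative they are positive multiples of
  each other.
\<close>

lemma npair_proportional:
  assumes y: "y \<in> M_real S23" "y \<noteq> 0" and n: "n \<noteq> 0" "npair n y = 0" and m: "m \<noteq> 0" "npair m y = 0"
  shows "npair m z < 0 \<longleftrightarrow> npair n z < 0"
proof -
  define Y0 Y1 where "Y0 = y 0 / 2" and "Y1 = y 1 / 3"
  have nz: "Y0 \<noteq> 0 \<or> Y1 \<noteq> 0" using y M_real_eq_0 by (auto simp: Y0_def Y1_def)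
  have e: "real (fst n) * Y0 + real (snd n) * Y1 = 0" "real (fst m) * Y0 + real (snd m) * Y1 = 0"
    using n(2) m(2) by (auto simp: npair_def Y0_def Y1_def)
  \<comment> \<open>The determinant vanishes because both vectors are orthogonal to \<open>y \<noteq> 0\<close>.\<close>
  define \<Delta> where "\<Delta> = real (fst n) * real (snd m) - real (snd n) * real (fst m)"
  have "\<Delta> * Y0 = real (snd m) * (real (fst n) * Y0 + real (snd n) * Y1) - real (snd n) * (real (fst m) * Y0 + real (snd m) * Y1)"
    "\<Delta> * Y1 = real (fst n) * (real (fst m) * Y0 + real (snd m) * Y1) - real (fst m) * (real (fst n) * Y0 + real (snd n) * Y1)"
    by (simp_all add: \<Delta>_def algebra_simps)
  then have "\<Delta> = 0" using nz unfolding e by auto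
  then have det: "real (fst n) * real (snd m) = real (snd n) * real (fst m)" by (simp add: \<Delta>_def)
  have f: "real (fst n) * npair m z = real (fst m) * npair n z" "real (snd n) * npair m z = real (snd m) * npair n z"
    using det by (simp_all add: npair_def distrib_left) (simp_all add: algebra_simps)
  consider "fst n > 0" | "fst n = 0" "snd n > 0" using n(1) by (auto simp: prod_eq_iff)
  then show ?thesis
  proof cases
    case 1
    then have "fst m > 0" using det m(1) by (auto simp: prod_eq_iff intro!: gr0I)
    then show ?thesis using 1 f(1) by (metis mult_less_0_iff of_nat_0_less_iff order_less_asym)
  next
    case 2
    then have "snd m > 0" using det m(1) by (auto simp: prod_eq_iff intro!: gr0I)
    then show ?thesis using 2 f(2) by (metis mult_less_0_iff of_nat_0_less_iff order_less_asym)
  qed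
qed

lemma finite_tdeg: "finite {n. tdeg n \<le> k}"
  by (rule finite_subset[of _ "{..k} \<times> {..k}"]) (auto simp: mem_Times_iff)

text \<open>
  Only exponents orthogonal to \<open>y\<close> can change sign near \<open>y\<close>, as far as finitely many exponents are concerned. So near
  \<open>y\<close> the potential takes, up to degree \<open>k\<close>, at most the two values belonging to the two sides of the line
  through \<open>y\<close>.
\<close>

lemma potential_near:
  assumes lim: "\<And>n. ((\<lambda>t. npair n (\<gamma> t)) \<longlongrightarrow> npair n y) F"
  shows "\<forall>\<^sub>F t in F.
    ((\<forall>n. n \<noteq> 0 \<longrightarrow> npair n y = 0 \<longrightarrow> \<not> npair n (\<gamma> t) < 0) \<longrightarrow> eq_upto k (potential (\<gamma> t)) (potential y)) \<and>
    ((\<forall>n. n \<noteq> 0 \<longrightarrow> npair n y = 0 \<longrightarrow> npair n (\<gamma> t) < 0) \<longrightarrow> eq_upto k (potential (\<gamma> t)) (lower (Cle y) T23))"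
proof -
  have "\<forall>\<^sub>F t in F. \<forall>n\<in>{n. tdeg n \<le> k}. npair n y \<noteq> 0 \<longrightarrow> (npair n (\<gamma> t) < 0 \<longleftrightarrow> npair n y < 0)"
  proof (rule eventually_ball_finite[OF finite_tdeg], rule ballI)
    fix n assume "n \<in> {n. tdeg n \<le> k}"
    consider "npair n y = 0" | "npair n y < 0" | "npair n y > 0" by linarith
    then show "\<forall>\<^sub>F t in F. npair n y \<noteq> 0 \<longrightarrow> (npair n (\<gamma> t) < 0 \<longleftrightarrow> npair n y < 0)"
    proof cases
      case 2
      then show ?thesis using order_tendstoD(2)[OF lim 2] by (auto elim: eventually_mono)
    next
      case 3
      then show ?thesis using order_tendstoD(1)[OF lim 3] by (auto elim: eventually_mono)
    qed simp
  qed
  then show ?thesis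
  proof (rule eventually_mono, intro conjI impI)
    fix t assume *: "\<forall>n\<in>{n. tdeg n \<le> k}. npair n y \<noteq> 0 \<longrightarrow> (npair n (\<gamma> t) < 0 \<longleftrightarrow> npair n y < 0)"
    show "eq_upto k (potential (\<gamma> t)) (potential y)" if "\<forall>n. n \<noteq> 0 \<longrightarrow> npair n y = 0 \<longrightarrow> \<not> npair n (\<gamma> t) < 0"
      unfolding eq_upto_def potential_def
    proof (intro allI impI lower_local[where k = k])
      fix n assume n: "tdeg n \<le> k" "n \<noteq> 0"
      show "n \<in> Cneg (\<gamma> t) \<longleftrightarrow> n \<in> Cneg y"
        using * that n by (cases "npair n y = 0") (auto simp: Cneg_def)
    qed
    show "eq_upto k (potential (\<gamma> t)) (lower (Cle y) T23)" if "\<forall>n. n \<noteq> 0 \<longrightarrow> npair n y = 0 \<longrightarrow> npair n (\<gamma> t) < 0"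
      unfolding eq_upto_def potential_def
    proof (intro allI impI lower_local[where k = k])
      fix n assume n: "tdeg n \<le> k" "n \<noteq> 0"
      show "n \<in> Cneg (\<gamma> t) \<longleftrightarrow> n \<in> Cle y"
        using * that n by (cases "npair n y = 0") (auto simp: Cneg_def Cle_def)
    qed
  qed
qed

lemma potential_locally_constant:
  assumes y: "y \<in> M_real S23" "y \<noteq> 0"
    and lim: "\<And>n. ((\<lambda>t. npair n (\<gamma> t)) \<longlongrightarrow> npair n y) F"
    and no: "\<And>w. w \<in> D23 \<Longrightarrow> nontrivial_mod S23 k w \<Longrightarrow> y \<notin> wsupp w"
  shows "\<forall>\<^sub>F t in F. eq_upto k (potential y) (potential (\<gamma> t))"
proof -
  have "eq_upto k (lower (Cle y) T23) (potential y)"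
    unfolding jump_at(2) using eq_upto_conv[OF eq_upto_refl[of k "potential y"] jump_eq_upto_delta[OF y no]] by simp
  note eq = this
  have "\<forall>\<^sub>F t in F.
    ((\<forall>n. n \<noteq> 0 \<longrightarrow> npair n y = 0 \<longrightarrow> \<not> npair n (\<gamma> t) < 0) \<longrightarrow> eq_upto k (potential (\<gamma> t)) (potential y)) \<and>
    ((\<forall>n. n \<noteq> 0 \<longrightarrow> npair n y = 0 \<longrightarrow> npair n (\<gamma> t) < 0) \<longrightarrow> eq_upto k (potential (\<gamma> t)) (lower (Cle y) T23))"
    by (rule potential_near[OF lim])
  then show ?thesis
  proof (rule eventually_mono)
    fix t assume *: "((\<forall>n. n \<noteq> 0 \<longrightarrow> npair n y = 0 \<longrightarrow> \<not> npair n (\<gamma> t) < 0) \<longrightarrow> eq_upto k (potential (\<gamma> t)) (potential y)) \<and>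
    ((\<forall>n. n \<noteq> 0 \<longrightarrow> npair n y = 0 \<longrightarrow> npair n (\<gamma> t) < 0) \<longrightarrow> eq_upto k (potential (\<gamma> t)) (lower (Cle y) T23))"
    show "eq_upto k (potential y) (potential (\<gamma> t))"
    proof (cases "\<forall>n. n \<noteq> 0 \<longrightarrow> npair n y = 0 \<longrightarrow> \<not> npair n (\<gamma> t) < 0")
      case True
      then show ?thesis using * eq_upto_sym by blast
    next
      case False
      then have "\<forall>n. n \<noteq> 0 \<longrightarrow> npair n y = 0 \<longrightarrow> npair n (\<gamma> t) < 0"
        using npair_proportional[OF y] by blast
      then have "eq_upto k (potential (\<gamma> t)) (lower (Cle y) T23)" using * by blast
      then show ?thesis using eq_upto_trans[OF eq_upto_sym[OF eq]] eq_upto_sym by blast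
    qed
  qed
qed

lemma potential_sides:
  assumes y: "y \<in> M_real S23" "y \<noteq> 0"
    and n: "n \<noteq> 0" "npair n y = 0"
    and lim: "\<And>n. ((\<lambda>t. npair n (\<gamma> t)) \<longlongrightarrow> npair n y) F"
  shows "\<forall>\<^sub>F t in F. npair n (\<gamma> t) > 0 \<Longrightarrow> \<forall>\<^sub>F t in F. eq_upto k (potential (\<gamma> t)) (potential y)"
    "\<forall>\<^sub>F t in F. npair n (\<gamma> t) < 0 \<Longrightarrow> \<forall>\<^sub>F t in F. eq_upto k (potential (\<gamma> t)) (conv (potential y) (jump_at y))"
proof -
  have ev: "\<forall>\<^sub>F t in F.
    ((\<forall>n. n \<noteq> 0 \<longrightarrow> npair n y = 0 \<longrightarrow> \<not> npair n (\<gamma> t) < 0) \<longrightarrow> eq_upto k (potential (\<gamma> t)) (potential y)) \<and>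
    ((\<forall>n. n \<noteq> 0 \<longrightarrow> npair n y = 0 \<longrightarrow> npair n (\<gamma> t) < 0) \<longrightarrow> eq_upto k (potential (\<gamma> t)) (lower (Cle y) T23))"
    by (rule potential_near[OF lim])
  have same: "m \<noteq> 0 \<Longrightarrow> npair m y = 0 \<Longrightarrow> npair m z < 0 \<longleftrightarrow> npair n z < 0" for m z
    using npair_proportional[OF y n] by blast
  show "\<forall>\<^sub>F t in F. eq_upto k (potential (\<gamma> t)) (potential y)" if "\<forall>\<^sub>F t in F. npair n (\<gamma> t) > 0"
    using ev that by eventually_elim (use same in \<open>auto simp: not_less less_imp_le\<close>)
  show "\<forall>\<^sub>F t in F. eq_upto k (potential (\<gamma> t)) (conv (potential y) (jump_at y))" if "\<forall>\<^sub>F t in F. npair n (\<gamma> t) < 0"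
    using ev that unfolding jump_at(2) by eventually_elim (use same in auto)
qed

lemma derivative_signs:
  fixes f :: "real \<Rightarrow> real"
  assumes "(f has_real_derivative d) (at t)" "f t = 0"
  shows "d > 0 \<Longrightarrow> (\<forall>\<^sub>F s in at_left t. f s < 0) \<and> (\<forall>\<^sub>F s in at_right t. f s > 0)"
    and "d < 0 \<Longrightarrow> (\<forall>\<^sub>F s in at_left t. f s > 0) \<and> (\<forall>\<^sub>F s in at_right t. f s < 0)"
proof -
  have L: "\<forall>\<^sub>F s in at_left t. P s" if "r > 0" "\<forall>h>0. h < r \<longrightarrow> P (t - h)" for P r
  proof -
    have "P s" if "t - r < s" "s < t" for s
      using \<open>\<forall>h>0. h < r \<longrightarrow> P (t - h)\<close>[rule_format, of "t - s"] that by simp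
    then show ?thesis
      unfolding eventually_at_left_field using \<open>r > 0\<close> by (intro exI[of _ "t - r"]) simp
  qed
  have R: "\<forall>\<^sub>F s in at_right t. P s" if "r > 0" "\<forall>h>0. h < r \<longrightarrow> P (t + h)" for P r
  proof -
    have "P s" if "t < s" "s < t + r" for s
      using \<open>\<forall>h>0. h < r \<longrightarrow> P (t + h)\<close>[rule_format, of "s - t"] that by simp
    then show ?thesis
      unfolding eventually_at_right_field using \<open>r > 0\<close> by (intro exI[of _ "t + r"]) simp
  qed
  show "(\<forall>\<^sub>F s in at_left t. f s < 0) \<and> (\<forall>\<^sub>F s in at_right t. f s > 0)" if "d > 0"
    using DERIV_pos_inc_left[OF assms(1) that] DERIV_pos_inc_right[OF assms(1) that] L[of _ "\<lambda>s. f s < 0"] R[of _ "\<lambda>s. f s > 0"]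
    by (auto simp: assms(2))
  show "(\<forall>\<^sub>F s in at_left t. f s > 0) \<and> (\<forall>\<^sub>F s in at_right t. f s < 0)" if "d < 0"
    using DERIV_neg_dec_left[OF assms(1) that] DERIV_neg_dec_right[OF assms(1) that] L[of _ "\<lambda>s. f s > 0"] R[of _ "\<lambda>s. f s < 0"]
    by (auto simp: assms(2))
qed

text \<open>
  Transversality makes the path change sides at a wall, and the sign of the derivative decides between
  the jump and its inverse.
\<close>

lemma potential_crossing:
  assumes y: "\<gamma> t0 \<in> M_real S23" "\<gamma> t0 \<noteq> 0"
    and n: "n \<noteq> 0" "npair n (\<gamma> t0) = 0"
    and der: "\<And>n. ((\<lambda>t. npair n (\<gamma> t)) has_real_derivative npair n vel) (at t0)"
    and vel: "npair n vel \<noteq> 0"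
  shows "\<exists>L. (\<forall>\<^sub>F t in at_left t0. eq_upto k (potential (\<gamma> t)) L) \<and>
    (\<forall>\<^sub>F t in at_right t0. eq_upto k (potential (\<gamma> t)) (conv L (signed (sgn (npair n (- vel))) (jump_at (\<gamma> t0)))))"
proof -
  have lim: "((\<lambda>t. npair m (\<gamma> t)) \<longlongrightarrow> npair m (\<gamma> t0)) (at t0 within S)" for m S
    using DERIV_isCont[OF der[of m]] unfolding isCont_def by (rule tendsto_within_subset) auto
  note sides = potential_sides[where y = "\<gamma> t0", OF y n lim]
  have neg: "npair n (- vel) = - npair n vel" by (simp add: npair_def)
  show ?thesis
  proof (cases "npair n vel > 0")
    case True
    have undo: "conv (conv (potential (\<gamma> t0)) (jump_at (\<gamma> t0))) (cinv (jump_at (\<gamma> t0))) = potential (\<gamma> t0)"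
      by (simp add: conv_assoc conv_cinv)
    show ?thesis
      using derivative_signs(1)[OF der n(2) True] sides True
      by (intro exI[of _ "conv (potential (\<gamma> t0)) (jump_at (\<gamma> t0))"]) (simp add: signed_def neg undo)
  next
    case False
    then have "npair n vel < 0" using vel by simp
    then show ?thesis
      using derivative_signs(2)[OF der n(2)] sides
      by (intro exI[of _ "potential (\<gamma> t0)"]) (simp add: signed_def neg)
  qed
qed

section \<open>Path-ordered products from local data\<close>

lemma eq_upto_constant:
  fixes pp :: "real \<Rightarrow> nat \<times> nat \<Rightarrow> coeff"
  assumes "a \<le> b" "\<And>t. t \<in> {a..b} \<Longrightarrow> \<forall>\<^sub>F s in at t within {a..b}. eq_upto k (pp t) (pp s)"
  shows "eq_upto k (pp a) (pp b)"
proof -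
  define f where "f t = (\<lambda>n. if tdeg n \<le> k then pp t n else 0)" for t
  have f: "f t = f s \<longleftrightarrow> eq_upto k (pp t) (pp s)" for t s
    by (auto simp: f_def eq_upto_def fun_eq_iff)
  have "f a = f b"
    by (rule connected_local_const[of "{a..b}"]) (use assms in \<open>auto simp: f\<close>)
  then show ?thesis by (simp add: f)
qed

text \<open>
  Induction on the list of crossing times moves the starting point across one crossing at a time. The function \<open>pp\<close>
  and the automorphisms pick up the same factors in the same order.
\<close>

lemma path_steps:
  fixes pp e :: "real \<Rightarrow> nat \<times> nat \<Rightarrow> coeff"
  assumes "sorted_wrt (<) ts" "set ts \<subseteq> {a<..<b}" "a \<le> b"
    and off: "\<And>t. t \<in> {a..b} \<Longrightarrow> t \<notin> set ts \<Longrightarrow> \<forall>\<^sub>F s in at t within {a..b}. eq_upto k (pp t) (pp s)"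
    and on: "\<And>t. t \<in> set ts \<Longrightarrow> \<exists>L. (\<forall>\<^sub>F s in at_left t. eq_upto k (pp s) L) \<and>
      (\<forall>\<^sub>F s in at_right t. eq_upto k (pp s) (conv L (e t)))"
    and e: "\<And>t. t \<in> set ts \<Longrightarrow> e t 0 = 1 \<and> (\<forall>z. act t (coef z) = coef (conj_by (e t) z))"
  shows "\<exists>F. F 0 = 1 \<and> (\<forall>z. fold act ts (coef z) = coef (conj_by F z)) \<and> eq_upto k (conv (pp a) F) (pp b)"
  using assms
proof (induction ts arbitrary: a)
  case Nil
  then have "eq_upto k (pp a) (pp b)" by (intro eq_upto_constant) auto
  then show ?case by (intro exI[of _ delta]) (simp add: delta_0)
next
  case (Cons t ts)
  have t: "a < t" "t < b" "\<And>s. s \<in> set ts \<Longrightarrow> t < s" using Cons.prems(1,2) by auto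
  obtain L where L: "\<forall>\<^sub>F s in at_left t. eq_upto k (pp s) L" "\<forall>\<^sub>F s in at_right t. eq_upto k (pp s) (conv L (e t))"
    using Cons.prems(5)[of t] by auto
  have "\<forall>\<^sub>F s in at_left t. eq_upto k (pp s) L \<and> a < s \<and> s < t"
    using L(1) eventually_at_left_real[OF t(1)] by eventually_elim auto
  then obtain a' where a': "eq_upto k (pp a') L" "a < a'" "a' < t"
    using eventually_happens'[OF trivial_limit_at_left_real] by blast
  \<comment> \<open>The next starting point lies after \<open>t\<close> but before any later crossing.\<close>
  define B where "B = Min (insert b (set ts))"
  have B: "t < B" "B \<le> b" "\<And>s. s \<in> set ts \<Longrightarrow> B \<le> s"
    using t by (auto simp: B_def)
  have "\<forall>\<^sub>F s in at_right t. eq_upto k (pp s) (conv L (e t)) \<and> t < s \<and> s < B"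
    using L(2) eventually_at_right_real[OF B(1)] by eventually_elim auto
  then obtain c where c: "eq_upto k (pp c) (conv L (e t))" "t < c" "c < B"
    using eventually_happens'[OF trivial_limit_at_right_real] by blast
  have "eq_upto k (pp a) (pp a')"
  proof (rule eq_upto_constant)
    fix s assume s: "s \<in> {a..a'}"
    then have "s \<notin> set (t # ts)" using a' t(3) by fastforce
    then have "\<forall>\<^sub>F r in at s within {a..b}. eq_upto k (pp s) (pp r)"
      using Cons.prems(4) s a' t by auto
    then show "\<forall>\<^sub>F r in at s within {a..a'}. eq_upto k (pp s) (pp r)"
      by (rule filter_leD[OF at_le, rotated]) (use a' t in auto)
  qed (use a' in simp)
  have aL: "eq_upto k (pp a) L" using \<open>eq_upto k (pp a) (pp a')\<close> a'(1) eq_upto_trans by blast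
  have "\<exists>F. F 0 = 1 \<and> (\<forall>z. fold act ts (coef z) = coef (conj_by F z)) \<and> eq_upto k (conv (pp c) F) (pp b)"
  proof (rule Cons.IH)
    show "sorted_wrt (<) ts" using Cons.prems(1) by simp
    show "set ts \<subseteq> {c<..<b}" using B(3) c(3) Cons.prems(2) by force
    show "c \<le> b" using c B by simp
    fix s
    show "\<forall>\<^sub>F r in at s within {c..b}. eq_upto k (pp s) (pp r)" if s: "s \<in> {c..b}" "s \<notin> set ts"
    proof -
      have "\<forall>\<^sub>F r in at s within {a..b}. eq_upto k (pp s) (pp r)"
        using Cons.prems(4)[of s] s c t by auto
      then show ?thesis
        by (rule filter_leD[OF at_le, rotated]) (use c t in auto)
    qed
  qed (use Cons.prems(5,6) in auto)
  then obtain F where F: "F 0 = 1" "\<And>z. fold act ts (coef z) = coef (conj_by F z)" "eq_upto k (conv (pp c) F) (pp b)"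
    by blast
  have et: "e t 0 = 1" "\<And>z. act t (coef z) = coef (conj_by (e t) z)" using Cons.prems(6) by auto
  have "eq_upto k (conv (pp a) (conv (e t) F)) (conv (conv L (e t)) F)"
    unfolding conv_assoc[symmetric] by (intro eq_upto_conv eq_upto_refl aL)
  also have "eq_upto k (conv (conv L (e t)) F) (conv (pp c) F)"
    by (intro eq_upto_conv eq_upto_refl) (rule eq_upto_sym[OF c(1)])
  finally have "eq_upto k (conv (pp a) (conv (e t) F)) (pp b)" using F(3) eq_upto_trans by blast
  then show ?case
    by (intro exI[of _ "conv (e t) F"]) (simp add: conv_0 et F conj_by_conv)
qed

section \<open>Generic paths\<close>

lemma npair_has_derivative:
  assumes "(\<lambda>s. \<gamma> s 0) differentiable (at t)" "(\<lambda>s. \<gamma> s 1) differentiable (at t)"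
  shows "((\<lambda>s. npair n (\<gamma> s)) has_real_derivative npair n (velocity \<gamma> t)) (at t)"
proof -
  have *: "((\<lambda>s. \<gamma> s 0) has_real_derivative velocity \<gamma> t 0) (at t)" "((\<lambda>s. \<gamma> s 1) has_real_derivative velocity \<gamma> t 1) (at t)"
    using assms unfolding velocity_def by (metis DERIV_deriv_iff_real_differentiable)+
  show ?thesis unfolding npair_def
    by (rule derivative_eq_intros * refl | simp)+ (simp add: mult.commute)
qed

lemma generic_path_facts:
  assumes "generic_path S23 D23 \<gamma>"
  shows "\<And>n. continuous_on {0..1} (\<lambda>t. npair n (\<gamma> t))"
    "continuous_on {0..1} (\<lambda>t. \<gamma> t 0)"
    "\<And>t. t \<in> {0..1} \<Longrightarrow> \<gamma> t \<in> M_real S23 \<and> \<gamma> t \<noteq> 0"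
    "\<And>w t n. w \<in> D23 \<Longrightarrow> t \<in> {0..1} \<Longrightarrow> \<gamma> t \<in> wsupp w \<Longrightarrow> t \<in> {0<..<1} \<and> pairing S23 (wnormal w) (velocity \<gamma> t) \<noteq> 0
      \<and> ((\<lambda>s. npair n (\<gamma> s)) has_real_derivative npair n (velocity \<gamma> t)) (at t)"
proof -
  have c: "continuous_on {0..1} (\<lambda>t. \<gamma> t 0)" "continuous_on {0..1} (\<lambda>t. \<gamma> t 1)"
    using assms by (auto simp: generic_path_def piecewise_C1_differentiable_on_def)
  show "continuous_on {0..1} (\<lambda>t. npair n (\<gamma> t))" for n
    unfolding npair_def by (intro continuous_intros c) auto
  show "continuous_on {0..1} (\<lambda>t. \<gamma> t 0)" by (rule c)
  show "\<gamma> t \<in> M_real S23 \<and> \<gamma> t \<noteq> 0" if "t \<in> {0..1}" for t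
    using assms that unfolding generic_path_def sing_locus_D23 by blast
  show "t \<in> {0<..<1} \<and> pairing S23 (wnormal w) (velocity \<gamma> t) \<noteq> 0
      \<and> ((\<lambda>s. npair n (\<gamma> s)) has_real_derivative npair n (velocity \<gamma> t)) (at t)"
    if w: "w \<in> D23" "t \<in> {0..1}" "\<gamma> t \<in> wsupp w" for w t n
  proof -
    have "t \<noteq> 0" "t \<noteq> 1" using assms w by (auto simp: generic_path_def)
    then have t: "t \<in> {0<..<1}" using w(2) by auto
    then have "(\<forall>i\<in>sI S23. (\<lambda>s. \<gamma> s i) differentiable (at t)) \<and> pairing S23 (wnormal w) (velocity \<gamma> t) \<noteq> 0"
      using assms w unfolding generic_path_def by blast
    then show ?thesis using t npair_has_derivative by auto
  qed
qed

text \<open>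
  Crossing times form a closed set, and by transversality they are isolated.
\<close>

lemma finite_crossings:
  assumes "generic_path S23 D23 \<gamma>" "w \<in> D23"
  shows "finite {t \<in> {0..1}. \<gamma> t \<in> wsupp w}"
proof -
  note gp = generic_path_facts[OF assms(1)]
  let ?S = "{t \<in> {0..1}. \<gamma> t \<in> wsupp w}"
  obtain n where n: "wnormal w = nv n" "wsupp w \<subseteq> {x \<in> M_real S23. npair n x = 0}"
    using wall_normal[OF assms(2)] by blast
  have "closed ?S"
    using assms(2)
  proof (cases rule: D23_cases)
    case 1
    have "?S = {t \<in> {0..1}. \<gamma> t 0 = 0}" using gp(3) by (auto simp: 1 wsupp_initial)
    then show ?thesis using continuous_closed_preimage_constant[OF gp(2), of 0] by simp
  next
    case 2
    have "?S = {t \<in> {0..1}. npair (0, 1) (\<gamma> t) = 0}" using gp(3) by (auto simp: 2 wsupp_initial npair_def)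
    then show ?thesis using continuous_closed_preimage_constant[OF gp(1)[of "(0, 1)"], of 0] by simp
  next
    case (3 m)
    have "?S = {t \<in> {0..1}. npair m (\<gamma> t) = 0} \<inter> ({0..1} \<inter> (\<lambda>t. \<gamma> t 0) -` {0..})"
      using gp(3) by (auto simp: 3 wsupp_out)
    then show ?thesis
      using continuous_closed_preimage_constant[OF gp(1)[of m], of 0]
        continuous_closed_preimage[OF gp(2), of "{0..}"] by (simp add: closed_Int)
  qed
  have "\<not> z islimpt ?S" if z: "z \<in> {0..1}" for z
  proof (cases "z \<in> ?S")
    case False
    then show ?thesis using \<open>closed ?S\<close> closed_limpt by blast
  next
    case True
    have d: "npair n (velocity \<gamma> z) \<noteq> 0" "((\<lambda>s. npair n (\<gamma> s)) has_real_derivative npair n (velocity \<gamma> z)) (at z)"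
      "npair n (\<gamma> z) = 0"
      using gp(4)[OF assms(2) z, of n] True n by (auto simp: pairing_nv)
    have "(\<forall>\<^sub>F s in at_left z. npair n (\<gamma> s) \<noteq> 0) \<and> (\<forall>\<^sub>F s in at_right z. npair n (\<gamma> s) \<noteq> 0)"
    proof (cases "npair n (velocity \<gamma> z) > 0")
      case True
      then show ?thesis using derivative_signs(1)[OF d(2,3)] by (auto elim: eventually_mono)
    next
      case False
      then have "npair n (velocity \<gamma> z) < 0" using d(1) by simp
      then show ?thesis using derivative_signs(2)[OF d(2,3)] by (auto elim: eventually_mono)
    qed
    then have "\<forall>\<^sub>F s in at z. npair n (\<gamma> s) \<noteq> 0" by (simp add: eventually_at_split)
    then have "\<forall>\<^sub>F s in at z. s \<notin> ?S" by (rule eventually_mono) (use n in auto)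
    then show ?thesis by (simp add: islimpt_iff_eventually)
  qed
  then have "finite ({0..1} \<inter> ?S)" by (intro finite_not_islimpt_in_compact) auto
  moreover have "{0..1} \<inter> ?S = ?S" by blast
  ultimately show ?thesis by simp
qed

text \<open>
  The behaviour of the potential at a crossing time and away from these times is the local data from which
  path-ordered products are computed; the contributions telescope and leave the values at the two ends.
\<close>

lemma path_product_level_D23:
  assumes \<gamma>: "generic_path S23 D23 \<gamma>"
  shows "\<exists>F. F 0 = 1 \<and> (\<forall>z. path_product_level S23 D23 k \<gamma> (coef z) = coef (conj_by F z)) \<and>
    eq_upto k (conv (potential (\<gamma> 0)) F) (potential (\<gamma> 1))"
proof -
  note gp = generic_path_facts[OF \<gamma>]
  define X where "X = {t \<in> {0..1}. \<exists>w\<in>D23. nontrivial_mod S23 k w \<and> \<gamma> t \<in> wsupp w}"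
  have "X = (\<Union>w\<in>{w \<in> D23. nontrivial_mod S23 k w}. {t \<in> {0..1}. \<gamma> t \<in> wsupp w})"
    by (auto simp: X_def)
  then have fin: "finite X"
    using scattering_diagram_D23 finite_crossings[OF \<gamma>] by (auto simp: scattering_diagram_def)
  define wl where "wl t = (SOME w. w \<in> D23 \<and> nontrivial_mod S23 k w \<and> \<gamma> t \<in> wsupp w)" for t
  have wl: "wl t \<in> D23 \<and> nontrivial_mod S23 k (wl t) \<and> \<gamma> t \<in> wsupp (wl t)" if "t \<in> X" for t
    unfolding wl_def by (rule someI_ex) (use that in \<open>auto simp: X_def\<close>)
  define e where "e t = signed (sgn (pairing S23 (wnormal (wl t)) (- velocity \<gamma> t))) (jump_at (\<gamma> t))" for t
  have X01: "X \<subseteq> {0<..<1}" using gp(4) unfolding X_def by blast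
  have XI: "t \<in> {0..1}" if "t \<in> X" for t using that by (auto simp: X_def)
  have "\<exists>F. F 0 = 1 \<and> (\<forall>z. fold (\<lambda>t. crossing_level S23 D23 k (\<gamma> t) (velocity \<gamma> t)) (sorted_list_of_set X) (coef z)
      = coef (conj_by F z)) \<and> eq_upto k (conv (potential (\<gamma> 0)) F) (potential (\<gamma> 1))"
  proof (rule path_steps[where e = e])
    show "sorted_wrt (<) (sorted_list_of_set X)" by simp
    show "set (sorted_list_of_set X) \<subseteq> {0<..<1}" using X01 fin by simp
    fix t
    show "\<forall>\<^sub>F s in at t within {0..1}. eq_upto k (potential (\<gamma> t)) (potential (\<gamma> s))"
      if t: "t \<in> {0..1}" "t \<notin> set (sorted_list_of_set X)"
    proof (rule potential_locally_constant)
      show "\<gamma> t \<in> M_real S23" "\<gamma> t \<noteq> 0" using gp(3) t by auto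
      show "((\<lambda>s. npair n (\<gamma> s)) \<longlongrightarrow> npair n (\<gamma> t)) (at t within {0..1})" for n
        using gp(1)[of n] t(1) by (auto simp: continuous_on_def)
      show "\<gamma> t \<notin> wsupp w" if "w \<in> D23" "nontrivial_mod S23 k w" for w
        using t that fin by (auto simp: X_def)
    qed
    assume "t \<in> set (sorted_list_of_set X)"
    then have t: "t \<in> X" using fin by simp
    note w = wl[OF t]
    have y: "\<gamma> t \<in> M_real S23" "\<gamma> t \<noteq> 0" using gp(3) XI[OF t] by auto
    obtain n where n: "n \<noteq> 0" "wnormal (wl t) = nv n" "wsupp (wl t) \<subseteq> {x \<in> M_real S23. npair n x = 0}"
      using wall_normal[OF conjunct1[OF w]] by metis
    have facts: "pairing S23 (wnormal (wl t)) (velocity \<gamma> t) \<noteq> 0 \<and>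
        ((\<lambda>s. npair m (\<gamma> s)) has_real_derivative npair m (velocity \<gamma> t)) (at t)" for m
      using gp(4)[OF conjunct1[OF w] XI[OF t] conjunct2[OF conjunct2[OF w]], of m] by (rule conjunct2)
    have d: "((\<lambda>s. npair m (\<gamma> s)) has_real_derivative npair m (velocity \<gamma> t)) (at t)" for m
      using facts by (rule conjunct2)
    have d0: "npair n (velocity \<gamma> t) \<noteq> 0"
      using conjunct1[OF facts] unfolding n(2) pairing_nv .
    have "npair n (\<gamma> t) = 0" using w n by auto
    from potential_crossing[OF y n(1) this d d0]
    show "\<exists>L. (\<forall>\<^sub>F s in at_left t. eq_upto k (potential (\<gamma> s)) L) \<and>
      (\<forall>\<^sub>F s in at_right t. eq_upto k (potential (\<gamma> s)) (conv L (e t)))"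
      unfolding e_def n(2) pairing_nv .
    show "e t 0 = 1 \<and> (\<forall>z. crossing_level S23 D23 k (\<gamma> t) (velocity \<gamma> t) (coef z) = coef (conj_by (e t) z))"
      using w y(2) crossing_level_wall[of "wl t" "\<gamma> t" k] by (simp add: e_def signed_0)
  qed simp
  then show ?thesis unfolding path_product_level_def X_def .
qed

lemma degree_lim_cong:
  assumes "\<And>u. \<forall>\<^sub>F k in sequentially. s k u = s' k u" shows "degree_lim s = degree_lim s'"
proof
  fix u
  have "(\<forall>\<^sub>F k in sequentially. s k u = c) \<longleftrightarrow> (\<forall>\<^sub>F k in sequentially. s' k u = c)" for c
  proof
    show "\<forall>\<^sub>F k in sequentially. s' k u = c" if "\<forall>\<^sub>F k in sequentially. s k u = c"
      using assms[of u] that by eventually_elim simp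
    show "\<forall>\<^sub>F k in sequentially. s k u = c" if "\<forall>\<^sub>F k in sequentially. s' k u = c"
      using assms[of u] that by eventually_elim simp
  qed
  then show "degree_lim s u = degree_lim s' u" by (simp add: degree_lim_def)
qed

lemma consistent_D23: "consistent S23 D23"
  unfolding consistent_def
proof (intro allI impI ballI)
  fix \<gamma> \<delta> x
  assume gd: "generic_path S23 D23 \<gamma> \<and> generic_path S23 D23 \<delta> \<and> \<gamma> 0 = \<delta> 0 \<and> \<gamma> 1 = \<delta> 1" and x: "x \<in> qtorus S23"
  obtain z where z: "x = coef z" using x by (metis Abs_qt_inverse)
  obtain r where r: "order_ge r z" using order_ge_ex by blast
  show "path_product S23 D23 \<gamma> x = path_product S23 D23 \<delta> x"
    unfolding path_product_def z
  proof (rule degree_lim_cong)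
    fix u :: lvec
    have "path_product_level S23 D23 k \<gamma> (coef z) u = path_product_level S23 D23 k \<delta> (coef z) u"
      if k: "k \<ge> nat (u 1 - u 0 - r)" for k
    proof -
      obtain F where F: "F 0 = 1" "\<And>z. path_product_level S23 D23 k \<gamma> (coef z) = coef (conj_by F z)"
        "eq_upto k (conv (potential (\<gamma> 0)) F) (potential (\<gamma> 1))"
        using path_product_level_D23[of \<gamma> k] gd by blast
      obtain G where G: "G 0 = 1" "\<And>z. path_product_level S23 D23 k \<delta> (coef z) = coef (conj_by G z)"
        "eq_upto k (conv (potential (\<delta> 0)) G) (potential (\<delta> 1))"
        using path_product_level_D23[of \<delta> k] gd by blast
      have "eq_upto k (conv (potential (\<gamma> 0)) F) (conv (potential (\<gamma> 0)) G)"
        using F(3) G(3) gd eq_upto_sym eq_upto_trans by metis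
      then have "eq_upto k (conv (cinv (potential (\<gamma> 0))) (conv (potential (\<gamma> 0)) F)) (conv (cinv (potential (\<gamma> 0))) (conv (potential (\<gamma> 0)) G))"
        by (rule eq_upto_conv[OF eq_upto_refl])
      then have "eq_upto k F G" by (simp add: conv_assoc[symmetric] cinv_conv)
      then show ?thesis using conj_by_local[of k F G r z u] F G r k by simp
    qed
    then show "\<forall>\<^sub>F k in sequentially. path_product_level S23 D23 k \<gamma> (coef z) u = path_product_level S23 D23 k \<delta> (coef z) u"
      unfolding eventually_sequentially by blast
  qed
qed

lemma qcsd_D23: "quantum_cluster_scattering_diagram S23 D23"
  unfolding quantum_cluster_scattering_diagram_def
  using scattering_diagram_D23 consistent_D23 outgoing_out_wall by (auto simp: D23_def)

section \<open>Wall crossing of monomials\<close>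

lemma degree_lim_eventually:
  assumes "\<forall>\<^sub>F k in sequentially. s k = x" shows "degree_lim s = x"
proof
  fix u
  have ev: "\<forall>\<^sub>F k in sequentially. s k u = x u" using assms by eventually_elim simp
  show "degree_lim s u = x u" unfolding degree_lim_def
  proof (rule the_equality)
    show "\<forall>\<^sub>F k in sequentially. s k u = x u" by (rule ev)
    fix c assume "\<forall>\<^sub>F k in sequentially. s k u = c"
    with ev have "\<forall>\<^sub>F k in sequentially. c = x u" by eventually_elim simp
    then show "c = x u" by simp
  qed
qed

text \<open>
  At a point on a wall the limit over degrees is attained: either the wall is seen from some degree on, or
  its function is \<open>1\<close>.
\<close>

lemma crossing_wall:
  assumes w: "w \<in> D23" "y \<in> wsupp w" "y \<noteq> 0"
  shows "crossing S23 D23 y vel (coef z) =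
    coef (conj_by (signed (sgn (pairing S23 (wnormal w) (- vel))) (jump_at y)) z)"
proof (cases "\<exists>k. nontrivial_mod S23 k w")
  case True
  then obtain k0 where "nontrivial_mod S23 k0 w" by blast
  then have nt: "nontrivial_mod S23 k w" if "k \<ge> k0" for k
    using that by (force simp: nontrivial_mod_def)
  show ?thesis unfolding crossing_def
  proof (rule degree_lim_eventually)
    show "\<forall>\<^sub>F k in sequentially. crossing_level S23 D23 k y vel (coef z) =
      coef (conj_by (signed (sgn (pairing S23 (wnormal w) (- vel))) (jump_at y)) z)"
      unfolding eventually_sequentially using crossing_level_wall[OF w nt] by blast
  qed
next
  case False
  \<comment> \<open>A wall that is trivial in every degree.\<close>
  have "jump_at y n = delta n" for n
    using False nontrivial_mod_eq_upto[OF wall_jump[OF w], of "tdeg n"] by (auto simp: eq_upto_def)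
  then have "jump_at y = delta" by auto
  then have "signed s (jump_at y) = delta" for s by (simp add: signed_def)
  moreover have "crossing S23 D23 y vel (coef z) = coef z" unfolding crossing_def
  proof (rule degree_lim_eventually)
    have "crossing_level S23 D23 k y vel = id" for k
      by (rule crossing_level_no_wall) (use False wall_unique w in blast)
    then show "\<forall>\<^sub>F k in sequentially. crossing_level S23 D23 k y vel (coef z) = coef z" by simp
  qed
  ultimately show ?thesis by simp
qed

definition qmon :: "coeff \<Rightarrow> lvec \<Rightarrow> qt" where "qmon c e = Abs_qt (qmono c e)"

lemma coef_qmon: "e \<in> M_lat S23 \<Longrightarrow> coef (qmon c e) = qmono c e"
  by (simp add: qmon_def Abs_qt_inverse qmono_in_qtorus)

text \<open>
  The effect on a series on the cone of moving a monomial \<open>A\<^sup>e\<close> past it.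
\<close>

definition twist :: "lvec \<Rightarrow> (nat \<times> nat \<Rightarrow> coeff) \<Rightarrow> nat \<times> nat \<Rightarrow> coeff" where
  "twist e f n = f n * tw e (pv n) ^ 2"

lemma tw_swap: "tw a b * tw b a = 1"
proof -
  have "- Lam S23 a b + - Lam S23 b a = 0" by (simp add: Lam_S23)
  then show ?thesis unfolding tw_def by (metis power_int_0_right power_int_add v_nz)
qed

lemma qmon_emb: assumes e: "e \<in> M_lat S23" shows "qmon c e * emb f = emb (twist e f) * qmon c e"
proof -
  have "coef (qmon c e * emb f) u = coef (emb (twist e f) * qmon c e) u" for u
  proof (cases "u - e \<in> range pv")
    case True
    then obtain n where n: "u - e = pv n" by blast
    have "tw e (pv n) = tw e (pv n) ^ 2 * tw (pv n) e"
      using tw_swap[of e "pv n"] by (simp add: power2_eq_square mult.assoc)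
    then show ?thesis
      by (simp add: times_qt.rep_eq coef_qmon e qmul_qmono_left qmul_qmono_right n twist_def)
  next
    case False
    then show ?thesis
      by (simp add: times_qt.rep_eq coef_qmon e qmul_qmono_left qmul_qmono_right coef_emb_0)
  qed
  then show ?thesis by (metis coef_inject ext)
qed

lemma conj_by_qmon:
  assumes e: "e \<in> M_lat S23"
  shows "coef (conj_by f (qmon c e)) (e + pv n) = conv (cinv f) (twist e f) n * c * tw (pv n) e"
    "u - e \<notin> range pv \<Longrightarrow> coef (conj_by f (qmon c e)) u = 0"
proof -
  have eq: "conj_by f (qmon c e) = emb (conv (cinv f) (twist e f)) * qmon c e"
    by (simp add: conj_by_def mult.assoc qmon_emb e emb_mult[symmetric])
  show "coef (conj_by f (qmon c e)) (e + pv n) = conv (cinv f) (twist e f) n * c * tw (pv n) e"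
    by (simp add: eq times_qt.rep_eq coef_qmon e qmul_qmono_right)
  show "coef (conj_by f (qmon c e)) u = 0" if "u - e \<notin> range pv"
    using that by (simp add: eq times_qt.rep_eq coef_qmon e qmul_qmono_right coef_emb_0)
qed

lemma twist_in_unip: "f \<in> unip M \<Longrightarrow> twist e f \<in> unip M"
  by (auto simp: unip_def twist_def)

lemma signed_in_unip: "add_closed M \<Longrightarrow> f \<in> unip M \<Longrightarrow> signed s f \<in> unip M"
  by (simp add: signed_def cinv_in_unip)

text \<open>
  A bend at \<open>y\<close> changes the exponent by some \<open>p\<^sub>1\<^sup>*(n)\<close> with \<open>n\<close> orthogonal to \<open>y\<close>. This is all that the
  enumeration of broken lines needs to know about the walls.
\<close>

lemma crossing_support:
  assumes w: "w \<in> D23" "y \<in> wsupp w" "y \<noteq> 0" and e: "e \<in> M_lat S23"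
    and nz: "crossing S23 D23 y vel (qmono c e) e' \<noteq> 0"
  obtains n where "e' = e + pv n" "npair n y = 0"
proof -
  define g where "g = signed (sgn (pairing S23 (wnormal w) (- vel))) (jump_at y)"
  have M: "add_closed {n. npair n y = 0}" by (auto simp: add_closed_def npair_add)
  have gU: "g \<in> unip {n. npair n y = 0}" unfolding g_def by (rule signed_in_unip[OF M jump_at(1)])
  have cr: "crossing S23 D23 y vel (qmono c e) = coef (conj_by g (qmon c e))"
    using crossing_wall[OF w, of vel "qmon c e"] by (simp add: coef_qmon e g_def)
  obtain n where n: "e' - e = pv n" using nz conj_by_qmon(2)[OF e] unfolding cr by blast
  then have e': "e' = e + pv n" by (metis add.commute diff_add_cancel)
  have "conv (cinv g) (twist e g) n \<noteq> 0" using nz unfolding cr e' conj_by_qmon(1)[OF e] by auto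
  moreover have "conv (cinv g) (twist e g) \<in> unip {n. npair n y = 0}"
    by (intro conv_in_unip cinv_in_unip twist_in_unip M gU)
  ultimately have "npair n y = 0" using unip_outside by fastforce
  then show ?thesis using that e' by blast
qed

section \<open>The negative coefficient\<close>

definition \<alpha>23 :: coeff where "\<alpha>23 = v ^ 2 - 1 + inverse v ^ 2"

lemma proper_1_1: "proper (1, 1) = {(1, 0), (0, 1)}"
  by (auto simp: proper_def below_def zero_prod_def le_Suc_eq One_nat_def)

lemma proper_axes: "proper (1, 0) = {}" "proper (0, 1) = {}"
  by (auto simp: proper_def below_def zero_prod_def le_Suc_eq One_nat_def)

lemma E_coeffs: "E0 (1, 0) = 1 / (v ^ 3 - inverse v ^ 3)" "E1 (0, 1) = 1 / (v ^ 2 - inverse v ^ 2)"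
proof -
  have n: "(1::nat, 0::nat) \<noteq> 0" "(0::nat, 1::nat) \<noteq> 0" by (auto simp: zero_prod_def)
  show "E0 (1, 0) = 1 / (v ^ 3 - inverse v ^ 3)" "E1 (0, 1) = 1 / (v ^ 2 - inverse v ^ 2)"
    using ray_nscale[OF n(1), of _ 1] ray_nscale[OF n(2), of _ 1]
    by (simp_all add: E0_def E1_def qdilog_v power_inverse)
qed

lemma tn_basis: "tn (1, 0) (0, 1) = v ^ 6" "tn (0, 1) (1, 0) = inverse v ^ 6"
proof -
  show "tn (1, 0) (0, 1) = v ^ 6"
    by (simp add: tn_def tw_def pv_def Lam_S23)
  show "tn (0, 1) (1, 0) = inverse v ^ 6"
    by (simp add: tn_def tw_def pv_def Lam_S23 power_int_def)
qed

text \<open>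
  On the ray orthogonal to \<open>e\<^sub>0 + e\<^sub>1\<close> the vector \<open>e\<^sub>1\<close> is negative and \<open>e\<^sub>0\<close> is positive, so \<open>T = E0 E1\<close> is to be
  rewritten with the \<open>e\<^sub>1\<close>-term first. In bidegree \<open>(1, 1)\<close> the error is the commutator of the two initial terms.
\<close>

lemma jump_1_1:
  assumes y: "npair (1, 1) y = 0" "y 0 > 0"
  shows "jump_at y (1, 1) = E0 (1, 0) * E1 (0, 1) * (v ^ 6 - inverse v ^ 6)"
    "jump_at y (1, 0) = 0" "jump_at y (0, 1) = 0"
proof -
  have nz: "(1, 1) \<noteq> (0::nat \<times> nat)" "(1, 0) \<noteq> (0::nat \<times> nat)" "(0, 1) \<noteq> (0::nat \<times> nat)"
    by (auto simp: zero_prod_def)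
  have y1: "y 1 < 0" using y by (simp add: npair_def)
  show J: "jump_at y (1, 0) = 0" "jump_at y (0, 1) = 0"
    using unip_outside[OF jump_at(1)[of y]] nz y y1 by (simp_all add: npair_def)
  have in_C: "(0, 1) \<in> Cle y" "(1, 0) \<notin> Cle y" "(1, 1) \<in> Cle y" "(1, 1) \<notin> Cneg y"
    using y y1 by (simp_all add: Cle_def Cneg_def npair_def)
  have "lower (Cle y) T23 (1, 1) = conv (potential y) (jump_at y) (1, 1)" using jump_at(2) by simp
  also have "\<dots> = jump_at y (1, 1)"
    using nz in_C J by (simp add: conv_expand proper_1_1) (simp add: potential_def lower_def)
  finally have "jump_at y (1, 1) = factor_coeff (Cle y) T23 (1, 1)"
    using in_C nz by (simp add: lower_def)
  also have "\<dots> = T23 (1, 1) - factor_coeff (Cle y) T23 (0, 1) * factor_coeff (Cle y) T23 (1, 0) * tn (0, 1) (1, 0)"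
    using in_C by (subst factor_coeff.simps) (simp add: proper_1_1)
  also have "factor_coeff (Cle y) T23 (0, 1) = E1 (0, 1)"
    by (subst factor_coeff.simps) (simp add: proper_axes T23_axes)
  also have "factor_coeff (Cle y) T23 (1, 0) = E0 (1, 0)"
    by (subst factor_coeff.simps) (simp add: proper_axes T23_axes)
  also have "T23 (1, 1) = E0 (1, 0) * E1 (0, 1) * tn (1, 0) (0, 1)"
    using nz by (simp add: T23_def conv_expand proper_1_1 E_outside)
  finally show "jump_at y (1, 1) = E0 (1, 0) * E1 (0, 1) * (v ^ 6 - inverse v ^ 6)"
    by (simp add: tn_basis right_diff_distrib mult.commute)
qed

lemma alpha_eq: "E0 (1, 0) * E1 (0, 1) * (v ^ 6 - inverse v ^ 6) * (v - inverse v) = \<alpha>23"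
proof -
  define i where "i = inverse v"
  have vi: "v * i = 1" by (simp add: i_def)
  have nz: "v ^ k - i ^ k \<noteq> 0" if "k > 0" for k
  proof
    assume "v ^ k - i ^ k = 0"
    then have "v ^ k * v ^ k = (v * i) ^ k" by (simp add: power_mult_distrib)
    then show False using that vi by (simp flip: power_add)
  qed
  have "(v ^ 6 - i ^ 6) * (v - i) = (v ^ 2 - 1 + i ^ 2) * ((v ^ 3 - i ^ 3) * (v ^ 2 - i ^ 2))"
    using vi by algebra
  then show ?thesis
    using nz[of 3] nz[of 2] by (simp add: E_coeffs \<alpha>23_def flip: i_def)
qed

abbreviation m23 :: lvec where "m23 \<equiv> mv 3 (- 5)"
abbreviation u23 :: lvec where "u23 \<equiv> mv 1 (- 2)"

lemma u23_eq: "u23 = m23 + pv (1, 1)" by (simp add: pv_def)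

text \<open>
  Conjugation by \<open>1 + x A\<^bsup>p\<^esup> + \<dots>\<close> adds \<open>x\<close> times the commutator of \<open>A\<^bsup>p\<^esup>\<close> and \<open>A\<^sup>m\<close>, and the relevant value of
  \<open>\<Lambda>\<close> is \<open>-1\<close>.
\<close>

lemma crossing_alpha:
  assumes w: "w \<in> D23" "y \<in> wsupp w" and y: "npair (1, 1) y = 0" "y 0 > 0"
  shows "crossing S23 D23 y (- real_vec m23) (qmono 1 m23) u23 = \<alpha>23"
proof -
  have y0: "y \<noteq> 0" using y by auto
  obtain n where n: "n \<noteq> 0" "wnormal w = nv n" "wsupp w \<subseteq> {x \<in> M_real S23. npair n x = 0}"
    using wall_normal[OF w(1)] by metis
  have M: "y \<in> M_real S23" "npair n y = 0" using n w by auto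
  have "npair (1, 1) (real_vec m23) < 0" by (simp add: npair_def real_vec_def)
  \<comment> \<open>The normal of the wall is parallel to \<open>(1, 1)\<close>, hence the crossing has negative sign.\<close>
  then have neg: "npair n (real_vec m23) < 0"
    using npair_proportional[OF M(1) y0 _ y(1) n(1) M(2)] by (simp add: zero_prod_def)
  let ?J = "jump_at y"
  have "crossing S23 D23 y (- real_vec m23) (qmono 1 m23) = coef (conj_by (cinv ?J) (qmon 1 m23))"
    using crossing_wall[OF w y0, of "- real_vec m23" "qmon 1 m23"] neg
    by (simp add: coef_qmon n(2) pairing_nv signed_def)
  then have "crossing S23 D23 y (- real_vec m23) (qmono 1 m23) u23 =
      conv ?J (twist m23 (cinv ?J)) (1, 1) * tw (pv (1, 1)) m23"
    unfolding u23_eq by (simp add: conj_by_qmon cinv_cinv)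
  also have "conv ?J (twist m23 (cinv ?J)) (1, 1) = ?J (1, 1) - ?J (1, 1) * tw m23 (pv (1, 1)) ^ 2"
  proof -
    have nz: "(1, 1) \<noteq> (0::nat \<times> nat)" by (simp add: zero_prod_def)
    have "cinv ?J (1, 1) = - ?J (1, 1)"
      using nz jump_1_1(2,3)[OF y] by (subst cinv.simps) (simp add: proper_1_1)
    then show ?thesis
      using nz jump_1_1(2,3)[OF y] by (simp add: conv_expand proper_1_1 twist_def cinv_0)
  qed
  also have "tw m23 (pv (1, 1)) = inverse v"
    by (simp add: tw_def Lam_S23 pv_def power_int_minus)
  also have "tw (pv (1, 1)) m23 = v"
    by (simp add: tw_def Lam_S23 pv_def)
  also have "(?J (1, 1) - ?J (1, 1) * inverse v ^ 2) * v = ?J (1, 1) * (v - inverse v)"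
    by (simp add: power2_eq_square algebra_simps)
  also have "\<dots> = \<alpha>23" unfolding jump_1_1(1)[OF y] by (rule alpha_eq)
  finally show ?thesis .
qed

lemma v_powi_mult: "v ^ N * q_half powi k = v powi (int N - k)"
  by (simp add: q_half_def power_int_inverse power_int_diff field_simps)

lemma alpha_laurent: "\<alpha>23 \<in> laurent_in_q_half UNIV"
  unfolding laurent_in_q_half_def mem_Collect_eq
proof (intro exI conjI)
  show "\<alpha>23 = (\<Sum>k\<in>{- 2, 0, 2}. of_int (if k = 0 then - 1 else 1) * q_half powi k)"
    by (simp add: \<alpha>23_def q_half_def power_int_def)
qed auto

text \<open>
  After multiplication by a large power of \<open>v\<close>, compare the coefficient of \<open>v\<^sup>N\<close> in an identity between polynomials.
\<close>

lemma alpha_not_positive: "\<alpha>23 \<notin> laurent_in_q_half {0..}"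
proof
  assume "\<alpha>23 \<in> laurent_in_q_half {0..}"
  then obtain K :: "int set" and a where K: "finite K" "\<forall>k\<in>K. a k \<in> {0..}"
    "\<alpha>23 = (\<Sum>k\<in>K. of_int (a k) * q_half powi k)"
    by (auto simp: laurent_in_q_half_def)
  define N where "N = 2 + nat (\<Sum>k\<in>K. \<bar>k\<bar>)"
  have N: "k \<le> int N" if "k \<in> K" for k
  proof -
    have "\<bar>k\<bar> \<le> (\<Sum>k\<in>K. \<bar>k\<bar>)" by (rule member_le_sum[OF that _ K(1)]) auto
    then show ?thesis by (simp add: N_def)
  qed
  obtain M where M: "N = M + 2" by (metis N_def add.commute)
  have "v ^ N * \<alpha>23 = v ^ (N + 2) - v ^ N + v ^ M"
    by (simp add: \<alpha>23_def M power_add field_simps power2_eq_square)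
  also have "\<dots> = to_fract (monom 1 (N + 2) - monom 1 N + monom 1 M)"
    by (simp only: v_power to_fract_add to_fract_diff)
  finally have 1: "v ^ N * \<alpha>23 = to_fract (monom 1 (N + 2) - monom 1 N + monom 1 M)" .
  have of_int_fract: "(of_int i :: coeff) = to_fract [:of_int i:]" for i
  proof -
    have nat: "(of_nat n :: coeff) = to_fract (of_nat n)" for n by (induction n) simp_all
    have "(of_int i :: coeff) = to_fract (of_int i)"
      by (cases i rule: int_cases2) (simp_all add: nat)
    then show ?thesis by (simp add: of_int_poly)
  qed
  have "v ^ N * \<alpha>23 = (\<Sum>k\<in>K. of_int (a k) * (v ^ N * q_half powi k))"
    by (simp add: K(3) sum_distrib_left algebra_simps)
  also have "\<dots> = (\<Sum>k\<in>K. to_fract (monom (of_int (a k)) (nat (int N - k))))"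
  proof (rule sum.cong[OF refl])
    fix k assume "k \<in> K"
    then have "v ^ N * q_half powi k = v ^ nat (int N - k)"
      using N[of k] unfolding v_powi_mult by (simp add: power_int_def)
    then show "of_int (a k) * (v ^ N * q_half powi k) = to_fract (monom (of_int (a k)) (nat (int N - k)))"
      by (simp add: of_int_fract v_power smult_monom flip: to_fract_mult)
  qed
  also have "\<dots> = to_fract (\<Sum>k\<in>K. monom (of_int (a k)) (nat (int N - k)))"
    using K(1) by (induction K rule: finite_induct) simp_all
  finally have "monom 1 (N + 2) - monom 1 N + monom 1 M = (\<Sum>k\<in>K. monom (of_int (a k) :: rat) (nat (int N - k)))"
    unfolding 1 by (simp only: to_fract_eq_iff)
  then have "coeff (monom 1 (N + 2) - monom 1 N + monom 1 M) N =
      coeff (\<Sum>k\<in>K. monom (of_int (a k) :: rat) (nat (int N - k))) N" by simp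
  then have "- 1 = (\<Sum>k\<in>K. if nat (int N - k) = N then of_int (a k) else (0::rat))"
    by (simp add: M coeff_sum)
  moreover have "(\<Sum>k\<in>K. if nat (int N - k) = N then of_int (a k) else (0::rat)) \<ge> 0"
    using K(2) by (intro sum_nonneg) auto
  ultimately show False by simp
qed

section \<open>Broken lines\<close>

lemma chamber_point:
  assumes "general_point S23 Q" "Q \<in> initial_chamber S23"
  shows "Q \<in> M_real S23" "Q 0 > 0" "Q 1 > 0"
proof -
  show "Q \<in> M_real S23" using assms by (auto simp: general_point_def)
  have ge: "0 \<le> npair (1, 0) Q" "0 \<le> npair (0, 1) Q"
    using assms(2) by (auto simp: initial_chamber_def unit_vec_nv pairing_nv)
  have "nv (1, 0) \<noteq> 0" "nv (0, 1) \<noteq> 0" by (simp_all add: nv_def)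
  then have "npair (1, 0) Q \<noteq> 0" "npair (0, 1) Q \<noteq> 0"
    using assms(1) by (auto simp: general_point_def simp flip: pairing_nv)
  then show "Q 0 > 0" "Q 1 > 0" using ge by (auto simp: npair_def)
qed

lemma alpha_nz: "\<alpha>23 \<noteq> 0"
  using alpha_not_positive by (auto simp: laurent_in_q_half_def)

definition the_line :: "rvec \<Rightarrow> (real \<times> coeff \<times> lvec) list" where
  "the_line Q = [(- (3 * Q 0 + 2 * Q 1), 1, m23), (0, \<alpha>23, u23)]"

lemma the_line_broken:
  assumes Q: "Q \<in> M_real S23" "Q 0 > 0" "Q 1 > 0"
  shows "broken_line S23 D23 m23 Q (the_line Q)"
proof -
  define s0 where "s0 = - (3 * Q 0 + 2 * Q 1)"
  have s0: "s0 < 0" using Q by (simp add: s0_def)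
  define \<gamma> :: "real \<Rightarrow> rvec" where
    "\<gamma> t = (\<lambda>i. if t \<le> s0 then Q i - s0 * real_of_int (u23 i) - (t - s0) * real_of_int (m23 i)
       else Q i - t * real_of_int (u23 i))" for t
  have L: "the_line Q = [(s0, 1, m23), (0, \<alpha>23, u23)]" by (simp add: the_line_def s0_def)
  have Qi: "Q i = 0" if "i \<noteq> 0" "i \<noteq> 1" for i using Q(1) that by (auto simp: M_real_S23)
  have M: "\<gamma> t \<in> M_real S23" for t by (auto simp: M_real_S23 \<gamma>_def Qi mv_def)
  have pos: "\<gamma> t 0 > 0" if "t \<le> 0" for t using that Q s0 by (auto simp: \<gamma>_def)
  have nsing: "\<gamma> t \<in> M_real S23 - sing_locus S23 D23" if "t \<le> 0" for t
    using M pos[OF that] by (auto simp: sing_locus_D23)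
  have \<gamma>s0: "\<gamma> s0 0 = Q 0 - s0" "\<gamma> s0 1 = Q 1 + 2 * s0" by (simp_all add: \<gamma>_def)
  have on: "npair (1, 1) (\<gamma> s0) = 0" unfolding npair_def \<gamma>s0 by (simp add: s0_def field_simps)
  have w: "out_wall (1, 1) \<in> D23" by (auto simp: D23_def prim_def)
  have mem: "\<gamma> s0 \<in> wsupp (out_wall (1, 1))"
    using M on pos[of s0] s0 by (simp add: wsupp_out)
  have cr: "crossing S23 D23 (\<gamma> s0) (- real_vec m23) (qmono 1 m23) u23 = \<alpha>23"
    using crossing_alpha[OF w mem on] pos s0 by simp
  have all2: "(\<forall>j\<le>Suc 0. P j) \<longleftrightarrow> P 0 \<and> P (Suc 0)" for P by (auto simp: le_Suc_eq)
  have \<gamma>0: "\<gamma> 0 = Q" using s0 by (auto simp: \<gamma>_def)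
  have seg: "\<gamma> t i = \<gamma> s0 i - (t - s0) * real_of_int (m23 i)" if "t \<le> s0" for t i
    using that by (simp add: \<gamma>_def)
  have seg': "\<gamma> t i = \<gamma> 0 i - (t - 0) * real_of_int (u23 i)" if "t \<le> 0" "s0 \<le> t" for t i
    using that unfolding \<gamma>0 by (auto simp: \<gamma>_def)
  show ?thesis
    unfolding broken_line_def Let_def L
    by (intro exI[of _ \<gamma>])
      (use s0 alpha_nz \<gamma>0 nsing seg seg' w mem cr in \<open>auto simp: all2\<close>)
qed

text \<open>
  Exponents move to the left at each bend. As the last exponent points to the right, all of them do, and the line
  stays in the right half plane. There every orthogonal exponent involves \<open>e\<^sub>1\<close>, so each bend decreases the
  first coordinate by at least \<open>2\<close>, and from \<open>3\<close> to \<open>1\<close> there is room for one bend only. Its time is determined by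
  the equation of the wall.
\<close>

lemma the_line_unique:
  assumes Q: "Q \<in> M_real S23" "Q 0 > 0" "Q 1 > 0"
    and bl: "broken_line S23 D23 m23 Q L" and last: "snd (snd (last L)) = u23"
  shows "L = the_line Q"
proof -
  define s c e r where "s = (\<lambda>j. fst (L ! j))" and "c = (\<lambda>j. fst (snd (L ! j)))"
    and "e = (\<lambda>j. snd (snd (L ! j)))" and "r = length L - 1"
  from bl obtain \<gamma> :: "real \<Rightarrow> rvec" where G: "L \<noteq> [] \<and> s r = 0 \<and> (\<forall>j<r. s j < s (Suc j)) \<and>
          c 0 = 1 \<and> e 0 = m23 \<and> (\<forall>j\<le>r. c j \<noteq> 0) \<and>
          \<gamma> 0 = Q \<and> (\<forall>t\<le>0. \<gamma> t \<in> M_real S23 - sing_locus S23 D23) \<and>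
          (\<forall>j\<le>r. \<forall>t\<le>s j. (0 < j \<longrightarrow> s (j - 1) \<le> t) \<longrightarrow>
             (\<forall>i. \<gamma> t i = \<gamma> (s j) i - (t - s j) * real_of_int (e j i))) \<and>
          (\<forall>j<r. e (Suc j) \<noteq> e j \<and> (\<exists>w\<in>D23. \<gamma> (s j) \<in> wsupp w) \<and>
             c (Suc j) =
               crossing S23 D23 (\<gamma> (s j)) (- real_vec (e j)) (qmono (c j) (e j)) (e (Suc j)))"
    unfolding broken_line_def Let_def s_def c_def e_def r_def by (elim exE)
  have L: "L \<noteq> []" and sr: "s r = 0" and smono: "\<And>j. j < r \<Longrightarrow> s j < s (Suc j)"
    and c0: "c 0 = 1" and e0: "e 0 = m23" and cnz: "\<And>j. j \<le> r \<Longrightarrow> c j \<noteq> 0"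
    and \<gamma>0: "\<gamma> 0 = Q" and ns: "\<And>t. t \<le> 0 \<Longrightarrow> \<gamma> t \<in> M_real S23 - sing_locus S23 D23"
    using G by (blast, blast, blast, blast, blast, blast, blast, blast)
  have seg: "\<gamma> t i = \<gamma> (s j) i - (t - s j) * real_of_int (e j i)"
    if "j \<le> r" "t \<le> s j" "0 < j \<Longrightarrow> s (j - 1) \<le> t" for j t i
    using G that by blast
  have bend: "e (Suc j) \<noteq> e j \<and> (\<exists>w\<in>D23. \<gamma> (s j) \<in> wsupp w) \<and>
       c (Suc j) = crossing S23 D23 (\<gamma> (s j)) (- real_vec (e j)) (qmono (c j) (e j)) (e (Suc j))"
    if "j < r" for j
    using G that by blast
  have er: "e r = u23" using last L by (simp add: e_def r_def last_conv_nth)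
  have s_le: "s j \<le> 0" if "j \<le> r" for j
    using that
  proof (induction j rule: inc_induct)
    case (step j)
    then show ?case using smono[of j] by simp
  qed (use sr in simp)
  have y: "\<gamma> (s j) \<in> M_real S23" "\<gamma> (s j) \<noteq> 0" if "j \<le> r" for j
    using ns[OF s_le[OF that]] by (auto simp: sing_locus_D23)
  have next_exponent: "\<exists>n. n \<noteq> 0 \<and> e (Suc j) = e j + pv n \<and> npair n (\<gamma> (s j)) = 0"
    if j: "j < r" and ej: "e j \<in> M_lat S23" for j
  proof -
    obtain w where w: "w \<in> D23" "\<gamma> (s j) \<in> wsupp w" using bend[OF j] by blast
    have "crossing S23 D23 (\<gamma> (s j)) (- real_vec (e j)) (qmono (c j) (e j)) (e (Suc j)) \<noteq> 0"
      using bend[OF j] cnz[of "Suc j"] j by simp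
    then obtain n where n: "e (Suc j) = e j + pv n" "npair n (\<gamma> (s j)) = 0"
      using crossing_support[OF w y(2) ej] j by (metis less_imp_le)
    then have "n \<noteq> 0" using bend[OF j] by auto
    then show ?thesis using n by blast
  qed
  have eM: "e j \<in> M_lat S23" if "j \<le> r" for j
    using that
  proof (induction j)
    case (Suc j)
    then obtain n where "e (Suc j) = e j + pv n" using next_exponent[of j] by auto
    moreover have "pv n \<in> M_lat S23" by (simp add: pv_def)
    moreover have "e j \<in> M_lat S23" using Suc by simp
    ultimately show ?case using M_lat_S23_add by metis
  qed (simp add: e0)
  have e_ge: "e j 0 \<ge> 1" if "j \<le> r" for j
    using that
  proof (induction j rule: inc_induct)
    case (step j)
    obtain n where "e (Suc j) = e j + pv n" using step.hyps next_exponent[of j] eM[of j] by auto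
    then show ?case using step.IH by (simp add: pv_def)
  qed (simp add: er)
  have pos: "\<gamma> (s j) 0 > 0" if "j \<le> r" for j
    using that
  proof (induction j rule: inc_induct)
    case base
    then show ?case using sr \<gamma>0 Q by simp
  next
    case (step j)
    have "\<gamma> (s j) 0 = \<gamma> (s (Suc j)) 0 - (s j - s (Suc j)) * real_of_int (e (Suc j) 0)"
      using seg[of "Suc j" "s j" 0] smono[of j] step.hyps by simp
    moreover have "(s j - s (Suc j)) * real_of_int (e (Suc j) 0) \<le> 0"
      using smono[of j] e_ge[of "Suc j"] step.hyps by (intro mult_nonpos_nonneg) auto
    ultimately show ?case using step.IH by simp
  qed
  have drop: "e (Suc j) 0 \<le> e j 0 - 2" if j: "j < r" for j
  proof -
    obtain n where n: "n \<noteq> 0" "e (Suc j) = e j + pv n" "npair n (\<gamma> (s j)) = 0"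
      using next_exponent[OF j] eM[of j] j by auto
    have "snd n \<noteq> 0"
    proof
      assume "snd n = 0"
      then have "real (fst n) * (\<gamma> (s j) 0 / 2) = 0" using n(3) by (simp add: npair_def)
      then have "fst n = 0" using pos[of j] j by simp
      then show False using n(1) \<open>snd n = 0\<close> by (simp add: prod_eq_iff)
    qed
    then show ?thesis using n(2) by (simp add: pv_def)
  qed
  have "e j 0 \<le> 3 - 2 * int j" if "j \<le> r" for j
    using that
  proof (induction j)
    case (Suc j)
    then show ?case using drop[of j] by simp
  qed (simp add: e0)
  from this[of r] have "r \<le> 1" using er by simp
  moreover have "r \<noteq> 0"
  proof
    assume "r = 0"
    then have "m23 = u23" using e0 er by simp
    then show False by simp
  qed
  ultimately have r: "r = 1" by simp
  obtain n where n: "u23 = m23 + pv n" "npair n (\<gamma> (s 0)) = 0"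
    using next_exponent[of 0] r eM[of 0] e0 er by (auto simp: One_nat_def)
  have "n = (1, 1)" using n(1) by (simp add: pv_def prod_eq_iff)
  then have p: "npair (1, 1) (\<gamma> (s 0)) = 0" using n by simp
  have "\<gamma> (s 0) i = Q i - s 0 * real_of_int (u23 i)" for i
    using seg[of 1 "s 0" i] smono[of 0] r sr er \<gamma>0 by (simp add: One_nat_def)
  then have "(Q 0 - s 0) / 2 + (Q 1 + s 0 * 2) / 3 = 0" using p by (simp add: npair_def)
  then have s0: "s 0 = - (3 * Q 0 + 2 * Q 1)" by (simp add: field_simps)
  obtain w where w: "w \<in> D23" "\<gamma> (s 0) \<in> wsupp w" using bend[of 0] r by auto
  have c1: "c 1 = \<alpha>23"
    using bend[of 0] crossing_alpha[OF w p pos[of 0]] r er e0 c0 by (simp add: One_nat_def)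
  have "length L = 2" using r L by (cases L) (auto simp: r_def)
  then have "L = [L ! 0, L ! 1]" by (auto simp: list_eq_iff_nth_eq less_Suc_eq numeral_2_eq_2 One_nat_def)
  moreover have "L ! 0 = (s 0, c 0, e 0)" "L ! 1 = (s 1, c 1, e 1)" by (simp_all add: s_def c_def e_def)
  ultimately show ?thesis using s0 c0 e0 sr r c1 er by (simp add: the_line_def)
qed

lemma theta_D23:
  assumes "general_point S23 Q" "Q \<in> initial_chamber S23"
  shows "theta S23 D23 Q m23 u23 = \<alpha>23"
proof -
  note Q = chamber_point[OF assms]
  have last: "snd (snd (last (the_line Q))) = u23" by (simp add: the_line_def)
  have "{L. broken_line S23 D23 m23 Q L \<and> snd (snd (last L)) = u23} = {the_line Q}"
    using the_line_broken[OF Q] the_line_unique[OF Q] last by blast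
  then show ?thesis by (simp add: theta_def the_line_def)
qed

theorem proposition2p9:
  shows "\<exists>(S :: seed) (D :: wall set) (m :: lvec) (u :: lvec) (\<alpha> :: coeff).
    fixed_data S \<and> compatible_form S \<and> quantum_cluster_scattering_diagram S D \<and>
    m \<in> M_lat S \<and> u \<in> M_lat S \<and>
    (\<forall>Q. general_point S Q \<and> Q \<in> initial_chamber S \<longrightarrow> theta S D Q m u = \<alpha>) \<and>
    \<alpha> \<in> laurent_in_q_half UNIV \<and> \<alpha> \<notin> laurent_in_q_half {0..}"
  using fixed_data_S23 compatible_form_S23 qcsd_D23 theta_D23 alpha_laurent alpha_not_positive
    mv_in_M_lat by blast

end
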